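(* Let $x\in B_n$ be such that $USS(x)$ is minimal. Then one of the following conditions holds: (i) $USS(x)$ has two orbits under cycling, conjugate to each other by $\Delta$ (that is, $USS(x)=\mathcal O_1\sqcup\mathcal O_2$ with $\mathcal O_1,\mathcal O_2$ cycling orbits and $\tau(\mathcal O_1)=\mathcal O_2$); (ii) $USS(x)$ has one orbit under cycling, conjugate to itself by $\Delta$ (that is, $USS(x)=\mathcal O$ is a single cycling orbit and $\tau(\mathcal O)=\mathcal O$).
   Context: $B_n$ is the braid group with Artin generators $\sigma_1,\dots,\sigma_{n-1}$; $B_n^+$ is the submonoid of products of positive powers of the $\sigma_i$; $\Delta=(\sigma_1\cdots\sigma_{n-1})(\sigma_1\cdots\sigma_{n-2})\cdots(\sigma_1\sigma_2)\sigma_1$. Write $a\preccurlyeq b$ ("$a$ is a prefix of $b$") if $a^{-1}b\in B_n^+$; this is a lattice order with meet $\wedge$. The simple elements are the $s$ with $1\preccurlyeq s\preccurlyeq\Delta$. Put $\tau(x)=\Delta^{-1}x\Delta$, $x^\alpha=\alpha^{-1}x\alpha$, and $\partial(s)=s^{-1}\Delta$ for $s$ simple. A product $st$ of simple elements is left-weighted if $\partial(s)\wedge t=1$. Every $x\in B_n$ has a unique left normal form $x=\Delta^p x_1\cdots x_l$ with $p\in\mathbb Z$, $l\ge0$, each $x_i$ simple and different from $1,\Delta$, and each $x_ix_{i+1}$ left-weighted. Put $\ell(x)=l$ (canonical length). If $l>0$ let $\iota(x)=\tau^{-p}(x_1)$ and $\varphi(x)=x_l$; also $\iota(\Delta^p)=1$,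 $\varphi(\Delta^p)=\Delta$. One has $\iota(x^{-1})=\partial(\varphi(x))$. Cycling is $\mathbf c(x)=\iota(x)^{-1}x\,\iota(x)$. $\ell_s(x)$ is the minimal canonical length among conjugates of $x$; $SSS(x)$ is the set of conjugates of $x$ of canonical length $\ell_s(x)$; the ultra summit set is $USS(x)=\{y\in SSS(x):\mathbf c^m(y)=y\text{ for some }m>0\}$, a finite disjoint union of closed orbits under cycling. For $y\in USS(x)$, a simple element $s\ne1$ is a minimal simple element for $y$ (with respect to $USS(x)$) if $y^s\in USS(x)$ and $y^t\notin USS(x)$ for every $t$ with $1\ne t\preccurlyeq s$, $t\neq s$. The directed graph $\Gamma_x$ has vertex set $USS(x)$ and an arrow labelled $s$ from $y$ to $y^s$ for each minimal simple element $s$ for $y$. An arrow $s$ starting at $y$ is black if $s\preccurlyeq\iota(y)$ and grey if $s\preccurlyeq\iota(y^{-1})$ (a priori it may be both). $USS(x)$ is called minimal if $\ell_s(x)>1$ and, for every $y\in USS(x)$, there is only one black arrow starting at $y$, and it is labelled $\iota(y)$, and only one grey arrow starting at $y$, and it is labelled $\iota(y^{-1})=\partial(\varphi(y))$. *)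

theory Defs
  imports "HOL-Algebra.Group" "HOL-Algebra.Lattice"
begin

section \<open>The braid group, by its Artin presentation\<close>

text \<open>
  A word is a list of letters: \<open>(True, i)\<close> stands for \<open>\<sigma>\<^sub>i\<close>,
  \<open>(False, i)\<close> for its inverse.
\<close>

type_synonym braid_word = "(bool \<times> nat) list"

definition braid_words :: "nat \<Rightarrow> braid_word set" where
  "braid_words n = lists (UNIV \<times> {1..<n})"

inductive artin_equiv :: "nat \<Rightarrow> braid_word \<Rightarrow> braid_word \<Rightarrow> bool" for n :: nat where
  refl: "w \<in> braid_words n \<Longrightarrow> artin_equiv n w w"
| sym: "artin_equiv n u v \<Longrightarrow> artin_equiv n v u"
| trans: "artin_equiv n u v \<Longrightarrow> artin_equiv n v w \<Longrightarrow> artin_equiv n u w"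
| append: "artin_equiv n u u' \<Longrightarrow> artin_equiv n v v' \<Longrightarrow> artin_equiv n (u @ v) (u' @ v')"
| cancel: "1 \<le> i \<Longrightarrow> i < n \<Longrightarrow> artin_equiv n [(b, i), (\<not> b, i)] []"
| commute: "1 \<le> i \<Longrightarrow> i + 2 \<le> j \<Longrightarrow> j < n \<Longrightarrow>
    artin_equiv n [(True, i), (True, j)] [(True, j), (True, i)]"
| braid: "1 \<le> i \<Longrightarrow> i + 1 < n \<Longrightarrow>
    artin_equiv n [(True, i), (True, i + 1), (True, i)]
                  [(True, i + 1), (True, i), (True, i + 1)]"

text \<open>The braid with a given representing word is the equivalence class of that word.\<close>

type_synonym braid = "braid_word set"

definition braid_of :: "nat \<Rightarrow> braid_word \<Rightarrow> braid" where
  "braid_of n w = {v. artin_equiv n w v}"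

definition braid_group :: "nat \<Rightarrow> braid monoid" where
  "braid_group n =
     \<lparr>carrier = braid_words n // {(u, v). artin_equiv n u v},
      mult = (\<lambda>a b. \<Union>u\<in>a. \<Union>v\<in>b. braid_of n (u @ v)),
      one = braid_of n []\<rparr>"

lemma braid_words_append:
  "u \<in> braid_words n \<Longrightarrow> v \<in> braid_words n \<Longrightarrow> u @ v \<in> braid_words n"
  by (simp add: braid_words_def)

lemma artin_equiv_words:
  assumes "artin_equiv n u v"
  shows "u \<in> braid_words n" "v \<in> braid_words n"
  using assms by (induction rule: artin_equiv.induct) (auto simp: braid_words_def)

lemma braid_of_eqI:
  assumes "artin_equiv n u v"
  shows "braid_of n u = braid_of n v"
proof -
  have "artin_equiv n u w \<longleftrightarrow> artin_equiv n v w" for w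
    using artin_equiv.trans[OF assms] artin_equiv.trans[OF artin_equiv.sym[OF assms]] by iprover
  then show ?thesis by (simp add: braid_of_def)
qed

lemma braid_of_eq_iff:
  assumes "v \<in> braid_words n"
  shows "braid_of n u = braid_of n v \<longleftrightarrow> artin_equiv n u v"
proof
  assume "braid_of n u = braid_of n v"
  then have "v \<in> braid_of n u"
    using artin_equiv.refl[OF assms] by (simp add: braid_of_def)
  then show "artin_equiv n u v" by (simp add: braid_of_def)
qed (rule braid_of_eqI)

lemma carrier_braid_group: "carrier (braid_group n) = braid_of n ` braid_words n"
  unfolding braid_group_def quotient_def braid_of_def by auto

lemma one_braid_group: "\<one>\<^bsub>braid_group n\<^esub> = braid_of n []"
  unfolding braid_group_def by simp

lemma mult_braid_of:
  assumes "u \<in> braid_words n" "v \<in> braid_words n"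
  shows "braid_of n u \<otimes>\<^bsub>braid_group n\<^esub> braid_of n v = braid_of n (u @ v)"
proof -
  have "braid_of n (u' @ v') = braid_of n (u @ v)"
    if "u' \<in> braid_of n u" "v' \<in> braid_of n v" for u' v'
    using braid_of_eqI[OF artin_equiv.append, of n u u' v v'] that
    by (simp add: braid_of_def)
  moreover have "u \<in> braid_of n u" "v \<in> braid_of n v"
    using assms by (simp_all add: braid_of_def artin_equiv.refl)
  ultimately have "(\<Union>u'\<in>braid_of n u. \<Union>v'\<in>braid_of n v. braid_of n (u' @ v')) = braid_of n (u @ v)"
    by blast
  then show ?thesis by (simp add: braid_group_def)
qed

lemma artin_equiv_inverse:
  assumes "w \<in> braid_words n"
  shows "artin_equiv n (rev (map (\<lambda>(b, i). (\<not> b, i)) w) @ w) []"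
  using assms
proof (induction w)
  case Nil
  then show ?case by (simp add: artin_equiv.refl braid_words_def)
next
  case (Cons a w)
  obtain b i where a: "a = (b, i)" by (cases a)
  let ?r = "rev (map (\<lambda>(b, i). (\<not> b, i)) w)"
  have i: "1 \<le> i" "i < n" and w: "w \<in> braid_words n"
    using Cons.prems by (auto simp: a braid_words_def)
  have r: "?r \<in> braid_words n"
    using w by (auto simp: braid_words_def lists_eq_set)
  have "artin_equiv n [(\<not> b, i), (b, i)] []"
    using artin_equiv.cancel[OF i, of "\<not> b"] by simp
  then have "artin_equiv n (?r @ ([(\<not> b, i), (b, i)] @ w)) (?r @ ([] @ w))"
    by (intro artin_equiv.append artin_equiv.refl r w)
  then show ?case
    using artin_equiv.trans[OF _ Cons.IH[OF w]] by (simp add: a)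
qed

lemma group_braid_group: "group (braid_group n)"
proof (rule groupI)
  fix a b assume "a \<in> carrier (braid_group n)" "b \<in> carrier (braid_group n)"
  then show "a \<otimes>\<^bsub>braid_group n\<^esub> b \<in> carrier (braid_group n)"
    unfolding carrier_braid_group by (auto simp: mult_braid_of braid_words_append)
next
  show "\<one>\<^bsub>braid_group n\<^esub> \<in> carrier (braid_group n)"
    by (auto simp: carrier_braid_group one_braid_group braid_words_def)
next
  fix a b c
  assume "a \<in> carrier (braid_group n)" "b \<in> carrier (braid_group n)"
    "c \<in> carrier (braid_group n)"
  then show "a \<otimes>\<^bsub>braid_group n\<^esub> b \<otimes>\<^bsub>braid_group n\<^esub> c =
      a \<otimes>\<^bsub>braid_group n\<^esub> (b \<otimes>\<^bsub>braid_group n\<^esub> c)"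
    unfolding carrier_braid_group by (auto simp: mult_braid_of braid_words_append)
next
  fix a assume "a \<in> carrier (braid_group n)"
  then show "\<one>\<^bsub>braid_group n\<^esub> \<otimes>\<^bsub>braid_group n\<^esub> a = a"
    using mult_braid_of[of "[]" n]
    unfolding carrier_braid_group one_braid_group by (auto simp: braid_words_def[of n])
next
  fix a assume "a \<in> carrier (braid_group n)"
  then obtain w where w: "w \<in> braid_words n" "a = braid_of n w"
    unfolding carrier_braid_group by auto
  let ?r = "rev (map (\<lambda>(b, i). (\<not> b, i)) w)"
  have r: "?r \<in> braid_words n"
    using w by (auto simp: braid_words_def lists_eq_set)
  show "\<exists>b\<in>carrier (braid_group n). b \<otimes>\<^bsub>braid_group n\<^esub> a = \<one>\<^bsub>braid_group n\<^esub>"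
  proof
    show "braid_of n ?r \<in> carrier (braid_group n)"
      using r by (simp add: carrier_braid_group)
    show "braid_of n ?r \<otimes>\<^bsub>braid_group n\<^esub> a = \<one>\<^bsub>braid_group n\<^esub>"
      using r w braid_of_eqI[OF artin_equiv_inverse[OF w(1)]]
      by (simp add: mult_braid_of one_braid_group)
  qed
qed

section \<open>Garside structure\<close>

definition sigma :: "nat \<Rightarrow> nat \<Rightarrow> braid" where
  "sigma n i = braid_of n [(True, i)]"

definition braid_prod :: "nat \<Rightarrow> braid list \<Rightarrow> braid" where
  "braid_prod n as = foldr (mult (braid_group n)) as \<one>\<^bsub>braid_group n\<^esub>"

definition positive_braids :: "nat \<Rightarrow> braid set" where
  "positive_braids n = {braid_prod n as | as. set as \<subseteq> sigma n ` {1..<n}}"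

definition Delta :: "nat \<Rightarrow> braid" where
  "Delta n = braid_prod n (concat (map (\<lambda>k. map (sigma n) [1..<Suc k]) (rev [1..<n])))"

definition braid_prefix :: "nat \<Rightarrow> braid \<Rightarrow> braid \<Rightarrow> bool" where
  "braid_prefix n a b \<longleftrightarrow> inv\<^bsub>braid_group n\<^esub> a \<otimes>\<^bsub>braid_group n\<^esub> b \<in> positive_braids n"

definition prefix_order :: "nat \<Rightarrow> braid gorder" where
  "prefix_order n =
     \<lparr>carrier = carrier (braid_group n), eq = (=), le = braid_prefix n\<rparr>"

definition simple_braids :: "nat \<Rightarrow> braid set" where
  "simple_braids n = {s \<in> carrier (braid_group n).
     braid_prefix n \<one>\<^bsub>braid_group n\<^esub> s \<and> braid_prefix n s (Delta n)}"

definition conjugate :: "nat \<Rightarrow> braid \<Rightarrow> braid \<Rightarrow> braid" where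
  "conjugate n x a = inv\<^bsub>braid_group n\<^esub> a \<otimes>\<^bsub>braid_group n\<^esub> x \<otimes>\<^bsub>braid_group n\<^esub> a"

definition tau :: "nat \<Rightarrow> braid \<Rightarrow> braid" where
  "tau n x = conjugate n x (Delta n)"

definition complement :: "nat \<Rightarrow> braid \<Rightarrow> braid" where
  "complement n s = inv\<^bsub>braid_group n\<^esub> s \<otimes>\<^bsub>braid_group n\<^esub> Delta n"

definition left_weighted :: "nat \<Rightarrow> braid \<Rightarrow> braid \<Rightarrow> bool" where
  "left_weighted n s t \<longleftrightarrow>
     complement n s \<sqinter>\<^bsub>prefix_order n\<^esub> t = \<one>\<^bsub>braid_group n\<^esub>"

definition left_normal_form :: "nat \<Rightarrow> braid \<Rightarrow> int \<Rightarrow> braid list \<Rightarrow> bool" where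
  "left_normal_form n x p xs \<longleftrightarrow>
     x = Delta n [^]\<^bsub>braid_group n\<^esub> p \<otimes>\<^bsub>braid_group n\<^esub> braid_prod n xs \<and>
     set xs \<subseteq> simple_braids n - {\<one>\<^bsub>braid_group n\<^esub>, Delta n} \<and>
     successively (left_weighted n) xs"

text \<open>
  The definite descriptions below range over the quantity wanted rather than over the normal
  form \<open>(p, xs)\<close> itself: for \<open>n \<le> 1\<close> one has \<open>\<Delta> = 1\<close> and the exponent \<open>p\<close> is not unique.
\<close>

definition canonical_length :: "nat \<Rightarrow> braid \<Rightarrow> nat" where
  "canonical_length n x = (THE l. \<exists>p xs. left_normal_form n x p xs \<and> l = length xs)"

text \<open>\<open>\<tau>\<close> is conjugation by \<open>\<Delta>\<close>, so \<open>\<tau>\<close> to the power \<open>-p\<close> is conjugation by \<open>\<Delta>\<close> to the power \<open>-p\<close>.\<close>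

definition initial_factor :: "nat \<Rightarrow> braid \<Rightarrow> braid" where
  "initial_factor n x = (THE s. \<exists>p xs. left_normal_form n x p xs \<and>
     s = (if xs = [] then \<one>\<^bsub>braid_group n\<^esub>
          else conjugate n (hd xs) (Delta n [^]\<^bsub>braid_group n\<^esub> (- p))))"

section \<open>Ultra summit sets\<close>

definition cycling :: "nat \<Rightarrow> braid \<Rightarrow> braid" where
  "cycling n x = conjugate n x (initial_factor n x)"

definition conjugates :: "nat \<Rightarrow> braid \<Rightarrow> braid set" where
  "conjugates n x = conjugate n x ` carrier (braid_group n)"

definition summit_length :: "nat \<Rightarrow> braid \<Rightarrow> nat" where
  "summit_length n x = (LEAST l. \<exists>y\<in>conjugates n x. l = canonical_length n y)"

definition SSS :: "nat \<Rightarrow> braid \<Rightarrow> braid set" where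
  "SSS n x = {y \<in> conjugates n x. canonical_length n y = summit_length n x}"

definition USS :: "nat \<Rightarrow> braid \<Rightarrow> braid set" where
  "USS n x = {y \<in> SSS n x. \<exists>m>0. (cycling n ^^ m) y = y}"

definition cycling_orbit :: "nat \<Rightarrow> braid \<Rightarrow> braid set" where
  "cycling_orbit n y = {(cycling n ^^ m) y | m. True}"

definition USS_orbits :: "nat \<Rightarrow> braid \<Rightarrow> braid set set" where
  "USS_orbits n x = cycling_orbit n ` USS n x"

text \<open>
  The elements \<open>t\<close> below \<open>s\<close> are the positive ones, i.e. simple elements: prefixes of \<open>s\<close> in the
  whole group include elements such as \<open>s\<close> times negative powers of \<open>\<Delta>\<^sup>2\<close>, which is central.
\<close>

definition minimal_simple :: "nat \<Rightarrow> braid \<Rightarrow> braid \<Rightarrow> braid \<Rightarrow> bool" where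
  "minimal_simple n x y s \<longleftrightarrow>
     s \<in> simple_braids n \<and> s \<noteq> \<one>\<^bsub>braid_group n\<^esub> \<and> conjugate n y s \<in> USS n x \<and>
     (\<forall>t\<in>carrier (braid_group n). t \<noteq> \<one>\<^bsub>braid_group n\<^esub> \<and>
        braid_prefix n \<one>\<^bsub>braid_group n\<^esub> t \<and> braid_prefix n t s \<and> t \<noteq> s \<longrightarrow>
        conjugate n y t \<notin> USS n x)"

text \<open>An arrow of \<open>\<Gamma>\<^sub>x\<close> is a triple (source, label, target).\<close>

definition USS_arrows :: "nat \<Rightarrow> braid \<Rightarrow> (braid \<times> braid \<times> braid) set" where
  "USS_arrows n x =
     {(y, s, conjugate n y s) | y s. y \<in> USS n x \<and> minimal_simple n x y s}"

definition black_arrows_from :: "nat \<Rightarrow> braid \<Rightarrow> braid \<Rightarrow> (braid \<times> braid \<times> braid) set" where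
  "black_arrows_from n x y =
     {(y', s, z) \<in> USS_arrows n x. y' = y \<and> braid_prefix n s (initial_factor n y)}"

definition grey_arrows_from :: "nat \<Rightarrow> braid \<Rightarrow> braid \<Rightarrow> (braid \<times> braid \<times> braid) set" where
  "grey_arrows_from n x y =
     {(y', s, z) \<in> USS_arrows n x.
        y' = y \<and> braid_prefix n s (initial_factor n (inv\<^bsub>braid_group n\<^esub> y))}"

definition USS_minimal :: "nat \<Rightarrow> braid \<Rightarrow> bool" where
  "USS_minimal n x \<longleftrightarrow>
     summit_length n x > 1 \<and>
     (\<forall>y\<in>USS n x.
        (\<exists>z. black_arrows_from n x y = {(y, initial_factor n y, z)}) \<and>
        (\<exists>z. grey_arrows_from n x y = {(y, initial_factor n (inv\<^bsub>braid_group n\<^esub> y), z)}))"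

end

theory Submission imports Defs begin

text \<open>
  Write \<open>U\<close> for the ultra summit set. All its elements lie between the same powers
  \<open>\<Delta>\<^sup>p\<close> and \<open>\<Delta>\<^sup>q\<close>, and \<open>\<iota>(y)\<close> is the meet of \<open>y \<Delta>\<^sup>-\<^sup>p\<close> and \<open>\<Delta>\<close>. The theorem rests on
  two facts about a positive conjugator \<open>a\<close> that carries \<open>y \<in> U\<close> to \<open>y\<^sup>a \<in> U\<close>.

  Convexity: such conjugators are closed under meets (\<open>recurrent_meet\<close>). The transport of
  \<open>a\<close>, that is \<open>\<iota>(y)\<^sup>-\<^sup>1 a \<iota>(y\<^sup>a)\<close>, carries \<open>c(y)\<close> to \<open>c(y\<^sup>a)\<close>. By the formula for \<open>\<iota>\<close> it is
  built from \<open>a\<close> by left translations, right multiplication by powers of \<open>\<Delta>\<close> and meets; all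
  of these commute with meets, so transport does. Repeated transport moves \<open>a\<close> inside the
  finite interval from \<open>1\<close> to a power of \<open>\<Delta>\<close>, so along periodic orbits it brings \<open>a\<close> back to
  itself; if it fixes \<open>a\<close> and \<open>b\<close>, it fixes their meet, whose target is therefore periodic.

  Black or grey: if \<open>s\<close> is simple, \<open>\<Delta>\<^sup>p \<preceq> y\<^sup>s\<close>, and \<open>s\<close> meets both \<open>\<iota>(y)\<close> and \<open>\<iota>(y\<^sup>-\<^sup>1)\<close>
  trivially, then \<open>s = 1\<close> (\<open>black_or_grey\<close>). Indeed \<open>ys\<close> and \<open>y\<close> then have the same initial
  factor \<open>\<iota>(y)\<close>, while \<open>s\<close> is a prefix of the initial factor of \<open>ys = s y\<^sup>s\<close>.

  When \<open>U\<close> is minimal, the two facts show that every nontrivial positive conjugator between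
  elements of \<open>U\<close> begins with the whole of \<open>\<iota>(y)\<close> or the whole of \<open>\<iota>(y\<^sup>-\<^sup>1)\<close>. Hence \<open>U\<close> is swept
  out from one element by the moves \<open>y \<mapsto> y\<^sup>\<iota>\<^sup>(\<^sup>y\<^sup>)\<close>, which is cycling, and \<open>y \<mapsto> z\<close>, the
  conjugation by \<open>\<kappa> = \<iota>(y\<^sup>-\<^sup>1)\<close>. For the latter put \<open>v = \<tau>\<^sup>-\<^sup>1(z)\<close>. The element \<open>\<Delta> \<kappa>\<^sup>-\<^sup>1\<close>
  carries \<open>v\<close> to \<open>y\<close> and is a prefix of \<open>\<iota>(v)\<close>, so by minimality it equals \<open>\<iota>(v)\<close>, and
  \<open>c(v) = y\<close>. As orbits are periodic, \<open>v\<close> is in the orbit of \<open>y\<close>. The second move therefore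
  leads from an orbit to its \<open>\<tau>\<close>-image, and \<open>U = O \<union> \<tau>(O)\<close> for a single orbit \<open>O\<close>
  (\<open>two_orbits\<close>); \<open>\<tau>\<close> is an involution that commutes with cycling, so \<open>O\<close> and \<open>\<tau>(O)\<close> are
  disjoint or equal.

  This argument needs greatest common prefixes in the braid group, which are obtained from
  the presentation. Garside's lemma (\<open>garside_key\<close>) gives cancellation and greatest common
  left divisors in the monoid of positive words modulo positive relations. Writing a braid as
  a positive numerator over a power of the central element \<open>\<Delta>\<^sup>2\<close> shows that this monoid embeds
  in the group (\<open>positive_braid_eq_iff\<close>).
\<close>

section \<open>Positive braids\<close>

abbreviation far :: "nat \<Rightarrow> nat \<Rightarrow> bool" where
  "far i j \<equiv> i + 2 \<le> j \<or> j + 2 \<le> i"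

abbreviation adjacent :: "nat \<Rightarrow> nat \<Rightarrow> bool" where
  "adjacent i j \<equiv> j = Suc i \<or> i = Suc j"

text \<open>
  One application of a positive braid relation inside a word. The letters range over all of
  \<open>nat\<close>, so one monoid serves every number of strands; the relations preserve the set of
  letters, so the words in \<open>\<sigma>\<^sub>1, \<dots>, \<sigma>\<^bsub>n-1\<^esub>\<close> form a submonoid.
\<close>

inductive braid_step :: "nat list \<Rightarrow> nat list \<Rightarrow> bool" where
  commute: "far i j \<Longrightarrow> braid_step (u @ [i, j] @ v) (u @ [j, i] @ v)"
| braid: "adjacent i j \<Longrightarrow> braid_step (u @ [i, j, i] @ v) (u @ [j, i, j] @ v)"

lemma braid_step_sym: "braid_step u v \<Longrightarrow> braid_step v u"
proof (induction rule: braid_step.induct)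
  case (commute i j u v)
  then show ?case by (intro braid_step.commute) auto
next
  case (braid i j u v)
  then show ?case by (intro braid_step.braid) auto
qed

lemma braid_step_context: "braid_step u v \<Longrightarrow> braid_step (a @ u @ b) (a @ v @ b)"
proof (induction rule: braid_step.induct)
  case (commute i j u v)
  show ?case using braid_step.commute[OF commute, of "a @ u" "v @ b"] by simp
next
  case (braid i j u v)
  show ?case using braid_step.braid[OF braid, of "a @ u" "v @ b"] by simp
qed

lemma braid_steps_context: "braid_step\<^sup>*\<^sup>* u v \<Longrightarrow> braid_step\<^sup>*\<^sup>* (a @ u @ b) (a @ v @ b)"
  by (induction rule: rtranclp_induct) (auto intro: rtranclp.rtrancl_into_rtrancl braid_step_context)

quotient_type pbraid = "nat list" / "braid_step\<^sup>*\<^sup>*"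
proof (rule equivpI)
  show "reflp braid_step\<^sup>*\<^sup>*" by (simp add: reflpI)
  show "symp braid_step\<^sup>*\<^sup>*" by (rule symp_rtranclp, rule sympI, rule braid_step_sym)
  show "transp braid_step\<^sup>*\<^sup>*" by (rule transp_rtranclp)
qed

lemma pbraid_word: obtains w where "a = abs_pbraid w"
  using pbraid.abs_induct[of "\<lambda>a. \<exists>w. a = abs_pbraid w"] by blast

instantiation pbraid :: monoid_mult
begin

lift_definition one_pbraid :: pbraid is "[]" .

lift_definition times_pbraid :: "pbraid \<Rightarrow> pbraid \<Rightarrow> pbraid" is "(@)"
proof -
  fix u u' v v' :: "nat list"
  assume u: "braid_step\<^sup>*\<^sup>* u u'" and v: "braid_step\<^sup>*\<^sup>* v v'"
  have "braid_step\<^sup>*\<^sup>* (u @ v) (u' @ v)" using braid_steps_context[OF u, of "[]" v] by simp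
  also have "braid_step\<^sup>*\<^sup>* (u' @ v) (u' @ v')" using braid_steps_context[OF v, of u' "[]"] by simp
  finally show "braid_step\<^sup>*\<^sup>* (u @ v) (u' @ v')" .
qed

instance
proof
  fix a b c :: pbraid
  show "a * b * c = a * (b * c)"
    by (cases a rule: pbraid_word, cases b rule: pbraid_word, cases c rule: pbraid_word)
      (simp add: times_pbraid.abs_eq)
  show "1 * a = a" "a * 1 = a"
    by (cases a rule: pbraid_word, simp add: times_pbraid.abs_eq one_pbraid.abs_eq)+
qed

end

lift_definition gen :: "nat \<Rightarrow> pbraid" is "\<lambda>i. [i]" .

lemma braid_step_length: "braid_step u v \<Longrightarrow> length u = length v"
  by (induction rule: braid_step.induct) simp_all

lemma braid_step_set: "braid_step u v \<Longrightarrow> set u = set v"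
  by (induction rule: braid_step.induct) (simp_all add: insert_commute)

lift_definition len :: "pbraid \<Rightarrow> nat" is length
proof -
  fix u v assume "braid_step\<^sup>*\<^sup>* u v"
  then show "length u = length v"
    by (induction rule: rtranclp_induct) (simp_all add: braid_step_length)
qed

lift_definition supp :: "pbraid \<Rightarrow> nat set" is set
proof -
  fix u v assume "braid_step\<^sup>*\<^sup>* u v"
  then show "set u = set v"
    by (induction rule: rtranclp_induct) (simp_all add: braid_step_set)
qed

lemma abs_pbraid_simps:
  "abs_pbraid [] = 1" "abs_pbraid (i # w) = gen i * abs_pbraid w"
  "abs_pbraid (v @ w) = abs_pbraid v * abs_pbraid w"
  by (simp_all add: one_pbraid.abs_eq gen.abs_eq times_pbraid.abs_eq)

lemma len_simps [simp]: "len 1 = 0" "len (a * b) = len a + len b" "len (gen i) = 1"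
  by (cases a rule: pbraid_word; cases b rule: pbraid_word; simp add: one_pbraid.abs_eq gen.abs_eq times_pbraid.abs_eq len.abs_eq)+

lemma supp_simps [simp]: "supp 1 = {}" "supp (a * b) = supp a \<union> supp b" "supp (gen i) = {i}"
  by (cases a rule: pbraid_word; cases b rule: pbraid_word; simp add: one_pbraid.abs_eq gen.abs_eq times_pbraid.abs_eq supp.abs_eq)+

lemma pbraid_cases: obtains "a = 1" | i b where "a = gen i * b"
proof -
  obtain w where w: "a = abs_pbraid w" by (rule pbraid_word)
  then show ?thesis using that by (cases w) (auto simp: abs_pbraid_simps)
qed

lemma len_eq_0 [simp]: "len a = 0 \<longleftrightarrow> a = 1"
  by (cases a rule: pbraid_cases) (auto dest: arg_cong[of _ _ len])

lemma gen_commute: "far i j \<Longrightarrow> gen i * (gen j * a) = gen j * (gen i * a)"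
proof -
  assume "far i j"
  then have "gen i * gen j = gen j * gen i"
    using braid_step.commute[of i j "[]" "[]"]
    by (simp add: gen.abs_eq times_pbraid.abs_eq pbraid.abs_eq_iff r_into_rtranclp)
  then show ?thesis by (metis mult.assoc)
qed

lemma gen_braid: "adjacent i j \<Longrightarrow> gen i * (gen j * (gen i * a)) = gen j * (gen i * (gen j * a))"
proof -
  assume "adjacent i j"
  then have "gen i * gen j * gen i = gen j * gen i * gen j"
    using braid_step.braid[OF \<open>adjacent i j\<close>, of "[]" "[]"]
    by (simp add: gen.abs_eq times_pbraid.abs_eq pbraid.abs_eq_iff r_into_rtranclp)
  then show ?thesis by (metis mult.assoc)
qed

text \<open>
  \<open>\<sigma>\<^sub>i * residue i j\<close> is the least common right multiple of \<open>\<sigma>\<^sub>i\<close> and \<open>\<sigma>\<^sub>j\<close>.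
\<close>

definition residue :: "nat \<Rightarrow> nat \<Rightarrow> pbraid" where
  "residue i j = (if i = j then 1 else if adjacent i j then gen j * gen i else gen j)"

text \<open>
  The inductive step of Garside's lemma. A chain of braid moves from a word starting with \<open>i\<close>
  to one starting with \<open>j\<close> passes through a word starting with \<open>k\<close>, whose tail \<open>w\<close> has two
  factorizations. These are merged by using the lemma for shorter elements. Everything
  depends on how \<open>i\<close>, \<open>j\<close>, \<open>k\<close> are placed; the longest cases are those in which they
  are three consecutive generators.
\<close>

lemma residue_compose:
  assumes IH: "\<And>i j a b. gen i * a = gen j * b \<Longrightarrow> len a < len w \<Longrightarrow>
      \<exists>c. a = residue i j * c \<and> b = residue j i * c"
    and u: "u = residue i k * d" "w = residue k i * d"
    and v: "w = residue k j * e" "v = residue j k * e"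
  shows "\<exists>c. u = residue i j * c \<and> v = residue j i * c"
proof -
  have far: "\<exists>c. a = gen j * c \<and> b = gen i * c"
    if "gen i * a = gen j * b" "len a < len w" "far i j" for i j a b
    using IH[OF that(1,2)] that(3) by (auto simp: residue_def split: if_splits)
  have adj: "\<exists>c. a = gen j * (gen i * c) \<and> b = gen i * (gen j * c)"
    if "gen i * a = gen j * b" "len a < len w" "adjacent i j" for i j a b
    using IH[OF that(1,2)] that(3) by (auto simp: residue_def mult.assoc split: if_splits)
  have cancel: "a = b" if "gen i * a = gen i * b" "len a < len w" for i a b
    using IH[OF that(1,2)] by (auto simp: residue_def)
  \<comment> \<open>Exactly one of the two outer generators is adjacent to the middle one; stated once
    and used with the roles of \<open>i\<close> and \<open>j\<close> exchanged.\<close>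
  have mixed: "\<exists>c. u = residue i j * c \<and> v = residue j i * c"
    if ki: "adjacent k i" and kj: "far k j" and ij: "i \<noteq> j"
      and u: "u = gen k * (gen i * d)" "w = gen i * (gen k * d)"
      and v: "w = gen j * e" "v = gen k * e" for i j u v d e
  proof (cases "far i j")
    case True
    have lw: "len w = len d + 2" using u(2) by simp
    then have "len (gen k * d) < len w" by simp
    then obtain c where c: "gen k * d = gen j * c" "e = gen i * c"
      using far[of i "gen k * d" j e] u(2) v(1) True by metis
    obtain c' where c': "d = gen j * c'" "c = gen k * c'"
      using far[of k d j c] c(1) lw kj by auto
    have "u = gen j * (gen k * (gen i * c'))"
      using gen_commute[OF True] gen_commute[OF kj] by (simp add: u c')
    moreover have "v = gen i * (gen k * (gen i * c'))"
      using gen_braid[OF ki] by (simp add: v c c')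
    ultimately show ?thesis using True by (auto simp: residue_def)
  next
    case False
    then have ij: "adjacent i j" using \<open>i \<noteq> j\<close> by auto
    have ji: "adjacent j i" and ik: "adjacent i k" and jk: "far j k" using ij ki kj by auto
    have lw: "len w = len d + 2" using u(2) by simp
    then have "len (gen k * d) < len w" by simp
    then obtain c where c: "gen k * d = gen j * (gen i * c)" "e = gen i * (gen j * c)"
      using adj[of i "gen k * d" j e] u(2) v(1) ij by metis
    obtain c' where c': "d = gen j * c'" "gen i * c = gen k * c'"
      using far[of k d j "gen i * c"] c(1) lw kj by auto
    have "len c' + 1 = len d" "len c = len c'"
      using arg_cong[OF c'(1), of len] arg_cong[OF c'(2), of len] by simp_all
    then obtain f where f: "c = gen k * (gen i * f)" "c' = gen i * (gen k * f)"
      using adj[of i c k c'] c'(2) lw ik by auto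
    let ?i = "gen i" and ?j = "gen j" and ?k = "gen k"
    have "u = ?k * (?i * (?j * (?i * (?k * f))))" by (simp add: u c' f)
    also have "\<dots> = ?k * (?j * (?i * (?j * (?k * f))))" using gen_braid[OF ij] by simp
    also have "\<dots> = ?j * (?k * (?i * (?k * (?j * f))))"
      using gen_commute[OF kj] by simp
    also have "\<dots> = ?j * (?i * (?k * (?i * (?j * f))))" using gen_braid[OF ki] by simp
    finally have u': "u = ?j * (?i * (?k * (?i * (?j * f))))" .
    have "v = ?k * (?i * (?j * (?k * (?i * f))))" by (simp add: v c f)
    also have "\<dots> = ?k * (?i * (?k * (?j * (?i * f))))" using gen_commute[OF jk] by simp
    also have "\<dots> = ?i * (?k * (?i * (?j * (?i * f))))" using gen_braid[OF ki] by simp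
    also have "\<dots> = ?i * (?k * (?j * (?i * (?j * f))))" using gen_braid[OF ij] by simp
    also have "\<dots> = ?i * (?j * (?k * (?i * (?j * f))))" using gen_commute[OF kj] by simp
    finally show ?thesis using u' ij ji by (auto simp: residue_def mult.assoc)
  qed
  consider "i = k" | "j = k" | "i \<noteq> k" "i = j" | "far k i" "far k j" "i \<noteq> j"
    | "adjacent k i" "far k j" "i \<noteq> j" | "far k i" "adjacent k j" "i \<noteq> j"
    | "adjacent k i" "adjacent k j" "i \<noteq> j"
    by linarith
  then show ?thesis
  proof cases
    case 1
    then show ?thesis using u v by (auto simp: residue_def)
  next
    case 2
    then show ?thesis using u v by (auto simp: residue_def)
  next
    case 3
    have "d = e"
    proof (cases "adjacent k i")
      case True
      then have w: "w = gen i * (gen k * d)" "w = gen i * (gen k * e)"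
        using u(2) v(1) 3 by (auto simp: residue_def mult.assoc)
      then have "gen k * d = gen k * e" using cancel[of i] by (metis len_simps(2,3) less_add_one add.commute)
      moreover have "len d < len w" using w(1) by simp
      ultimately show ?thesis by (rule cancel)
    next
      case False
      then have w: "w = gen i * d" "w = gen i * e"
        using u(2) v(1) 3 by (auto simp: residue_def)
      then show ?thesis using cancel[of i d e] by simp
    qed
    then show ?thesis using u v 3 by (auto simp: residue_def)
  next
    case 4
    then have w: "w = gen i * d" "w = gen j * e" and uv: "u = gen k * d" "v = gen k * e"
      using u v by (auto simp: residue_def)
    then have "len d < len w" by simp
    then obtain c where "d = residue i j * c" "e = residue j i * c" using IH[of i d j e] w(1) w(2) by metis
    then have "u = residue i j * (gen k * c) \<and> v = residue j i * (gen k * c)"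
      using 4 gen_commute[of k i] gen_commute[of k j] uv by (auto simp: residue_def mult.assoc)
    then show ?thesis by blast
  next
    case 5
    then have "u = gen k * (gen i * d)" "w = gen i * (gen k * d)" "w = gen j * e" "v = gen k * e"
      using u v by (auto simp: residue_def mult.assoc)
    then show ?thesis using mixed 5 by blast
  next
    case 6
    then have "v = gen k * (gen j * e)" "w = gen j * (gen k * e)" "w = gen i * d" "u = gen k * d"
      using u v by (auto simp: residue_def mult.assoc)
    then show ?thesis using mixed[of j i v e d u] 6 by blast
  next
    case 7
    let ?i = "gen i" and ?j = "gen j" and ?k = "gen k"
    have ij: "far i j" and ji: "far j i" and ki: "adjacent k i" and kj: "adjacent k j" using 7 by auto
    have uv: "u = ?k * (?i * d)" "v = ?k * (?j * e)"
      and w: "w = ?i * (?k * d)" "w = ?j * (?k * e)"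
      using u v ki kj by (auto simp: residue_def mult.assoc)
    have lw: "len w = len d + 2" "len w = len e + 2" using w(1) arg_cong[OF w(2), of len] by simp_all
    then have lt: "len (?k * d) < len w" "len d < len w" "len e < len w" by simp_all
    have "?i * (?k * d) = ?j * (?k * e)" using w by simp
    from far[OF this lt(1) ij]
    obtain c where c: "?k * d = ?j * c" "?k * e = ?i * c" by blast
    obtain c1 where c1: "d = ?j * (?k * c1)" "c = ?k * (?j * c1)"
      using adj[OF c(1) lt(2) kj] by blast
    obtain c2 where c2: "e = ?i * (?k * c2)" "c = ?k * (?i * c2)"
      using adj[OF c(2) lt(3) ki] by blast
    have lt1: "len (?j * c1) < len w" "len c1 < len w" using lt(2) c1(1) by simp_all
    have "?j * c1 = ?i * c2" using cancel[OF _ lt1(1), of k] c1(2) c2(2) by simp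
    then obtain f where f: "c1 = ?i * f" "c2 = ?j * f" using far[OF _ lt1(2) ji] by blast
    have "u = ?k * (?i * (?j * (?k * (?i * f))))" by (simp add: uv c1 f)
    also have "\<dots> = ?k * (?j * (?i * (?k * (?i * f))))" using gen_commute[OF ij] by simp
    also have "\<dots> = ?k * (?j * (?k * (?i * (?k * f))))" using gen_braid[OF ki] by simp
    also have "\<dots> = ?j * (?k * (?j * (?i * (?k * f))))" using gen_braid[OF kj] by simp
    finally have u': "u = ?j * (?k * (?j * (?i * (?k * f))))" .
    have "v = ?k * (?j * (?i * (?k * (?j * f))))" by (simp add: uv c2 f)
    also have "\<dots> = ?k * (?i * (?j * (?k * (?j * f))))" using gen_commute[OF ij] by simp
    also have "\<dots> = ?k * (?i * (?k * (?j * (?k * f))))" using gen_braid[OF kj] by simp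
    also have "\<dots> = ?i * (?k * (?i * (?j * (?k * f))))" using gen_braid[OF ki] by simp
    also have "\<dots> = ?i * (?k * (?j * (?i * (?k * f))))" using gen_commute[OF ij] by simp
    finally show ?thesis using u' ij ji by (auto simp: residue_def)
  qed
qed

lemma braid_step_Cons_cases:
  assumes "braid_step (i # u) (j # v)"
  shows "\<exists>c. abs_pbraid u = residue i j * c \<and> abs_pbraid v = residue j i * c"
  using assms
proof (cases rule: braid_step.cases)
  case (commute k l a b)
  show ?thesis
  proof (cases a)
    case Nil
    then show ?thesis using commute by (auto simp: residue_def abs_pbraid_simps)
  next
    case (Cons x a')
    then have "braid_step u v" using commute braid_step.commute[of k l a' b] by auto
    then have "abs_pbraid u = abs_pbraid v" by (auto simp: pbraid.abs_eq_iff)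
    then show ?thesis using Cons commute by (auto simp: residue_def)
  qed
next
  case (braid k l a b)
  show ?thesis
  proof (cases a)
    case Nil
    then show ?thesis using braid by (auto simp: residue_def abs_pbraid_simps mult.assoc)
  next
    case (Cons x a')
    then have "braid_step u v" using braid braid_step.braid[OF braid(3), of a' b] by auto
    then have "abs_pbraid u = abs_pbraid v" by (auto simp: pbraid.abs_eq_iff)
    then show ?thesis using Cons braid by (auto simp: residue_def)
  qed
qed

text \<open>
  Garside's lemma: in the positive monoid, common multiples of two generators are multiples
  of the obvious ones. The outer induction is on length, the inner one on the number of braid
  moves between the two words. For \<open>i = j\<close> this is left cancellation.
\<close>

theorem garside_key:
  "gen i * a = gen j * b \<Longrightarrow> \<exists>c. a = residue i j * c \<and> b = residue j i * c"
proof (induction "len a" arbitrary: i j a b rule: less_induct)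
  case less
  have *: "\<exists>c. abs_pbraid u = residue i j * c \<and> abs_pbraid v = residue j i * c"
    if "braid_step\<^sup>*\<^sup>* (i # u) w" "w = j # v" "length u = len a" for w j u v
    using that
  proof (induction arbitrary: j v rule: rtranclp_induct)
    case base
    then show ?case by (auto simp: residue_def)
  next
    case (step y z)
    have ly: "length y = Suc (len a)"
      using rel_funD[OF len.rsp step.hyps(1)] step.prems(2) by simp
    then obtain k w where y: "y = k # w" by (cases y) auto
    have lw: "len (abs_pbraid w) = len a" using ly y by (simp add: len.abs_eq)
    obtain d where d: "abs_pbraid u = residue i k * d" "abs_pbraid w = residue k i * d"
      using step.IH[OF y step.prems(2)] by blast
    obtain e where e: "abs_pbraid w = residue k j * e" "abs_pbraid v = residue j k * e"
      using braid_step_Cons_cases step.hyps(2) step.prems(1) y by blast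
    show ?case using residue_compose[OF _ d e] less.hyps lw by simp
  qed
  obtain u v where uv: "a = abs_pbraid u" "b = abs_pbraid v"
    by (metis pbraid_word)
  then have "braid_step\<^sup>*\<^sup>* (i # u) (j # v)"
    using less.prems by (simp add: abs_pbraid_simps(2)[symmetric] pbraid.abs_eq_iff)
  then show ?case using *[of u "j # v" j v] uv by (simp add: len.abs_eq)
qed

lemma gen_cancel: "gen i * a = gen i * b \<Longrightarrow> a = b"
  using garside_key[of i a i b] by (auto simp: residue_def)

lemma pbraid_left_cancel: "c * a = c * b \<Longrightarrow> (a :: pbraid) = b"
proof (induction "len c" arbitrary: c)
  case 0
  then show ?case by simp
next
  case (Suc m)
  obtain i d where "c = gen i * d" using Suc.hyps(2) by (cases c rule: pbraid_cases) auto
  then show ?case using Suc.hyps(1)[of d] Suc.hyps(2) Suc.prems gen_cancel[of i "d * a" "d * b"]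
    by (simp add: mult.assoc)
qed

definition left_dvd :: "pbraid \<Rightarrow> pbraid \<Rightarrow> bool" where
  "left_dvd a b \<longleftrightarrow> (\<exists>c. b = a * c)"

lemma left_dvd_trans: "left_dvd a b \<Longrightarrow> left_dvd b c \<Longrightarrow> left_dvd a c"
  by (auto simp: left_dvd_def mult.assoc)

lemma left_dvd_mult_iff [simp]: "left_dvd (c * a) (c * b) \<longleftrightarrow> left_dvd a b"
  by (auto simp: left_dvd_def mult.assoc dest: pbraid_left_cancel)

lemma left_dvd_two_gens:
  assumes "left_dvd (gen i) a" "left_dvd (gen j) a"
  shows "left_dvd (gen i * residue i j) a"
  using assms garside_key unfolding left_dvd_def by (metis mult.assoc)

lemma gen_residue: "gen i * residue i j = gen j * residue j i"
proof -
  consider "i = j" | "adjacent i j" | "far i j" "\<not> adjacent i j" by linarith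
  then show ?thesis
    using gen_braid[of i j 1] gen_commute[of i j 1] by cases (auto simp: residue_def)
qed

text \<open>
  By induction on length. If \<open>\<sigma>\<^sub>i\<close> divides both elements, split it off and multiply the
  greatest common divisor of the quotients by \<open>\<sigma>\<^sub>i\<close>. A common divisor that starts with another
  generator \<open>\<sigma>\<^sub>j\<close> divides the candidate built from \<open>\<sigma>\<^sub>j\<close>; that candidate is divisible by the
  least common multiple of \<open>\<sigma>\<^sub>i\<close> and \<open>\<sigma>\<^sub>j\<close>, hence by \<open>\<sigma>\<^sub>i\<close>, so it divides the candidate built
  from \<open>\<sigma>\<^sub>i\<close>.
\<close>

theorem pbraid_gcd:
  "\<exists>g. left_dvd g a \<and> left_dvd g b \<and> (\<forall>d. left_dvd d a \<longrightarrow> left_dvd d b \<longrightarrow> left_dvd d g)"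
proof (induction "len a" arbitrary: a b rule: less_induct)
  case less
  show ?case
  proof (cases "\<exists>i. left_dvd (gen i) a \<and> left_dvd (gen i) b")
    case False
    have "left_dvd d 1" if "left_dvd d a" "left_dvd d b" for d
      using that False by (cases d rule: pbraid_cases) (auto simp: left_dvd_def mult.assoc)
    then show ?thesis by (intro exI[of _ 1]) (auto simp: left_dvd_def)
  next
    case True
    have gcd_gen: "\<exists>g. left_dvd (gen i * g) a \<and> left_dvd (gen i * g) b \<and>
        (\<forall>d. left_dvd (gen i * d) a \<longrightarrow> left_dvd (gen i * d) b \<longrightarrow> left_dvd (gen i * d) (gen i * g))"
      if i: "left_dvd (gen i) a" "left_dvd (gen i) b" for i
    proof -
      obtain a' b' where ab: "a = gen i * a'" "b = gen i * b'"
        using i unfolding left_dvd_def by blast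
      then show ?thesis using less.hyps[of a' b'] by auto
    qed
    obtain i where i: "left_dvd (gen i) a" "left_dvd (gen i) b" using True by blast
    obtain g where g: "left_dvd (gen i * g) a" "left_dvd (gen i * g) b"
      and max_g: "\<And>d. left_dvd (gen i * d) a \<Longrightarrow> left_dvd (gen i * d) b \<Longrightarrow>
          left_dvd (gen i * d) (gen i * g)"
      using gcd_gen[OF i] by blast
    have "left_dvd d (gen i * g)" if d: "left_dvd d a" "left_dvd d b" for d
    proof (cases d rule: pbraid_cases)
      case 1
      then show ?thesis by (simp add: left_dvd_def)
    next
      case (2 j e)
      have j: "left_dvd (gen j) a" "left_dvd (gen j) b"
        using d 2 by (auto simp: left_dvd_def mult.assoc)
      obtain h where h: "left_dvd (gen j * h) a" "left_dvd (gen j * h) b"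
        and max_h: "\<And>d. left_dvd (gen j * d) a \<Longrightarrow> left_dvd (gen j * d) b \<Longrightarrow>
            left_dvd (gen j * d) (gen j * h)"
        using gcd_gen[OF j] by blast
      have "left_dvd (gen j * residue j i) (gen j * h)"
        using max_h left_dvd_two_gens[OF j(1) i(1)] left_dvd_two_gens[OF j(2) i(2)] by blast
      then obtain k where "gen j * h = gen i * (residue i j * k)"
        unfolding left_dvd_def by (metis gen_residue mult.assoc)
      then have "left_dvd (gen j * h) (gen i * g)" using max_g h by metis
      moreover have "left_dvd d (gen j * h)" using max_h d 2 by blast
      ultimately show ?thesis using left_dvd_trans by blast
    qed
    then show ?thesis using g by blast
  qed
qed

section \<open>The half twist\<close>

lemma pbraid_induct [case_names one gen]:
  assumes "P 1" "\<And>i b. P b \<Longrightarrow> P (gen i * b)"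
  shows "P a"
proof -
  obtain w where w: "a = abs_pbraid w" by (rule pbraid_word)
  show ?thesis unfolding w by (induction w) (simp_all add: abs_pbraid_simps assms)
qed

lemma gen_commute_supp: "(\<And>j. j \<in> supp a \<Longrightarrow> far i j) \<Longrightarrow> gen i * a = a * gen i"
proof (induction a rule: pbraid_induct)
  case (gen j a)
  then show ?case using gen_commute[of i j a] by (simp add: mult.assoc)
qed simp

definition run :: "nat \<Rightarrow> pbraid" where
  "run m = abs_pbraid [1..<m]"

definition half_twist_word :: "nat \<Rightarrow> nat list" where
  "half_twist_word n = concat (map (\<lambda>k. [1..<Suc k]) (rev [1..<n]))"

definition half_twist :: "nat \<Rightarrow> pbraid" where
  "half_twist n = abs_pbraid (half_twist_word n)"

lemma run_Suc: "1 \<le> m \<Longrightarrow> run (Suc m) = run m * gen m"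
  by (simp add: run_def abs_pbraid_simps)

lemma supp_run: "supp (run m) = {1..<m}"
  by (auto simp: run_def supp.abs_eq)

lemma half_twist_Suc: "half_twist (Suc n) = run (Suc n) * half_twist n"
  by (cases "n = 0") (simp_all add: half_twist_def half_twist_word_def run_def abs_pbraid_simps mult.assoc)

lemma half_twist_0: "half_twist 0 = 1"
  by (simp add: half_twist_def half_twist_word_def abs_pbraid_simps)

lemma supp_half_twist: "supp (half_twist n) = {1..<n}"
  by (induction n) (auto simp: half_twist_0 half_twist_Suc supp_run)

text \<open>
  Sliding a crossing through a strand that crosses all the others.
\<close>

lemma gen_run_shift:
  assumes "1 \<le> i" "Suc i < m"
  shows "gen (Suc i) * run m = run m * gen i"
  using assms(2)
proof (induction m)
  case (Suc m)
  show ?case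
  proof (cases "Suc i < m")
    case True
    then have "gen (Suc i) * run (Suc m) = run m * (gen i * gen m)"
      using Suc.IH by (simp add: run_Suc mult.assoc[symmetric])
    also have "gen i * gen m = gen m * gen i" using gen_commute[of i m 1] True by simp
    finally show ?thesis using True by (simp add: run_Suc mult.assoc)
  next
    case False
    then have m: "m = Suc i" using Suc.prems by simp
    have "gen (Suc i) * run i = run i * gen (Suc i)"
      by (rule gen_commute_supp) (auto simp: supp_run)
    then have "gen (Suc i) * run (Suc m) = run i * (gen (Suc i) * (gen i * (gen (Suc i) * 1)))"
      using assms(1) by (simp add: m run_Suc mult.assoc) (simp add: mult.assoc[symmetric])
    also have "\<dots> = run (Suc m) * gen i"
      using assms(1) gen_braid[of "Suc i" i 1] by (simp add: m run_Suc mult.assoc)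
    finally show ?thesis .
  qed
qed simp

lemma run_run_shift:
  assumes "j < m"
  shows "run m * run j = abs_pbraid (map Suc [1..<j]) * run m"
  using assms
proof (induction j)
  case (Suc j)
  show ?case
  proof (cases "j = 0")
    case False
    then have "run m * run (Suc j) = abs_pbraid (map Suc [1..<j]) * (run m * gen j)"
      using Suc by (simp add: run_Suc mult.assoc[symmetric])
    also have "run m * gen j = gen (Suc j) * run m" using gen_run_shift[of j m] Suc.prems False by simp
    finally show ?thesis using False by (simp add: abs_pbraid_simps mult.assoc)
  qed (simp add: run_def abs_pbraid_simps)
qed (simp add: run_def abs_pbraid_simps)

lemma run_Cons: "1 \<le> m \<Longrightarrow> gen 1 * abs_pbraid (map Suc [1..<m]) = run (Suc m)"
proof -
  assume "1 \<le> m"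
  then have "[1..<Suc m] = 1 # map Suc [1..<m]"
    by (simp add: map_Suc_upt upt_conv_Cons del: upt_Suc)
  then show ?thesis by (simp add: run_def abs_pbraid_simps)
qed

text \<open>
  Since \<open>\<Delta>\<^sub>n\<^sub>+\<^sub>1 = (\<sigma>\<^sub>1 \<dots> \<sigma>\<^sub>n) \<Delta>\<^sub>n\<close>, the case \<open>i > 1\<close> follows by sliding \<open>\<sigma>\<^sub>i\<close> through the first
  factor. For \<open>i = 1\<close> both sides equal \<open>(\<sigma>\<^sub>1 \<dots> \<sigma>\<^sub>n) (\<sigma>\<^sub>1 \<dots> \<sigma>\<^sub>n) \<Delta>\<^bsub>n-1\<^esub>\<close>.
\<close>

lemma gen_half_twist:
  "1 \<le> i \<Longrightarrow> i < n \<Longrightarrow> gen i * half_twist n = half_twist n * gen (n - i)"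
proof (induction n arbitrary: i)
  case (Suc n)
  show ?case
  proof (cases "i = 1")
    case False
    then obtain j where j: "i = Suc j" "1 \<le> j" "j < n" using Suc.prems by (cases i) auto
    have "gen i * half_twist (Suc n) = run (Suc n) * (gen j * half_twist n)"
      using gen_run_shift[of j "Suc n"] j by (simp add: half_twist_Suc mult.assoc[symmetric])
    then show ?thesis using Suc.IH[of j] j by (simp add: half_twist_Suc mult.assoc)
  next
    case True
    then obtain m where n: "n = Suc m" using Suc.prems by (cases n) auto
    have comm: "half_twist m * gen n = gen n * half_twist m"
      by (rule gen_commute_supp[symmetric]) (auto simp: supp_half_twist n)
    have "gen 1 * half_twist (Suc n) = gen 1 * (run (Suc n) * run n) * half_twist m"
      by (simp add: half_twist_Suc n mult.assoc)
    also have "gen 1 * (run (Suc n) * run n) = run (Suc n) * run (Suc n)"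
      using run_run_shift[of n "Suc n"] run_Cons[of n] n by (simp add: mult.assoc[symmetric])
    also have "\<dots> * half_twist m = run (Suc n) * (run n * (gen n * half_twist m))"
      using run_Suc[of n] n by (simp add: mult.assoc)
    also have "\<dots> = half_twist (Suc n) * gen n"
      using comm by (simp add: half_twist_Suc n mult.assoc)
    finally show ?thesis using True by simp
  qed
qed simp

lemma gen_left_dvd_half_twist: "1 \<le> i \<Longrightarrow> i < n \<Longrightarrow> \<exists>d. half_twist n = gen i * d"
proof (induction n arbitrary: i)
  case (Suc n)
  show ?case
  proof (cases "i = 1")
    case True
    then show ?thesis using run_Cons[of n] Suc.prems by (metis half_twist_Suc less_Suc_eq_le mult.assoc)
  next
    case False
    then obtain j where j: "i = Suc j" "1 \<le> j" "j < n" using Suc.prems by (cases i) auto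
    then obtain d where "half_twist n = gen j * d" using Suc.IH by blast
    then have "half_twist (Suc n) = gen i * (run (Suc n) * d)"
      using gen_run_shift[of j "Suc n"] j by (simp add: half_twist_Suc mult.assoc[symmetric])
    then show ?thesis by blast
  qed
qed simp

definition full_twist :: "nat \<Rightarrow> pbraid" where
  "full_twist n = half_twist n * half_twist n"

lemma gen_full_twist:
  assumes "1 \<le> i" "i < n"
  shows "gen i * full_twist n = full_twist n * gen i"
  using gen_half_twist[of i n] gen_half_twist[of "n - i" n] assms
  by (simp add: full_twist_def mult.assoc[symmetric]) (simp add: mult.assoc)

text \<open>
  The positive element \<open>\<sigma>\<^sub>i\<^sup>-\<^sup>1 \<Delta>\<^sup>2\<close>. It is unique by left cancellation.
\<close>

definition gen_cofactor :: "nat \<Rightarrow> nat \<Rightarrow> pbraid" where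
  "gen_cofactor n i = (SOME d. full_twist n = gen i * d)"

lemma gen_cofactor:
  assumes "1 \<le> i" "i < n"
  shows "gen i * gen_cofactor n i = full_twist n" "gen_cofactor n i * gen i = full_twist n"
    and "gen_cofactor n i * full_twist n = full_twist n * gen_cofactor n i"
proof -
  let ?c = "gen_cofactor n i"
  have "\<exists>d. full_twist n = gen i * d"
    using gen_left_dvd_half_twist[OF assms] by (auto simp: full_twist_def mult.assoc)
  then show c: "gen i * ?c = full_twist n" unfolding gen_cofactor_def by (metis (mono_tags, lifting) someI_ex)
  have "gen i * (?c * gen i) = gen i * full_twist n"
    using gen_full_twist[OF assms] by (simp add: mult.assoc[symmetric] c)
  then show c': "?c * gen i = full_twist n" by (rule gen_cancel)
  show "?c * full_twist n = full_twist n * ?c"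
    by (metis c c' mult.assoc)
qed

section \<open>Embedding of the positive monoid in the braid group\<close>

text \<open>
  Every inverse letter is replaced by its positive cofactor in \<open>\<Delta>\<^sup>2\<close>, so that a word \<open>w\<close>
  represents \<open>numerator n w\<close> divided by one factor \<open>\<Delta>\<^sup>2\<close> for each inverse letter.
\<close>

primrec numerator :: "nat \<Rightarrow> braid_word \<Rightarrow> pbraid" where
  "numerator n [] = 1"
| "numerator n (l # w) =
     (case l of (b, i) \<Rightarrow> if b then gen i else gen_cofactor n i) * numerator n w"

definition negative_letters :: "braid_word \<Rightarrow> nat" where
  "negative_letters w = length (filter (\<lambda>(b, i). \<not> b) w)"

lemma numerator_append: "numerator n (u @ v) = numerator n u * numerator n v"
  by (induction u) (simp_all add: mult.assoc)

lemma numerator_commute: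
  assumes "w \<in> braid_words n"
  shows "numerator n w * full_twist n ^ k = full_twist n ^ k * numerator n w"
proof -
  have "full_twist n * numerator n w = numerator n w * full_twist n"
    using assms
  proof (induction w)
    case (Cons l w)
    obtain b i where l: "l = (b, i)" by (cases l)
    have i: "1 \<le> i" "i < n" and w: "w \<in> braid_words n"
      using Cons.prems by (auto simp: l braid_words_def)
    let ?c = "if b then gen i else gen_cofactor n i"
    have c: "full_twist n * ?c = ?c * full_twist n"
      using gen_full_twist[OF i] gen_cofactor(3)[OF i] by simp
    have "full_twist n * (?c * numerator n w) = ?c * (full_twist n * numerator n w)"
      by (simp only: mult.assoc[symmetric] c)
    then show ?case by (simp only: l numerator.simps prod.case Cons.IH[OF w] mult.assoc)
  qed simp
  then show ?thesis by (rule power_commuting_commutes[symmetric])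
qed

text \<open>
  Equality of fractions with powers of the central element \<open>\<Delta>\<^sup>2\<close> as denominators, cleared of
  denominators. Transitivity is where left cancellation in the positive monoid enters.
\<close>

lemma numerator_equiv:
  "artin_equiv n u v \<Longrightarrow>
   numerator n u * full_twist n ^ negative_letters v = numerator n v * full_twist n ^ negative_letters u"
proof (induction rule: artin_equiv.induct)
  case (trans u v w)
  let ?Z = "full_twist n" and ?N = "numerator n" and ?k = negative_letters
  note c = numerator_commute[OF artin_equiv_words(1)[OF trans.hyps(1)]]
    numerator_commute[OF artin_equiv_words(2)[OF trans.hyps(1)]]
    numerator_commute[OF artin_equiv_words(2)[OF trans.hyps(2)]]
  have zz: "?Z ^ a * ?Z ^ b = ?Z ^ b * ?Z ^ a" for a b by (simp add: power_add[symmetric] add.commute)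
  have "?Z ^ ?k v * (?N u * ?Z ^ ?k w) = ?N u * ?Z ^ ?k v * ?Z ^ ?k w"
    by (metis mult.assoc c(1))
  also have "\<dots> = ?N v * ?Z ^ ?k w * ?Z ^ ?k u"
    by (metis trans.IH(1) mult.assoc zz)
  also have "\<dots> = ?Z ^ ?k v * (?N w * ?Z ^ ?k u)"
    by (metis trans.IH(2) mult.assoc c(3))
  finally show ?case by (rule pbraid_left_cancel)
next
  case (append u u' v v')
  let ?Z = "full_twist n" and ?N = "numerator n" and ?k = negative_letters
  note c = numerator_commute[OF artin_equiv_words(1)[OF append.hyps(2)]]
    numerator_commute[OF artin_equiv_words(2)[OF append.hyps(2)]]
  have "?N (u @ v) * ?Z ^ ?k (u' @ v') = ?N u * (?N v * ?Z ^ ?k u') * ?Z ^ ?k v'"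
    by (simp add: numerator_append negative_letters_def power_add mult.assoc)
  also have "\<dots> = (?N u * ?Z ^ ?k u') * (?N v * ?Z ^ ?k v')"
    by (simp add: c mult.assoc)
  also have "\<dots> = (?N u' * ?Z ^ ?k u) * (?N v' * ?Z ^ ?k v)"
    by (simp only: append.IH)
  also have "\<dots> = ?N u' * (?N v' * ?Z ^ ?k u) * ?Z ^ ?k v"
    by (simp add: c mult.assoc)
  also have "\<dots> = ?N (u' @ v') * ?Z ^ ?k (u @ v)"
    by (simp add: numerator_append negative_letters_def power_add mult.assoc)
  finally show ?case .
next
  case (cancel i b)
  then show ?case using gen_cofactor[of i n] by (simp add: negative_letters_def)
next
  case (commute i j)
  then show ?case using gen_commute[of i j 1] by (simp add: negative_letters_def)
next
  case (braid i)
  then show ?case using gen_braid[of i "i + 1" 1] by (simp add: negative_letters_def mult.assoc)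
qed (simp_all)

definition positive_braid :: "nat \<Rightarrow> nat list \<Rightarrow> braid" where
  "positive_braid n w = braid_of n (map (Pair True) w)"

lemma positive_word_in [simp]: "map (Pair True) w \<in> braid_words n \<longleftrightarrow> set w \<subseteq> {1..<n}"
  by (auto simp: braid_words_def lists_eq_set)

lemma numerator_positive: "numerator n (map (Pair True) w) = abs_pbraid w"
  by (induction w) (simp_all add: abs_pbraid_simps)

lemma artin_equiv_context:
  assumes "artin_equiv n u v" "a \<in> braid_words n" "b \<in> braid_words n"
  shows "artin_equiv n (a @ u @ b) (a @ v @ b)"
  using assms by (intro artin_equiv.append artin_equiv.refl)

lemma braid_step_artin_equiv:
  assumes "braid_step u v" "set u \<subseteq> {1..<n}"
  shows "artin_equiv n (map (Pair True) u) (map (Pair True) v)"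
  using assms
proof (induction rule: braid_step.induct)
  case (commute i j u v)
  have "artin_equiv n [(True, i), (True, j)] [(True, j), (True, i)]"
    using commute artin_equiv.commute[of i j n] artin_equiv.sym[OF artin_equiv.commute[of j i n]]
    by auto
  then show ?case
    using artin_equiv_context[of n _ _ "map (Pair True) u" "map (Pair True) v"] commute.prems
    by fastforce
next
  case (braid i j u v)
  have "artin_equiv n [(True, i), (True, j), (True, i)] [(True, j), (True, i), (True, j)]"
    using braid artin_equiv.braid[of i n] artin_equiv.sym[OF artin_equiv.braid[of j n]]
    by auto
  then show ?case
    using artin_equiv_context[of n _ _ "map (Pair True) u" "map (Pair True) v"] braid.prems
    by fastforce
qed

text \<open>
  The positive monoid embeds in the braid group: a positive word has no inverse letters, so
  its numerator is the word itself and its denominator is trivial.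
\<close>

theorem positive_braid_eq_iff:
  assumes "set u \<subseteq> {1..<n}" "set v \<subseteq> {1..<n}"
  shows "positive_braid n u = positive_braid n v \<longleftrightarrow> abs_pbraid u = abs_pbraid v"
proof
  assume "positive_braid n u = positive_braid n v"
  then have "artin_equiv n (map (Pair True) u) (map (Pair True) v)"
    using assms by (simp add: positive_braid_def braid_of_eq_iff)
  then show "abs_pbraid u = abs_pbraid v"
    using numerator_equiv by (fastforce simp: numerator_positive negative_letters_def filter_map comp_def)
next
  assume "abs_pbraid u = abs_pbraid v"
  then have "braid_step\<^sup>*\<^sup>* u v" by (simp add: pbraid.abs_eq_iff)
  then have "artin_equiv n (map (Pair True) u) (map (Pair True) v) \<and> set v = set u"
  proof (induction rule: rtranclp_induct)
    case base
    then show ?case using assms by (auto intro: artin_equiv.refl)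
  next
    case (step v w)
    then show ?case
      using braid_step_artin_equiv[of v w n] braid_step_set[of v w] assms artin_equiv.trans
      by metis
  qed
  then show "positive_braid n u = positive_braid n v"
    by (simp add: positive_braid_def braid_of_eqI)
qed

section \<open>Orbits of a map\<close>

lemma funpow_fixed_mult:
  fixes f :: "'a \<Rightarrow> 'a"
  shows "(f ^^ k) y = y \<Longrightarrow> (f ^^ (k * m)) y = y"
  by (induction m) (simp_all add: funpow_add)

text \<open>
  Every point of a periodic orbit leads back to the starting point.
\<close>

lemma funpow_orbit_return:
  fixes f :: "'a \<Rightarrow> 'a"
  assumes "(f ^^ N) y = y" "N > 0"
  shows "\<exists>j. (f ^^ j) ((f ^^ k) y) = y"
proof -
  have "N * k - k + k = N * k" using assms(2) by (cases N) auto
  then have "(f ^^ (N * k - k)) ((f ^^ k) y) = y"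
    using funpow_fixed_mult[OF assms(1), of k] by (metis comp_apply funpow_add)
  then show ?thesis by blast
qed

definition orbit :: "('a \<Rightarrow> 'a) \<Rightarrow> 'a \<Rightarrow> 'a set" where
  "orbit f y = {(f ^^ m) y | m. True}"

lemma orbit_self: "y \<in> orbit f y"
  unfolding orbit_def by (metis (mono_tags, lifting) funpow_0 mem_Collect_eq)

lemma orbit_trans: "z \<in> orbit f y \<Longrightarrow> orbit f z \<subseteq> orbit f y"
  unfolding orbit_def by clarify (metis comp_apply funpow_add)

lemma orbit_step: "z \<in> orbit f y \<Longrightarrow> f z \<in> orbit f y"
  unfolding orbit_def by clarify (metis comp_apply funpow.simps(2))

lemma orbit_eq:
  assumes "(f ^^ N) y = y" "N > 0" "z \<in> orbit f y"
  shows "orbit f z = orbit f y"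
proof -
  obtain k where "z = (f ^^ k) y" using assms(3) by (auto simp: orbit_def)
  then obtain j where "(f ^^ j) z = y" using funpow_orbit_return[OF assms(1,2), of k] by blast
  then have "y \<in> orbit f z" unfolding orbit_def by blast
  then show ?thesis using orbit_trans[of y f z] orbit_trans[OF assms(3)] by simp
qed

section \<open>Garside groups: prefix order and meets\<close>

text \<open>
  The part of Garside theory used below. \<open>P\<close> is the positive monoid, \<open>D\<close> the Garside element
  and \<open>L\<close> an additive length, in braid groups the exponent sum. The length makes the prefix
  order antisymmetric, bounds transports and supports induction along positive elements. As in braid groups, already
  the square of \<open>D\<close> is central.
\<close>

locale garside_group = group G for G (structure) +
  fixes P :: "'a set" and D :: 'a and L :: "'a \<Rightarrow> int"
  assumes P_carrier: "P \<subseteq> carrier G"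
    and one_P: "\<one> \<in> P"
    and mult_P: "a \<in> P \<Longrightarrow> b \<in> P \<Longrightarrow> a \<otimes> b \<in> P"
    and gcd_P: "a \<in> P \<Longrightarrow> b \<in> P \<Longrightarrow> \<exists>g\<in>P. inv g \<otimes> a \<in> P \<and> inv g \<otimes> b \<in> P \<and>
        (\<forall>d\<in>P. inv d \<otimes> a \<in> P \<longrightarrow> inv d \<otimes> b \<in> P \<longrightarrow> inv d \<otimes> g \<in> P)"
    and L_mult: "a \<in> carrier G \<Longrightarrow> b \<in> carrier G \<Longrightarrow> L (a \<otimes> b) = L a + L b"
    and L_pos: "a \<in> P \<Longrightarrow> a \<noteq> \<one> \<Longrightarrow> 0 < L a"
    and finite_P: "finite {a \<in> P. L a \<le> m}"
    and D_P: "D \<in> P"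
    and D_conj: "a \<in> P \<Longrightarrow> inv D \<otimes> a \<otimes> D \<in> P"
    and D_square_central: "a \<in> carrier G \<Longrightarrow> D \<otimes> D \<otimes> a = a \<otimes> (D \<otimes> D)"
    and D_absorbs: "a \<in> carrier G \<Longrightarrow> \<exists>k::nat. D [^] k \<otimes> a \<in> P"
    and D_nontrivial: "D \<noteq> \<one>"
begin

definition prefix :: "'a \<Rightarrow> 'a \<Rightarrow> bool" (infix "\<preceq>" 50) where
  "a \<preceq> b \<longleftrightarrow> inv a \<otimes> b \<in> P"

definition meet :: "'a \<Rightarrow> 'a \<Rightarrow> 'a" (infixl "\<^bold>\<and>" 65) where
  "a \<^bold>\<and> b = (THE m. m \<in> carrier G \<and> m \<preceq> a \<and> m \<preceq> b \<and>
     (\<forall>d\<in>carrier G. d \<preceq> a \<longrightarrow> d \<preceq> b \<longrightarrow> d \<preceq> m))"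

definition conj_by :: "'a \<Rightarrow> 'a \<Rightarrow> 'a" where
  "conj_by x a = inv a \<otimes> x \<otimes> a"

abbreviation D_pow :: "int \<Rightarrow> 'a" where
  "D_pow p \<equiv> D [^] p"

lemma P_closed [simp, intro]: "a \<in> P \<Longrightarrow> a \<in> carrier G"
  using P_carrier by blast

lemma D_closed [simp, intro]: "D \<in> carrier G"
  using D_P by simp

lemma cancel_inv [simp]:
  assumes "a \<in> carrier G" "b \<in> carrier G"
  shows "inv a \<otimes> (a \<otimes> b) = b" "a \<otimes> (inv a \<otimes> b) = b"
  using assms by (simp_all add: m_assoc[symmetric])

lemma inv_mult_eq_one_iff: "a \<in> carrier G \<Longrightarrow> b \<in> carrier G \<Longrightarrow> inv a \<otimes> b = \<one> \<longleftrightarrow> a = b"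
  by (metis cancel_inv(2) l_inv r_one)

lemmas group_word = m_assoc inv_mult_group

lemma conj_by_closed [simp]: "x \<in> carrier G \<Longrightarrow> a \<in> carrier G \<Longrightarrow> conj_by x a \<in> carrier G"
  by (simp add: conj_by_def)

lemma conj_by_mult:
  "x \<in> carrier G \<Longrightarrow> a \<in> carrier G \<Longrightarrow> b \<in> carrier G \<Longrightarrow>
   conj_by (conj_by x a) b = conj_by x (a \<otimes> b)"
  by (simp add: conj_by_def group_word)

lemma conj_by_one [simp]: "x \<in> carrier G \<Longrightarrow> conj_by x \<one> = x"
  by (simp add: conj_by_def)

lemma D_pow_add: "D_pow (p + q) = D_pow p \<otimes> D_pow q"
  by (simp add: int_pow_mult)

lemma D_pow_minus: "D_pow (- p) = inv (D_pow p)"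
  by (simp add: int_pow_neg)

lemma D_pow_1 [simp]: "D_pow 1 = D"
  by (simp add: int_pow_1)

lemma D_pow_commute: "D_pow p \<otimes> D_pow q = D_pow q \<otimes> D_pow p"
  by (simp add: D_pow_add[symmetric] add.commute)

lemma D_inv_conj: "a \<in> P \<Longrightarrow> D \<otimes> a \<otimes> inv D \<in> P"
proof -
  assume a: "a \<in> P"
  then have "D \<otimes> a \<otimes> inv D = inv D \<otimes> (D \<otimes> D \<otimes> a) \<otimes> inv D"
    by (simp add: group_word)
  also have "\<dots> = inv D \<otimes> a \<otimes> D"
    using a by (subst D_square_central) (auto simp add: group_word)
  finally show ?thesis using D_conj[OF a] by simp
qed

text \<open>
  As \<open>D\<^sup>2\<close> is central, conjugation by \<open>D\<close> is an involution, so the positive monoid is also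
  stable under the inverse conjugation.
\<close>

lemma conj_by_D_pow_P: "a \<in> P \<Longrightarrow> conj_by a (D_pow p) \<in> P"
proof (induction p rule: int_induct[where k = 0])
  case base
  then show ?case by simp
next
  case (step1 i)
  then have "conj_by (conj_by a (D_pow i)) D \<in> P" using D_conj by (simp add: conj_by_def)
  then show ?case using step1.prems by (simp add: conj_by_mult D_pow_add)
next
  case (step2 i)
  then have "conj_by (conj_by a (D_pow i)) (inv D) \<in> P"
    using D_inv_conj by (simp add: conj_by_def)
  then show ?case using step2.prems D_pow_add[of i "-1"] D_pow_minus[of 1]
    by (simp add: conj_by_mult)
qed

lemma L_one: "L \<one> = 0"
  using L_mult[of \<one> \<one>] by simp

lemma L_inv: "a \<in> carrier G \<Longrightarrow> L (inv a) = - L a"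
  using L_mult[of "inv a" a] L_one by simp

lemma L_D_pow: "L (D_pow p) = p * L D"
proof (induction p rule: int_induct[where k = 0])
  case base
  then show ?case by (simp add: L_one)
next
  case (step1 i)
  then show ?case by (simp add: D_pow_add L_mult distrib_right)
next
  case (step2 i)
  then show ?case using D_pow_add[of i "-1"] D_pow_minus[of 1]
    by (simp add: L_mult L_inv left_diff_distrib)
qed

lemma L_D_pos: "0 < L D"
  using L_pos[OF D_P D_nontrivial] .

lemma L_nonneg: "a \<in> P \<Longrightarrow> 0 \<le> L a"
  using L_pos[of a] L_one by fastforce

lemma prefix_refl [simp]: "a \<in> carrier G \<Longrightarrow> a \<preceq> a"
  by (simp add: prefix_def one_P)

lemma prefix_trans:
  assumes "a \<preceq> b" "b \<preceq> c" "a \<in> carrier G" "b \<in> carrier G" "c \<in> carrier G"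
  shows "a \<preceq> c"
  using mult_P[of "inv a \<otimes> b" "inv b \<otimes> c"] assms by (simp add: prefix_def group_word)

lemma prefix_antisym:
  assumes "a \<preceq> b" "b \<preceq> a" "a \<in> carrier G" "b \<in> carrier G"
  shows "a = b"
proof (rule ccontr)
  assume "a \<noteq> b"
  then have "0 < L (inv a \<otimes> b)" using L_pos assms by (simp add: prefix_def inv_mult_eq_one_iff)
  moreover have "0 \<le> L (inv b \<otimes> a)" using L_nonneg assms by (simp add: prefix_def)
  ultimately show False using assms by (simp add: L_mult L_inv)
qed

lemma prefix_mult_left:
  "c \<in> carrier G \<Longrightarrow> a \<in> carrier G \<Longrightarrow> b \<in> carrier G \<Longrightarrow> c \<otimes> a \<preceq> c \<otimes> b \<longleftrightarrow> a \<preceq> b"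
  by (simp add: prefix_def group_word)

text \<open>
  Right multiplication does not respect prefixes in general, but \<open>D\<^sup>p\<close> normalizes \<open>P\<close>.
\<close>

lemma prefix_mult_D_pow:
  assumes "a \<in> carrier G" "b \<in> carrier G"
  shows "a \<otimes> D_pow p \<preceq> b \<otimes> D_pow p \<longleftrightarrow> a \<preceq> b"
proof -
  have "conj_by (inv a \<otimes> b) (D_pow p) \<in> P \<longleftrightarrow> inv a \<otimes> b \<in> P"
    using conj_by_D_pow_P[of "inv a \<otimes> b" p] conj_by_D_pow_P[of "conj_by (inv a \<otimes> b) (D_pow p)" "- p"] assms
    by (auto simp: conj_by_mult D_pow_minus)
  then show ?thesis using assms by (simp add: prefix_def conj_by_def group_word)
qed

lemma one_prefix: "a \<in> carrier G \<Longrightarrow> \<one> \<preceq> a \<longleftrightarrow> a \<in> P"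
  by (simp add: prefix_def)

lemma prefix_mult_P: "a \<in> carrier G \<Longrightarrow> b \<in> P \<Longrightarrow> a \<preceq> a \<otimes> b"
  by (simp add: prefix_def)

lemma prefix_imp_L_le: "a \<preceq> b \<Longrightarrow> a \<in> carrier G \<Longrightarrow> b \<in> carrier G \<Longrightarrow> L a \<le> L b"
  using L_nonneg[of "inv a \<otimes> b"] by (simp add: prefix_def L_mult L_inv)

lemma D_pow_P: "0 \<le> p \<Longrightarrow> D_pow p \<in> P"
  by (induction p rule: int_ge_induct) (simp_all add: one_P mult_P D_P D_pow_add)

lemma D_pow_mono: "p \<le> q \<Longrightarrow> D_pow p \<preceq> D_pow q"
  using D_pow_P[of "q - p"] by (simp add: prefix_def D_pow_minus[symmetric] D_pow_add[symmetric])

text \<open>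
  Multiplying by a large power of \<open>D\<close> reduces to greatest common divisors of positive
  elements.
\<close>

lemma meet_exists:
  assumes "a \<in> carrier G" "b \<in> carrier G"
  shows "\<exists>m\<in>carrier G. m \<preceq> a \<and> m \<preceq> b \<and> (\<forall>d\<in>carrier G. d \<preceq> a \<longrightarrow> d \<preceq> b \<longrightarrow> d \<preceq> m)"
proof -
  have shift: "\<exists>k::nat. \<forall>j\<ge>int k. D_pow j \<otimes> c \<in> P" if "c \<in> carrier G" for c
  proof -
    obtain k :: nat where k: "D [^] k \<otimes> c \<in> P" using D_absorbs \<open>c \<in> carrier G\<close> by blast
    have "D_pow j \<otimes> c \<in> P" if "j \<ge> int k" for j
    proof -
      have "D_pow j = D_pow (j - int k) \<otimes> D_pow (int k)" by (simp add: D_pow_add[symmetric])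
      then have "D_pow j \<otimes> c = D_pow (j - int k) \<otimes> (D [^] k \<otimes> c)"
        using \<open>c \<in> carrier G\<close> by (simp add: int_pow_int m_assoc)
      then show ?thesis using mult_P[OF D_pow_P k] that by simp
    qed
    then show ?thesis by blast
  qed
  obtain k where k: "\<forall>j\<ge>int k. D_pow j \<otimes> a \<in> P" using shift assms by blast
  obtain l where l: "\<forall>j\<ge>int l. D_pow j \<otimes> b \<in> P" using shift assms by blast
  define i where "i = int (max k l)"
  obtain g where g: "g \<in> P" "g \<preceq> D_pow i \<otimes> a" "g \<preceq> D_pow i \<otimes> b"
    "\<And>d. d \<in> P \<Longrightarrow> d \<preceq> D_pow i \<otimes> a \<Longrightarrow> d \<preceq> D_pow i \<otimes> b \<Longrightarrow> d \<preceq> g"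
    using gcd_P[of "D_pow i \<otimes> a" "D_pow i \<otimes> b"] k l unfolding i_def prefix_def by auto
  let ?m = "inv (D_pow i) \<otimes> g"
  have "D_pow i \<otimes> ?m \<preceq> D_pow i \<otimes> a" "D_pow i \<otimes> ?m \<preceq> D_pow i \<otimes> b" using g by simp_all
  then have m: "?m \<in> carrier G" "?m \<preceq> a" "?m \<preceq> b"
    using assms g(1) prefix_mult_left[of "D_pow i" ?m] by auto
  \<comment> \<open>A common prefix \<open>d\<close> need not become positive after multiplication by \<open>D\<^sup>i\<close>, so a
    larger power \<open>D\<^sup>j\<close> is used; the greatest common divisor \<open>h\<close> at level \<open>j\<close> is again a
    multiple of \<open>D\<^sup>j\<^sup>-\<^sup>i\<close>, so it is comparable with \<open>g\<close>.\<close>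
  have "d \<preceq> ?m" if d: "d \<in> carrier G" "d \<preceq> a" "d \<preceq> b" for d
  proof -
    obtain k' where k': "\<forall>j\<ge>int k'. D_pow j \<otimes> d \<in> P" using shift d by blast
    define j where "j = max i (int k')"
    define r where "r = D_pow (j - i)"
    have r: "r \<in> P" unfolding r_def j_def by (rule D_pow_P) simp
    have Dj: "D_pow j = r \<otimes> D_pow i" by (simp add: r_def D_pow_add[symmetric])
    have jP: "D_pow j \<otimes> a \<in> P" "D_pow j \<otimes> b \<in> P" "D_pow j \<otimes> d \<in> P"
      using k l k' by (auto simp: j_def i_def)
    obtain h where h: "h \<in> P" "h \<preceq> D_pow j \<otimes> a" "h \<preceq> D_pow j \<otimes> b"
      "\<And>d. d \<in> P \<Longrightarrow> d \<preceq> D_pow j \<otimes> a \<Longrightarrow> d \<preceq> D_pow j \<otimes> b \<Longrightarrow> d \<preceq> h"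
      using gcd_P[OF jP(1,2)] unfolding prefix_def by auto
    have "r \<preceq> r \<otimes> (D_pow i \<otimes> a)" "r \<preceq> r \<otimes> (D_pow i \<otimes> b)"
      using r k l by (auto simp: i_def intro!: prefix_mult_P)
    then have "r \<preceq> h" using h(4)[of r] r assms by (simp add: Dj m_assoc)
    then have h': "inv r \<otimes> h \<in> P" by (simp add: prefix_def)
    have "r \<otimes> (inv r \<otimes> h) \<preceq> r \<otimes> (D_pow i \<otimes> a)" "r \<otimes> (inv r \<otimes> h) \<preceq> r \<otimes> (D_pow i \<otimes> b)"
      using h assms r by (simp_all add: Dj m_assoc)
    then have "inv r \<otimes> h \<preceq> g"
      using g(4)[OF h'] assms h(1) r prefix_mult_left[of r "inv r \<otimes> h" "D_pow i \<otimes> a"]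
        prefix_mult_left[of r "inv r \<otimes> h" "D_pow i \<otimes> b"] by blast
    then have "r \<otimes> (inv r \<otimes> h) \<preceq> r \<otimes> g"
      using g(1) h(1) r by (subst prefix_mult_left) auto
    moreover have "D_pow j \<otimes> d \<preceq> h"
      using h(4)[OF jP(3)] d assms by (simp add: prefix_mult_left)
    ultimately have "D_pow j \<otimes> d \<preceq> r \<otimes> g"
      using prefix_trans[of "D_pow j \<otimes> d" h "r \<otimes> g"] h(1) r g(1) d by simp
    also have "r \<otimes> g = D_pow j \<otimes> ?m" using r g(1) by (simp add: Dj group_word)
    finally show ?thesis using d m by (simp add: prefix_mult_left)
  qed
  then show ?thesis using m by blast
qed

lemma meet_props:
  assumes "a \<in> carrier G" "b \<in> carrier G"
  shows "a \<^bold>\<and> b \<in> carrier G \<and> a \<^bold>\<and> b \<preceq> a \<and> a \<^bold>\<and> b \<preceq> b \<and>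
     (\<forall>d\<in>carrier G. d \<preceq> a \<longrightarrow> d \<preceq> b \<longrightarrow> d \<preceq> a \<^bold>\<and> b)"
  unfolding meet_def by (rule theI') (use meet_exists[OF assms] prefix_antisym in blast)

lemma meet_closed [simp]: "a \<in> carrier G \<Longrightarrow> b \<in> carrier G \<Longrightarrow> a \<^bold>\<and> b \<in> carrier G"
  using meet_props by blast

lemma prefix_meet_iff:
  assumes "a \<in> carrier G" "b \<in> carrier G" "d \<in> carrier G"
  shows "d \<preceq> a \<^bold>\<and> b \<longleftrightarrow> d \<preceq> a \<and> d \<preceq> b"
  using meet_props[OF assms(1,2)] prefix_trans[of d "a \<^bold>\<and> b"] assms by blast

lemma meet_prefix:
  "a \<in> carrier G \<Longrightarrow> b \<in> carrier G \<Longrightarrow> a \<^bold>\<and> b \<preceq> a"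
  "a \<in> carrier G \<Longrightarrow> b \<in> carrier G \<Longrightarrow> a \<^bold>\<and> b \<preceq> b"
  using meet_props by blast+

text \<open>
  Identities between meets are proved by comparing the prefixes of both sides.
\<close>

lemma eq_by_prefixes:
  assumes "a \<in> carrier G" "b \<in> carrier G" "\<And>d. d \<in> carrier G \<Longrightarrow> d \<preceq> a \<longleftrightarrow> d \<preceq> b"
  shows "a = b"
  using assms(3)[of a] assms(3)[of b] assms(1,2) by (intro prefix_antisym) simp_all

lemma meet_commute: "a \<in> carrier G \<Longrightarrow> b \<in> carrier G \<Longrightarrow> a \<^bold>\<and> b = b \<^bold>\<and> a"
  by (rule eq_by_prefixes) (auto simp: prefix_meet_iff)

lemma meet_assoc:
  "a \<in> carrier G \<Longrightarrow> b \<in> carrier G \<Longrightarrow> c \<in> carrier G \<Longrightarrow> a \<^bold>\<and> b \<^bold>\<and> c = a \<^bold>\<and> (b \<^bold>\<and> c)"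
  by (rule eq_by_prefixes) (auto simp: prefix_meet_iff)

lemma meet_left_commute:
  "a \<in> carrier G \<Longrightarrow> b \<in> carrier G \<Longrightarrow> c \<in> carrier G \<Longrightarrow> a \<^bold>\<and> (b \<^bold>\<and> c) = b \<^bold>\<and> (a \<^bold>\<and> c)"
  by (rule eq_by_prefixes) (auto simp: prefix_meet_iff)

lemma meet_absorb:
  "a \<preceq> b \<Longrightarrow> a \<in> carrier G \<Longrightarrow> b \<in> carrier G \<Longrightarrow> a \<^bold>\<and> b = a"
  by (rule eq_by_prefixes) (auto simp: prefix_meet_iff intro: prefix_trans)

lemma mult_meet:
  assumes "a \<in> carrier G" "b \<in> carrier G" "c \<in> carrier G"
  shows "c \<otimes> (a \<^bold>\<and> b) = (c \<otimes> a) \<^bold>\<and> (c \<otimes> b)"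
proof (rule eq_by_prefixes)
  fix d assume d: "d \<in> carrier G"
  define e where "e = inv c \<otimes> d"
  have e: "e \<in> carrier G" "d = c \<otimes> e" using d assms by (auto simp: e_def)
  show "d \<preceq> c \<otimes> (a \<^bold>\<and> b) \<longleftrightarrow> d \<preceq> (c \<otimes> a) \<^bold>\<and> (c \<otimes> b)"
    using assms e by (simp add: prefix_meet_iff prefix_mult_left)
qed (use assms in auto)

lemma meet_mult_D_pow:
  assumes "a \<in> carrier G" "b \<in> carrier G"
  shows "(a \<^bold>\<and> b) \<otimes> D_pow p = (a \<otimes> D_pow p) \<^bold>\<and> (b \<otimes> D_pow p)"
proof (rule eq_by_prefixes)
  fix d assume d: "d \<in> carrier G"
  define e where "e = d \<otimes> inv (D_pow p)"
  have e: "e \<in> carrier G" "d = e \<otimes> D_pow p" using d by (auto simp: e_def m_assoc)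
  show "d \<preceq> (a \<^bold>\<and> b) \<otimes> D_pow p \<longleftrightarrow> d \<preceq> (a \<otimes> D_pow p) \<^bold>\<and> (b \<otimes> D_pow p)"
    using assms e by (simp add: prefix_meet_iff prefix_mult_D_pow)
qed (use assms in auto)

lemma meet_P: "a \<in> P \<Longrightarrow> b \<in> P \<Longrightarrow> a \<^bold>\<and> b \<in> P"
  using prefix_meet_iff[of a b \<one>] by (simp add: one_prefix)

lemma finite_interval: "finite {a \<in> carrier G. D_pow p \<preceq> a \<and> a \<preceq> D_pow q}"
proof -
  have "{a \<in> carrier G. D_pow p \<preceq> a \<and> a \<preceq> D_pow q} \<subseteq>
      (\<lambda>b. D_pow p \<otimes> b) ` {b \<in> P. L b \<le> (q - p) * L D}"
  proof clarify
    fix a assume a: "a \<in> carrier G" "D_pow p \<preceq> a" "a \<preceq> D_pow q"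
    have "inv (D_pow p) \<otimes> a \<in> P" "L (inv (D_pow p) \<otimes> a) \<le> (q - p) * L D"
      using a prefix_imp_L_le[OF a(3)] by (simp_all add: prefix_def L_mult L_inv L_D_pow left_diff_distrib)
    then show "a \<in> (\<lambda>b. D_pow p \<otimes> b) ` {b \<in> P. L b \<le> (q - p) * L D}"
      using a by (intro image_eqI[of _ _ "inv (D_pow p) \<otimes> a"]) auto
  qed
  then show ?thesis using finite_P finite_surj by blast
qed

section \<open>Normal forms\<close>

lemma meet_le_iff_right: "a \<in> carrier G \<Longrightarrow> b \<in> carrier G \<Longrightarrow> a \<^bold>\<and> b = a \<longleftrightarrow> a \<preceq> b"
  using meet_absorb meet_prefix(2) by fastforce

lemma prefix_D_power: "a \<in> carrier G \<Longrightarrow> \<exists>p. a \<preceq> D_pow p" 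
proof -
  assume a: "a \<in> carrier G"
  obtain k :: nat where k: "D [^] k \<otimes> inv a \<in> P" using D_absorbs a by blast
  have "conj_by (D [^] k \<otimes> inv a) (D_pow (int k)) \<in> P" by (rule conj_by_D_pow_P[OF k])
  also have "conj_by (D [^] k \<otimes> inv a) (D_pow (int k)) = inv a \<otimes> D_pow (int k)"
    using a by (simp add: conj_by_def int_pow_int m_assoc)
  finally show ?thesis unfolding prefix_def by blast
qed

lemma D_power_prefix: "a \<in> carrier G \<Longrightarrow> \<exists>p. D_pow p \<preceq> a"
proof -
  assume a: "a \<in> carrier G"
  obtain k :: nat where k: "D [^] k \<otimes> a \<in> P" using D_absorbs a by blast
  then have "D_pow (- int k) \<preceq> a" by (simp add: prefix_def D_pow_minus int_pow_int)
  then show ?thesis by blast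
qed

lemma prefix_D_pow_trans:
  "D_pow p \<preceq> a \<Longrightarrow> q \<le> p \<Longrightarrow> a \<in> carrier G \<Longrightarrow> D_pow q \<preceq> a"
  "a \<preceq> D_pow p \<Longrightarrow> p \<le> q \<Longrightarrow> a \<in> carrier G \<Longrightarrow> a \<preceq> D_pow q"
  using prefix_trans[OF D_pow_mono, of q p a] prefix_trans[OF _ D_pow_mono, of a p q] by simp_all

text \<open>
  If \<open>w \<^bold>\<and> D = 1\<close>, then \<open>w \<^bold>\<and> D\<^sup>k = 1\<close> for every \<open>k\<close>: a common prefix of \<open>w\<close> and \<open>D\<^sup>k\<^sup>+\<^sup>1\<close> is a
  prefix of \<open>w D\<^sup>k \<^bold>\<and> D D\<^sup>k = (w \<^bold>\<and> D) D\<^sup>k = D\<^sup>k\<close>. But \<open>w\<close> is a prefix of some power of \<open>D\<close>.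
\<close>

lemma positive_meet_D:
  assumes "w \<in> P" "w \<noteq> \<one>"
  shows "w \<^bold>\<and> D \<noteq> \<one>"
proof
  assume 1: "w \<^bold>\<and> D = \<one>"
  have "w \<^bold>\<and> D_pow (int k) = \<one>" for k
  proof (induction k)
    case 0
    then show ?case using assms meet_commute[of w \<one>] meet_absorb[of \<one> w] by (simp add: one_prefix)
  next
    case (Suc k)
    let ?m = "w \<^bold>\<and> D_pow (int (Suc k))"
    have m: "?m \<in> P" using assms(1) D_pow_P by (intro meet_P) auto
    have "?m \<preceq> w \<otimes> D_pow (int k)"
      using prefix_trans[OF meet_prefix(1) prefix_mult_P[OF _ D_pow_P], of w "D_pow (int (Suc k))" "int k"]
        assms(1) by simp
    then have "?m \<preceq> (w \<otimes> D_pow (int k)) \<^bold>\<and> (D \<otimes> D_pow (int k))"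
      using assms(1) meet_prefix(2)[of w "D_pow (int (Suc k))"] by (simp add: prefix_meet_iff D_pow_add)
    also have "\<dots> = D_pow (int k)"
      using assms(1) by (simp add: meet_mult_D_pow[symmetric] 1)
    finally have "?m \<preceq> w \<^bold>\<and> D_pow (int k)"
      using assms(1) meet_prefix(1)[of w] by (simp add: prefix_meet_iff)
    then have "?m \<preceq> \<one>" by (simp only: Suc.IH)
    then show ?case using m by (intro prefix_antisym) (auto simp: one_prefix)
  qed
  note 2 = this
  obtain p where "w \<preceq> D_pow p" using prefix_D_power assms(1) by blast
  then have "w \<preceq> D_pow (int (nat p))" using prefix_D_pow_trans(2) assms(1) by fastforce
  then have "w \<^bold>\<and> D_pow (int (nat p)) = w" using assms(1) by (intro meet_absorb) auto
  then show False using assms(2) 2[of "nat p"] by simp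
qed

text \<open>
  Infimum and supremum are relations rather than functions, so that no value has to be
  chosen before existence and uniqueness are known.
\<close>

definition has_inf :: "'a \<Rightarrow> int \<Rightarrow> bool" where
  "has_inf y p \<longleftrightarrow> D_pow p \<preceq> y \<and> \<not> D_pow (p + 1) \<preceq> y"

definition has_sup :: "'a \<Rightarrow> int \<Rightarrow> bool" where
  "has_sup y q \<longleftrightarrow> y \<preceq> D_pow q \<and> \<not> y \<preceq> D_pow (q - 1)"

lemma has_inf_prefix_iff: "has_inf y p \<Longrightarrow> y \<in> carrier G \<Longrightarrow> D_pow r \<preceq> y \<longleftrightarrow> r \<le> p"
  unfolding has_inf_def using prefix_D_pow_trans(1)[of _ y] by (metis zless_add1_eq linorder_not_le zless_imp_add1_zle)

lemma has_sup_prefix_iff: "has_sup y q \<Longrightarrow> y \<in> carrier G \<Longrightarrow> y \<preceq> D_pow r \<longleftrightarrow> q \<le> r"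
  unfolding has_sup_def using prefix_D_pow_trans(2)[of y] by (metis linorder_not_le zle_diff1_eq)

lemma has_inf_unique: "has_inf y p \<Longrightarrow> has_inf y p' \<Longrightarrow> y \<in> carrier G \<Longrightarrow> p = p'"
  using has_inf_prefix_iff has_inf_def by (meson antisym)

lemma has_sup_unique: "has_sup y q \<Longrightarrow> has_sup y q' \<Longrightarrow> y \<in> carrier G \<Longrightarrow> q = q'"
  using has_sup_prefix_iff has_sup_def by (meson antisym)

text \<open>
  The exponents \<open>p\<close> with \<open>D\<^sup>p \<preceq> y\<close> are bounded by the length of \<open>y\<close>.
\<close>

lemma has_inf_exists: "y \<in> carrier G \<Longrightarrow> \<exists>p. has_inf y p"
proof (rule ccontr)
  assume y: "y \<in> carrier G" and no: "\<nexists>p. has_inf y p"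
  obtain p0 where p0: "D_pow p0 \<preceq> y" using D_power_prefix y by blast
  have all: "D_pow p \<preceq> y" if "p0 \<le> p" for p
    using that by (induction p rule: int_ge_induct) (use p0 no has_inf_def in auto)
  define p where "p = max p0 (L y + 1)"
  have "p * L D \<le> L y"
    using prefix_imp_L_le[OF all[of p]] y by (simp add: p_def L_D_pow)
  moreover have "0 \<le> L y \<Longrightarrow> p * 1 \<le> p * L D"
    using L_D_pos by (intro mult_left_mono) (auto simp: p_def)
  moreover have "p > L y" by (simp add: p_def)
  moreover have "L y < 0 \<Longrightarrow> False"
  proof -
    assume "L y < 0"
    have "D_pow (max p0 0) \<preceq> y" by (rule all) simp
    then have "(max p0 0) * L D \<le> L y" using prefix_imp_L_le y by (simp add: L_D_pow[symmetric])
    moreover have "0 \<le> max p0 0 * L D" using L_D_pos by simp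
    ultimately show False using \<open>L y < 0\<close> by simp
  qed
  ultimately show False by linarith
qed

text \<open>
  The initial factor \<open>\<tau>\<^sup>-\<^sup>p(x\<^sub>1)\<close> of an element \<open>y\<close> of infimum \<open>p\<close>, written without its normal
  form. The parameter \<open>p\<close> is kept fixed for all elements of an ultra summit set, which makes
  the formula compatible with meets.
\<close>

definition iota :: "int \<Rightarrow> 'a \<Rightarrow> 'a" where
  "iota p y = (y \<otimes> D_pow (- p)) \<^bold>\<and> D"

abbreviation left_weighted_list :: "'a list \<Rightarrow> bool" where
  "left_weighted_list \<equiv> successively (\<lambda>s t. (inv s \<otimes> D) \<^bold>\<and> t = \<one>)"

definition normal_form :: "'a \<Rightarrow> int \<Rightarrow> 'a list \<Rightarrow> bool" where
  "normal_form y p xs \<longleftrightarrow> y = D_pow p \<otimes> foldr (\<otimes>) xs \<one> \<and>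
     set xs \<subseteq> {s \<in> carrier G. \<one> \<preceq> s \<and> s \<preceq> D} - {\<one>, D} \<and>
     left_weighted_list xs"

lemma foldr_mult_P: "set xs \<subseteq> P \<Longrightarrow> foldr (\<otimes>) xs \<one> \<in> P"
  by (induction xs) (auto simp: one_P mult_P)

text \<open>
  In a left-weighted product the first factor is the largest simple prefix: with \<open>w\<close> the
  product of the other factors, \<open>D \<^bold>\<and> x w = x (\<partial>x \<^bold>\<and> w)\<close>, and \<open>\<partial>x \<preceq> D\<close> sees only the first
  factor of \<open>w\<close>.
\<close>

lemma left_weighted_head:
  assumes "left_weighted_list (x # xs)" "set (x # xs) \<subseteq> {s \<in> P. s \<preceq> D}"
  shows "foldr (\<otimes>) (x # xs) \<one> \<^bold>\<and> D = x"
  using assms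
proof (induction xs arbitrary: x)
  case Nil
  then show ?case by (auto simp: meet_absorb)
next
  case (Cons x' xs)
  let ?w = "foldr (\<otimes>) (x' # xs) \<one>"
  have x: "x \<in> P" "inv x \<otimes> D \<in> P" using Cons.prems by (auto simp: prefix_def)
  have w: "?w \<in> P" using Cons.prems by (intro foldr_mult_P) auto
  have x': "x' \<in> P" using Cons.prems by auto
  have hd: "?w \<^bold>\<and> D = x'" using Cons.IH[of x'] Cons.prems by simp
  have "inv x \<otimes> D \<preceq> D"
    using x(1) D_conj[OF x(1)] by (simp add: prefix_def group_word)
  then have "(inv x \<otimes> D) \<^bold>\<and> ?w = (inv x \<otimes> D) \<^bold>\<and> D \<^bold>\<and> ?w"
    using x w by (simp add: meet_absorb)
  also have "\<dots> = (inv x \<otimes> D) \<^bold>\<and> (?w \<^bold>\<and> D)"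
    using x(1) w by (simp add: meet_assoc meet_commute meet_left_commute)
  also have "\<dots> = \<one>" using hd Cons.prems by simp
  finally have "(x \<otimes> ?w) \<^bold>\<and> (x \<otimes> (inv x \<otimes> D)) = x"
    using x(1) w meet_commute[of "inv x \<otimes> D" ?w] by (subst mult_meet[symmetric]) auto
  then show ?case using x(1) by simp
qed

text \<open>
  Splitting off the largest simple prefix lowers the supremum, because
  \<open>w \<preceq> w D\<^sup>k \<^bold>\<and> D D\<^sup>k = (w \<^bold>\<and> D) D\<^sup>k\<close>.
\<close>

lemma prefix_D_pow_quotient:
  assumes "w \<in> P" "w \<preceq> D_pow (k + 1)" "0 \<le> k"
  shows "inv (w \<^bold>\<and> D) \<otimes> w \<preceq> D_pow k"
proof -
  have "w \<preceq> w \<otimes> D_pow k" using assms by (intro prefix_mult_P D_pow_P) auto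
  moreover have "w \<preceq> D \<otimes> D_pow k"
    using assms D_pow_add[of 1 k] by (simp add: add.commute)
  ultimately have "w \<preceq> (w \<^bold>\<and> D) \<otimes> D_pow k"
    using assms by (simp add: meet_mult_D_pow prefix_meet_iff)
  then show ?thesis
    using assms(1) prefix_mult_left[of "w \<^bold>\<and> D" "inv (w \<^bold>\<and> D) \<otimes> w" "D_pow k"] by simp
qed

lemma left_weighted_sup:
  assumes "left_weighted_list xs" "set xs \<subseteq> {s \<in> P. s \<preceq> D} - {\<one>}"
  shows "has_sup (foldr (\<otimes>) xs \<one>) (int (length xs))"
  using assms
proof (induction xs)
  case Nil
  show ?case using prefix_imp_L_le[of \<one> "D_pow (- 1)"] L_D_pos L_D_pow[of "- 1"]
    by (auto simp: has_sup_def L_one)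
next
  case (Cons x xs)
  let ?w = "foldr (\<otimes>) xs \<one>"
  have x: "x \<in> P" "x \<preceq> D" "x \<noteq> \<one>" using Cons.prems by auto
  have w: "?w \<in> P" using Cons.prems by (intro foldr_mult_P) auto
  have sup: "has_sup ?w (int (length xs))"
    using Cons by (auto simp: successively_Cons)
  have "x \<otimes> ?w \<preceq> x \<otimes> D_pow (int (length xs))"
    using sup x w by (simp add: has_sup_def prefix_mult_left)
  also have "x \<otimes> D_pow (int (length xs)) \<preceq> D \<otimes> D_pow (int (length xs))"
    using x by (simp add: prefix_mult_D_pow)
  finally (prefix_trans) have "x \<otimes> ?w \<preceq> D_pow (int (length (x # xs)))"
    using x w D_pow_add[of 1 "int (length xs)"] by simp
  moreover have False if "x \<otimes> ?w \<preceq> D_pow (int (length xs))"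
  proof (cases xs)
    case Nil
    then have "x \<preceq> \<one>" using that x by simp
    then show False using x prefix_antisym[of x \<one>] by (simp add: one_prefix)
  next
    case (Cons a list)
    have "(x \<otimes> ?w) \<^bold>\<and> D = x" using left_weighted_head[of x xs] Cons.prems by auto
    moreover have "int (length xs) = int (length list) + 1" using Cons by simp
    ultimately have "?w \<preceq> D_pow (int (length list))"
      using prefix_D_pow_quotient[of "x \<otimes> ?w" "int (length list)"] that x w mult_P by simp
    then show False using sup has_sup_prefix_iff w Cons by fastforce
  qed
  ultimately show ?case by (auto simp: has_sup_def)
qed

text \<open>
  A normal form determines infimum, supremum and initial factor by order-theoretic formulas
  in which the normal form no longer occurs; this yields its uniqueness as far as it is
  needed.
\<close>

lemma normal_form_props:
  assumes "normal_form y p xs"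
  shows "y \<in> carrier G" "has_inf y p" "has_sup y (p + int (length xs))"
    and "(if xs = [] then \<one> else conj_by (hd xs) (D_pow (- p))) = iota p y"
proof -
  let ?w = "foldr (\<otimes>) xs \<one>"
  have xs: "set xs \<subseteq> {s \<in> P. s \<preceq> D} - {\<one>, D}" and lw: "left_weighted_list xs"
    and y: "y = D_pow p \<otimes> ?w"
    using assms by (auto simp: normal_form_def one_prefix)
  have w: "?w \<in> P" using xs by (intro foldr_mult_P) auto
  then show yc: "y \<in> carrier G" by (simp add: y)
  have hd: "xs = [] \<or> ?w \<^bold>\<and> D = hd xs"
    using left_weighted_head[of "hd xs" "tl xs"] lw xs by (cases xs) auto
  have "\<not> D \<preceq> ?w"
  proof
    assume D: "D \<preceq> ?w"
    show False
    proof (cases xs)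
      case Nil
      then show False using D prefix_imp_L_le[of D \<one>] L_D_pos by (simp add: L_one)
    next
      case (Cons x list)
      have "?w \<^bold>\<and> D = D" using D w meet_absorb[of D ?w] meet_commute[of D ?w] by simp
      then show False using hd Cons xs by auto
    qed
  qed
  then show "has_inf y p"
    using w prefix_mult_left[of "D_pow p" \<one> ?w] prefix_mult_left[of "D_pow p" D ?w]
    by (simp add: has_inf_def y one_prefix D_pow_add)
  have "has_sup ?w (int (length xs))" using left_weighted_sup lw xs by blast
  then show "has_sup y (p + int (length xs))"
    using w prefix_mult_left[of "D_pow p" ?w "D_pow (int (length xs))"]
      prefix_mult_left[of "D_pow p" ?w "D_pow (int (length xs) - 1)"]
    by (simp add: has_sup_def y D_pow_add[symmetric] add_diff_eq)
  have "iota p y = D_pow p \<otimes> ((?w \<^bold>\<and> D) \<otimes> D_pow (- p))"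
  proof -
    have "D_pow p \<otimes> (D \<otimes> D_pow (- p)) = D"
      using D_pow_commute[of 1 "- p"] by (simp add: D_pow_minus)
    then show ?thesis using w by (simp add: iota_def y meet_mult_D_pow mult_meet m_assoc)
  qed
  moreover have hd_closed: "xs \<noteq> [] \<Longrightarrow> hd xs \<in> carrier G" using xs by (cases xs) auto
  moreover have "xs = [] \<Longrightarrow> ?w \<^bold>\<and> D = \<one>"
    using meet_absorb[of \<one> D] D_P by (simp add: one_prefix)
  ultimately show "(if xs = [] then \<one> else conj_by (hd xs) (D_pow (- p))) = iota p y"
    using hd w hd_closed by (auto simp: conj_by_def D_pow_minus m_assoc)
qed

text \<open>
  The greedy algorithm: split off the largest simple prefix and recurse.
\<close>

lemma left_weighted_exists:
  assumes "w \<in> P" "\<not> D \<preceq> w"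
  shows "\<exists>xs. w = foldr (\<otimes>) xs \<one> \<and> set xs \<subseteq> {s \<in> P. s \<preceq> D} - {\<one>, D} \<and> left_weighted_list xs"
  using assms
proof (induction "nat (L w)" arbitrary: w rule: less_induct)
  case less
  show ?case
  proof (cases "w = \<one>")
    case True
    then show ?thesis by (intro exI[of _ "[]"]) simp
  next
    case False
    define s where "s = w \<^bold>\<and> D"
    define v where "v = inv s \<otimes> w"
    have s: "s \<in> P" "s \<preceq> D" "s \<noteq> \<one>" "s \<preceq> w"
      using less.prems False positive_meet_D meet_P D_P meet_prefix by (auto simp: s_def)
    have "s \<noteq> D" using less.prems s(4) by auto
    have v: "v \<in> P" "w = s \<otimes> v" using s less.prems by (simp_all add: v_def prefix_def)
    have "L v < L w" "0 \<le> L v" using v s L_pos L_nonneg by (simp_all add: L_mult)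
    then have lt: "nat (L v) < nat (L w)" by simp
    have nD: "\<not> D \<preceq> v"
    proof
      assume "D \<preceq> v"
      then have "s \<otimes> D \<preceq> w" using v s by (simp add: prefix_mult_left)
      moreover have "D \<preceq> s \<otimes> D" using D_conj[OF s(1)] s(1) by (simp add: prefix_def m_assoc)
      ultimately show False using less.prems prefix_trans[of D "s \<otimes> D" w] s by simp
    qed
    obtain xs where xs: "v = foldr (\<otimes>) xs \<one>" "set xs \<subseteq> {s \<in> P. s \<preceq> D} - {\<one>, D}"
      "left_weighted_list xs" using less.hyps[OF lt v(1) nD] by blast
    have "left_weighted_list (s # xs)"
    proof (cases xs)
      case (Cons x list)
      have x: "v \<^bold>\<and> D = x" using left_weighted_head[of x list] xs Cons by auto
      have sD: "inv s \<otimes> D \<preceq> D" using s(1) D_conj[OF s(1)] by (simp add: prefix_def group_word)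
      have "(inv s \<otimes> D) \<^bold>\<and> x = (inv s \<otimes> D) \<^bold>\<and> D \<^bold>\<and> v"
        using s v by (simp add: x[symmetric] meet_assoc meet_commute meet_left_commute)
      also have "\<dots> = (inv s \<otimes> D) \<^bold>\<and> (inv s \<otimes> w)"
        using s sD v by (simp add: meet_absorb)
      also have "\<dots> = inv s \<otimes> (w \<^bold>\<and> D)"
        using s less.prems(1) by (simp add: mult_meet meet_commute)
      also have "\<dots> = \<one>" using s by (simp add: s_def[symmetric])
      finally show ?thesis using xs Cons by simp
    qed simp
    then show ?thesis using xs s v \<open>s \<noteq> D\<close> by (intro exI[of _ "s # xs"]) auto
  qed
qed

lemma normal_form_exists:
  assumes "y \<in> carrier G"
  shows "\<exists>p xs. normal_form y p xs"
proof -
  obtain p where p: "has_inf y p" using has_inf_exists assms by blast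
  define w where "w = inv (D_pow p) \<otimes> y"
  have w: "w \<in> P" "y = D_pow p \<otimes> w" using p assms by (simp_all add: w_def has_inf_def prefix_def)
  have "\<not> D \<preceq> w"
    using p w prefix_mult_left[of "D_pow p" D w] by (simp add: has_inf_def D_pow_add)
  then obtain xs where "w = foldr (\<otimes>) xs \<one>" "set xs \<subseteq> {s \<in> P. s \<preceq> D} - {\<one>, D}"
    "left_weighted_list xs" using left_weighted_exists w by blast
  then have "normal_form y p xs" using w by (auto simp: normal_form_def one_prefix)
  then show ?thesis by blast
qed

section \<open>Cycling\<close>

lemma iota_closed [simp]: "y \<in> carrier G \<Longrightarrow> iota p y \<in> carrier G"
  by (simp add: iota_def)

lemma iota_prefix_D: "y \<in> carrier G \<Longrightarrow> iota p y \<preceq> D"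
  by (simp add: iota_def meet_prefix)

lemma D_pow_prefix_iff_right:
  assumes "y \<in> carrier G" shows "D_pow p \<preceq> y \<longleftrightarrow> y \<otimes> D_pow (- p) \<in> P"
  using prefix_mult_D_pow[of "D_pow p" y "- p"] assms
  by (simp add: one_prefix D_pow_minus)

lemma iota_P:
  assumes "y \<in> carrier G" "D_pow p \<preceq> y" shows "iota p y \<in> P"
  using assms D_pow_prefix_iff_right unfolding iota_def by (intro meet_P D_P) simp

lemma iota_eq_D_iff:
  assumes "y \<in> carrier G" shows "iota p y = D \<longleftrightarrow> D_pow (p + 1) \<preceq> y"
proof -
  have "iota p y = D \<longleftrightarrow> D \<preceq> y \<otimes> D_pow (- p)"
    using assms meet_le_iff_right[of D "y \<otimes> D_pow (- p)"] meet_commute[of D "y \<otimes> D_pow (- p)"]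
    by (simp add: iota_def)
  also have "\<dots> \<longleftrightarrow> D_pow (p + 1) \<preceq> y"
    using assms prefix_mult_D_pow[of D "y \<otimes> D_pow (- p)" p] D_pow_add[of 1 p]
    by (simp add: m_assoc D_pow_minus add.commute)
  finally show ?thesis .
qed

definition cyc :: "int \<Rightarrow> 'a \<Rightarrow> 'a" where
  "cyc p y = conj_by y (iota p y)"

lemma cyc_closed [simp]: "y \<in> carrier G \<Longrightarrow> cyc p y \<in> carrier G"
  by (simp add: cyc_def)

lemma cyc_pow_closed [simp]: "y \<in> carrier G \<Longrightarrow> (cyc p ^^ k) y \<in> carrier G"
  by (induction k) auto

text \<open>
  Bounds on a conjugate, as inequalities in which the conjugator \<open>a\<close> occurs only through
  left translation and right multiplication by powers of \<open>D\<close>. In this form they pass to meets of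
  conjugators.
\<close>

lemma conj_by_prefix_iff:
  assumes "y \<in> carrier G" "a \<in> carrier G"
  shows "D_pow p \<preceq> conj_by y a \<longleftrightarrow> a \<preceq> y \<otimes> a \<otimes> D_pow (- p)"
    and "conj_by y a \<preceq> D_pow q \<longleftrightarrow> y \<otimes> a \<preceq> a \<otimes> D_pow q"
proof -
  have "D_pow p \<preceq> conj_by y a \<longleftrightarrow> D_pow p \<otimes> D_pow (- p) \<preceq> conj_by y a \<otimes> D_pow (- p)"
    using assms by (subst prefix_mult_D_pow) auto
  also have "\<dots> \<longleftrightarrow> a \<otimes> \<one> \<preceq> a \<otimes> (conj_by y a \<otimes> D_pow (- p))"
    using assms by (subst prefix_mult_left) (auto simp: D_pow_minus)
  finally show "D_pow p \<preceq> conj_by y a \<longleftrightarrow> a \<preceq> y \<otimes> a \<otimes> D_pow (- p)"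
    using assms by (simp add: conj_by_def m_assoc)
  show "conj_by y a \<preceq> D_pow q \<longleftrightarrow> y \<otimes> a \<preceq> a \<otimes> D_pow q"
    using assms prefix_mult_left[of a "conj_by y a" "D_pow q"] by (simp add: conj_by_def m_assoc)
qed

lemma cyc_inf:
  assumes "y \<in> carrier G" "D_pow p \<preceq> y" shows "D_pow p \<preceq> cyc p y"
proof -
  let ?i = "iota p y"
  have i: "?i \<in> P" using assms by (rule iota_P)
  have "?i \<preceq> y \<otimes> D_pow (- p)" using assms by (simp add: iota_def meet_prefix)
  moreover have "y \<otimes> D_pow (- p) \<preceq> y \<otimes> ?i \<otimes> D_pow (- p)"
    using assms i by (subst prefix_mult_D_pow) (auto intro: prefix_mult_P)
  ultimately show ?thesis
    using prefix_trans[of ?i "y \<otimes> D_pow (- p)" "y \<otimes> ?i \<otimes> D_pow (- p)"] assms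
    by (simp add: cyc_def conj_by_prefix_iff)
qed

text \<open>
  The bound is checked on the two arguments of the meet \<open>\<iota>(y) D\<^sup>q = y D\<^sup>q\<^sup>-\<^sup>p \<^bold>\<and> D\<^sup>q\<^sup>+\<^sup>1\<close>.
\<close>

lemma cyc_sup:
  assumes "y \<in> carrier G" "y \<preceq> D_pow q" "p < q" shows "cyc p y \<preceq> D_pow q"
proof -
  let ?i = "iota p y"
  have iD: "?i \<preceq> D" using assms by (simp add: iota_prefix_D)
  have "?i \<preceq> D_pow (q - p)"
    using prefix_trans[OF iD D_pow_mono[of 1 "q - p", simplified]] assms by simp
  then have 1: "y \<otimes> ?i \<preceq> y \<otimes> D_pow (- p) \<otimes> D_pow q"
    using assms by (simp add: m_assoc D_pow_add[symmetric] prefix_mult_left)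
  have "y \<otimes> ?i \<preceq> y \<otimes> D" using assms iD by (simp add: prefix_mult_left)
  also have "y \<otimes> D \<preceq> D_pow q \<otimes> D" using assms prefix_mult_D_pow[of y "D_pow q" 1] by simp
  finally (prefix_trans) have "y \<otimes> ?i \<preceq> D \<otimes> D_pow q"
    using assms D_pow_commute[of q 1] by simp
  with 1 have "y \<otimes> ?i \<preceq> ?i \<otimes> D_pow q"
    unfolding iota_def using assms by (subst meet_mult_D_pow) (simp_all add: prefix_meet_iff)
  then show ?thesis using assms by (simp add: cyc_def conj_by_prefix_iff)
qed

lemma cyc_pow_inf: "y \<in> carrier G \<Longrightarrow> D_pow p \<preceq> y \<Longrightarrow> D_pow p \<preceq> (cyc p ^^ k) y"
  by (induction k) (auto intro: cyc_inf)

lemma cyc_pow_sup: "y \<in> carrier G \<Longrightarrow> y \<preceq> D_pow q \<Longrightarrow> p < q \<Longrightarrow> (cyc p ^^ k) y \<preceq> D_pow q"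
  by (induction k) (auto intro: cyc_sup)

lemma iota_conj_D:
  assumes "y \<in> carrier G"
  shows "iota p (conj_by y (D_pow m)) = conj_by (iota p y) (D_pow m)"
proof -
  have "conj_by y (D_pow m) \<otimes> D_pow (- p) = inv (D_pow m) \<otimes> (y \<otimes> D_pow (- p) \<otimes> D_pow m)"
    using assms D_pow_commute[of m "- p"] by (simp add: conj_by_def m_assoc)
  moreover have "D = inv (D_pow m) \<otimes> (D \<otimes> D_pow m)"
    using D_pow_commute[of 1 m] by simp
  ultimately have "iota p (conj_by y (D_pow m)) =
      (inv (D_pow m) \<otimes> (y \<otimes> D_pow (- p) \<otimes> D_pow m)) \<^bold>\<and> (inv (D_pow m) \<otimes> (D \<otimes> D_pow m))"
    by (simp add: iota_def)
  also have "\<dots> = inv (D_pow m) \<otimes> (((y \<otimes> D_pow (- p)) \<^bold>\<and> D) \<otimes> D_pow m)"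
    using assms by (simp add: mult_meet meet_mult_D_pow)
  finally show ?thesis using assms by (simp add: iota_def conj_by_def m_assoc)
qed

lemma conj_by_conj_by:
  "y \<in> carrier G \<Longrightarrow> a \<in> carrier G \<Longrightarrow> b \<in> carrier G \<Longrightarrow>
   conj_by (conj_by y a) (conj_by b a) = conj_by (conj_by y b) a"
  by (simp add: conj_by_def group_word)

lemma cyc_conj_D:
  "y \<in> carrier G \<Longrightarrow> cyc p (conj_by y (D_pow m)) = conj_by (cyc p y) (D_pow m)"
  by (simp add: cyc_def iota_conj_D conj_by_conj_by)

lemma cyc_pow_conj_D:
  "y \<in> carrier G \<Longrightarrow> (cyc p ^^ k) (conj_by y (D_pow m)) = conj_by ((cyc p ^^ k) y) (D_pow m)"
  by (induction k) (simp_all add: cyc_conj_D)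

section \<open>Transport and convexity\<close>

text \<open>
  If \<open>a\<close> carries \<open>y\<close> to \<open>z\<close>, its transport carries the cycling of \<open>y\<close> to the cycling of
  \<open>z\<close>.
\<close>

definition transport :: "int \<Rightarrow> 'a \<Rightarrow> 'a \<Rightarrow> 'a" where
  "transport p y a = inv (iota p y) \<otimes> a \<otimes> iota p (conj_by y a)"

text \<open>
  Translating the meet \<open>\<iota>(y\<^sup>a)\<close> by \<open>a\<close> removes the conjugate \<open>y\<^sup>a\<close> from the formula. The right-hand
  side depends on \<open>a\<close> only through operations that preserve meets.
\<close>

lemma transport_alt:
  assumes "y \<in> carrier G" "a \<in> carrier G"
  shows "transport p y a = inv (iota p y) \<otimes> ((y \<otimes> a \<otimes> D_pow (- p)) \<^bold>\<and> (a \<otimes> D))"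
  using assms by (simp add: transport_def iota_def m_assoc mult_meet conj_by_def)

lemma transport_meet:
  assumes "y \<in> carrier G" "a \<in> carrier G" "b \<in> carrier G"
  shows "transport p y (a \<^bold>\<and> b) = transport p y a \<^bold>\<and> transport p y b"
proof -
  have "(y \<otimes> (a \<^bold>\<and> b) \<otimes> D_pow (- p)) \<^bold>\<and> ((a \<^bold>\<and> b) \<otimes> D) =
      ((y \<otimes> a \<otimes> D_pow (- p)) \<^bold>\<and> (a \<otimes> D)) \<^bold>\<and> ((y \<otimes> b \<otimes> D_pow (- p)) \<^bold>\<and> (b \<otimes> D))"
    using assms meet_mult_D_pow[of a b 1]
    by (simp add: mult_meet meet_mult_D_pow meet_assoc meet_left_commute meet_commute)
  then show ?thesis using assms by (simp add: transport_alt mult_meet)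
qed

lemma transport_D_pow:
  assumes "y \<in> carrier G"
  shows "transport p y (D_pow m) = D_pow m"
  using assms by (simp add: transport_def iota_conj_D) (simp add: conj_by_def m_assoc)

text \<open>
  The product of the first \<open>k\<close> initial factors met when cycling; conjugation by it is \<open>k\<close>-fold
  cycling.
\<close>

primrec cyc_prod :: "int \<Rightarrow> nat \<Rightarrow> 'a \<Rightarrow> 'a" where
  "cyc_prod p 0 y = \<one>"
| "cyc_prod p (Suc k) y = cyc_prod p k y \<otimes> iota p ((cyc p ^^ k) y)"

lemma cyc_prod_closed [simp]: "y \<in> carrier G \<Longrightarrow> cyc_prod p k y \<in> carrier G"
  by (induction k) auto

lemma cyc_pow_eq_conj_by: "y \<in> carrier G \<Longrightarrow> (cyc p ^^ k) y = conj_by y (cyc_prod p k y)"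
  by (induction k) (simp_all add: cyc_def conj_by_mult[symmetric])

lemma cyc_prod_add:
  "y \<in> carrier G \<Longrightarrow> cyc_prod p (k + l) y = cyc_prod p k y \<otimes> cyc_prod p l ((cyc p ^^ k) y)"
  by (induction l)
    (simp_all add: m_assoc add.commute funpow_add[symmetric] flip: comp_apply[of "cyc p ^^ _" "cyc p ^^ _"])

definition transports :: "int \<Rightarrow> nat \<Rightarrow> 'a \<Rightarrow> 'a \<Rightarrow> 'a" where
  "transports p k y a = inv (cyc_prod p k y) \<otimes> a \<otimes> cyc_prod p k (conj_by y a)"

lemma transports_closed [simp]:
  "y \<in> carrier G \<Longrightarrow> a \<in> carrier G \<Longrightarrow> transports p k y a \<in> carrier G"
  by (simp add: transports_def)

lemma conj_by_transports:
  "y \<in> carrier G \<Longrightarrow> a \<in> carrier G \<Longrightarrow>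
   conj_by ((cyc p ^^ k) y) (transports p k y a) = (cyc p ^^ k) (conj_by y a)"
  by (simp add: cyc_pow_eq_conj_by transports_def conj_by_mult m_assoc)

lemma transports_0 [simp]: "y \<in> carrier G \<Longrightarrow> a \<in> carrier G \<Longrightarrow> transports p 0 y a = a"
  by (simp add: transports_def)

lemma transports_Suc:
  assumes "y \<in> carrier G" "a \<in> carrier G"
  shows "transports p (Suc k) y a = transport p ((cyc p ^^ k) y) (transports p k y a)"
  unfolding transport_def conj_by_transports[OF assms]
  using assms by (simp add: transports_def group_word)

lemma transports_add:
  assumes "y \<in> carrier G" "a \<in> carrier G"
  shows "transports p (k + l) y a = transports p l ((cyc p ^^ k) y) (transports p k y a)"
  unfolding transports_def[of p l] conj_by_transports[OF assms]
  using assms by (simp add: transports_def cyc_prod_add group_word)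

lemma transports_meet:
  assumes "y \<in> carrier G" "a \<in> carrier G" "b \<in> carrier G"
  shows "transports p k y (a \<^bold>\<and> b) = transports p k y a \<^bold>\<and> transports p k y b"
  by (induction k) (use assms in \<open>simp_all add: transports_Suc transport_meet\<close>)

lemma transports_D_pow: "y \<in> carrier G \<Longrightarrow> transports p k y (D_pow m) = D_pow m"
  by (induction k) (simp_all add: transports_Suc transport_D_pow)

lemma transports_mono:
  assumes "y \<in> carrier G" "a \<in> carrier G" "b \<in> carrier G" "a \<preceq> b"
  shows "transports p k y a \<preceq> transports p k y b"
  using transports_meet[OF assms(1-3), of p k] meet_absorb[OF assms(4)] assms
  by (metis meet_prefix(2) transports_closed)

text \<open>
  Transport fixes all powers of \<open>D\<close> and is monotone, so it preserves the finite interval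
  between \<open>1\<close> and \<open>D\<^sup>m\<close>.
\<close>

lemma transports_bounds:
  assumes "y \<in> carrier G" "a \<in> P" "a \<preceq> D_pow m"
  shows "transports p k y a \<in> P" "transports p k y a \<preceq> D_pow m"
  using transports_mono[of y a "D_pow m" p k] transports_mono[of y "D_pow 0" a p k] assms
  by (simp_all add: transports_D_pow) (simp_all add: transports_D_pow[of y p k 0, simplified] one_prefix)

definition recurrent :: "int \<Rightarrow> 'a \<Rightarrow> bool" where
  "recurrent p y \<longleftrightarrow> (\<exists>N>0. (cyc p ^^ N) y = y)"

text \<open>
  A periodic point of cycling has the largest infimum in its conjugacy class. Otherwise
  some \<open>z = y\<^sup>a\<close> has larger infimum, so \<open>\<iota>(z) = D\<close>, and the same holds along the whole
  orbit of \<open>z\<close>, while no \<open>\<iota>\<close> along the orbit of \<open>y\<close> equals \<open>D\<close>. Each transport of \<open>a\<close> is then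
  strictly longer than the one before, although all of them are prefixes of a fixed power
  of \<open>D\<close>.
\<close>

lemma recurrent_inf_maximal:
  assumes y: "y \<in> carrier G" "D_pow p \<preceq> y" "\<not> D_pow (p + 1) \<preceq> y" and "recurrent p y"
    and a: "a \<in> P"
  shows "\<not> D_pow (p + 1) \<preceq> conj_by y a"
proof
  assume z: "D_pow (p + 1) \<preceq> conj_by y a"
  obtain N where N: "N > 0" "(cyc p ^^ N) y = y" using \<open>recurrent p y\<close> by (auto simp: recurrent_def)
  \<comment> \<open>Where \<open>\<iota> = D\<close>, cycling is conjugation by \<open>D\<close> and keeps the larger infimum.\<close>
  have stay: "D_pow (p + 1) \<preceq> (cyc p ^^ k) w" if "w \<in> carrier G" "D_pow (p + 1) \<preceq> w" for w k
  proof (induction k)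
    case (Suc k)
    let ?v = "(cyc p ^^ k) w"
    have v: "?v \<in> carrier G" "iota p ?v = D" using that Suc by (simp_all add: iota_eq_D_iff)
    have "conj_by (inv (D_pow (p + 1)) \<otimes> ?v) D \<in> P"
      using Suc conj_by_D_pow_P[of _ 1] by (simp add: prefix_def)
    also have "conj_by (inv (D_pow (p + 1)) \<otimes> ?v) D = inv (D_pow (p + 1)) \<otimes> cyc p ?v"
      using v D_pow_commute[of "- (p + 1)" "- 1", unfolded D_pow_minus]
      by (simp add: cyc_def conj_by_def m_assoc[symmetric])
    finally show ?case using v by (simp add: prefix_def)
  qed (use that in simp)
  have never: "iota p ((cyc p ^^ k) y) \<noteq> D" for k
  proof
    assume D: "iota p ((cyc p ^^ k) y) = D"
    obtain j where "(cyc p ^^ j) ((cyc p ^^ k) y) = y"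
      using funpow_orbit_return[OF N(2,1)] by blast
    moreover have "D_pow (p + 1) \<preceq> (cyc p ^^ j) ((cyc p ^^ k) y)"
      using y D by (intro stay[of "(cyc p ^^ k) y"]) (simp_all add: iota_eq_D_iff)
    ultimately show False using y by simp
  qed
  obtain m where m: "a \<preceq> D_pow m" using prefix_D_power a by blast
  have grow: "L a + int k \<le> L (transports p k y a)" for k
  proof (induction k)
    case 0
    then show ?case using a y by simp
  next
    case (Suc k)
    let ?u = "(cyc p ^^ k) y" and ?t = "transports p k y a"
    have "conj_by ?u ?t = (cyc p ^^ k) (conj_by y a)" using y a by (simp add: conj_by_transports)
    then have D: "iota p (conj_by ?u ?t) = D" using stay z y a by (simp add: iota_eq_D_iff)
    have "iota p ?u \<preceq> D" using y by (simp add: iota_prefix_D)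
    then have "0 < L (inv (iota p ?u) \<otimes> D)"
      using never[of k] y by (intro L_pos) (simp_all add: prefix_def inv_mult_eq_one_iff)
    then have "L ?t < L (transport p ?u ?t)"
      using y a by (simp add: transport_def D L_mult L_inv)
    then show ?case using Suc y a by (simp add: transports_Suc)
  qed
  let ?k = "nat (m * L D + 1 - L a)"
  have "L (transports p ?k y a) \<le> m * L D"
    using transports_bounds[OF y(1) a m, of p ?k] prefix_imp_L_le y a by (simp add: L_D_pow[symmetric])
  then show False using grow[of ?k] by linarith
qed

text \<open>
  The transports of \<open>a\<close> along a common period of both orbits stay in a finite set, so two of
  them agree. On the conjugators from \<open>y\<close> to \<open>z\<close>, transport along a common period is \<open>a \<mapsto> u\<^sup>-\<^sup>1 a v\<close>
  with fixed \<open>u\<close> and \<open>v\<close>, hence injective, and \<open>a\<close> itself must recur.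
\<close>

lemma transports_recur:
  assumes "y \<in> carrier G" "a \<in> P" "recurrent p y" "recurrent p (conj_by y a)"
  shows "\<exists>k>0. (cyc p ^^ k) y = y \<and> (cyc p ^^ k) (conj_by y a) = conj_by y a \<and> transports p k y a = a"
proof -
  let ?z = "conj_by y a"
  have z: "?z \<in> carrier G" using assms by simp
  obtain N M where NM: "N > 0" "(cyc p ^^ N) y = y" "M > 0" "(cyc p ^^ M) ?z = ?z"
    using assms by (auto simp: recurrent_def)
  define K where "K = N * M"
  have K: "K > 0" "(cyc p ^^ (K * i)) y = y" "(cyc p ^^ (K * i)) ?z = ?z" for i
    using NM funpow_fixed_mult[OF NM(2), of "M * i"] funpow_fixed_mult[OF NM(4), of "N * i"]
    by (simp_all add: K_def ac_simps)
  obtain m where m: "a \<preceq> D_pow m" using prefix_D_power assms by blast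
  let ?t = "\<lambda>i. transports p (K * i) y a"
  have "range ?t \<subseteq> {b \<in> carrier G. D_pow 0 \<preceq> b \<and> b \<preceq> D_pow m}"
    using transports_bounds[OF assms(1,2) m] by (auto simp: one_prefix)
  then have "finite (range ?t)" using finite_interval finite_subset by blast
  then have "\<not> inj ?t" using finite_imageD infinite_UNIV_nat by blast
  then obtain i j where "?t i = ?t j" "i \<noteq> j" by (auto simp: inj_def)
  then obtain i d where eq: "?t i = ?t (d + i)" and d: "d > 0"
    by (metis linorder_neqE_nat less_imp_add_positive add.commute)
  have "transports p (K * d + K * i) y a = transports p (K * i) y (?t d)"
    using assms by (simp add: transports_add K)
  also have "\<dots> = inv (cyc_prod p (K * i) y) \<otimes> ?t d \<otimes> cyc_prod p (K * i) ?z"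
    using conj_by_transports[of y a "K * d" p] assms K by (simp add: transports_def[of p "K * i"])
  finally have "inv (cyc_prod p (K * i) y) \<otimes> a \<otimes> cyc_prod p (K * i) ?z =
      inv (cyc_prod p (K * i) y) \<otimes> ?t d \<otimes> cyc_prod p (K * i) ?z"
    using eq by (simp add: transports_def[of p "K * i"] distrib_left)
  then have "a = ?t d" using assms z by simp
  then show ?thesis using K d by (intro exI[of _ "K * d"]) simp
qed

lemma transports_fixed_mult:
  assumes "y \<in> carrier G" "a \<in> carrier G" "(cyc p ^^ k) y = y" "transports p k y a = a"
  shows "transports p (k * m) y a = a"
  by (induction m) (use assms in \<open>simp_all add: transports_add\<close>)

text \<open>
  Convexity. A common period of the transports of \<open>a\<close> and \<open>b\<close> also fixes their meet, and so
  gives a period of the cycling orbit of its target.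
\<close>

theorem recurrent_meet:
  assumes y: "y \<in> carrier G" "recurrent p y"
    and a: "a \<in> P" "recurrent p (conj_by y a)"
    and b: "b \<in> P" "recurrent p (conj_by y b)"
  shows "recurrent p (conj_by y (a \<^bold>\<and> b))"
proof -
  obtain k where k: "k > 0" "(cyc p ^^ k) y = y" "transports p k y a = a"
    using transports_recur y a by blast
  obtain l where l: "l > 0" "(cyc p ^^ l) y = y" "transports p l y b = b"
    using transports_recur y b by blast
  have fix_y: "(cyc p ^^ (k * l)) y = y" using funpow_fixed_mult[OF k(2)] .
  have "transports p (k * l) y a = a" using transports_fixed_mult k y a by simp
  moreover have "transports p (k * l) y b = b"
    using transports_fixed_mult[of y b l p k] l y b by (simp add: mult.commute)
  ultimately have "transports p (k * l) y (a \<^bold>\<and> b) = a \<^bold>\<and> b"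
    using y a b by (simp add: transports_meet)
  then have "(cyc p ^^ (k * l)) (conj_by y (a \<^bold>\<and> b)) = conj_by y (a \<^bold>\<and> b)"
    using conj_by_transports[of y "a \<^bold>\<and> b" "k * l" p] fix_y y a b by simp
  then show ?thesis using k l unfolding recurrent_def by (metis nat_0_less_mult_iff)
qed

section \<open>Minimal ultra summit sets\<close>

lemma conj_by_D_square: "y \<in> carrier G \<Longrightarrow> conj_by y (D \<otimes> D) = y"
proof -
  assume y: "y \<in> carrier G"
  have "conj_by y (D \<otimes> D) = inv (D \<otimes> D) \<otimes> (D \<otimes> D \<otimes> y)"
    using y D_square_central[OF y] by (simp add: conj_by_def m_assoc)
  then show ?thesis using y by simp
qed

lemma conj_by_D_even: "y \<in> carrier G \<Longrightarrow> conj_by y (D_pow (2 * int k)) = y"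
proof (induction k)
  case (Suc k)
  have "D_pow (2 * int (Suc k)) = D_pow (2 * int k) \<otimes> (D \<otimes> D)"
    using D_pow_add[of "2 * int k" 2] D_pow_add[of 1 1] by (simp add: algebra_simps)
  then show ?case
    using Suc by (simp add: conj_by_mult[symmetric] del: of_nat_Suc) (simp add: conj_by_mult conj_by_D_square)
qed simp

text \<open>
  An even power of \<open>D\<close> is central and can be absorbed in the conjugator.
\<close>

lemma conjugate_by_positive:
  assumes "y \<in> carrier G" "g \<in> carrier G"
  shows "\<exists>a\<in>P. conj_by y a = conj_by y g"
proof -
  obtain k :: nat where k: "D [^] k \<otimes> g \<in> P" using D_absorbs assms by blast
  have "D_pow (int k) \<otimes> (D [^] k \<otimes> g) \<in> P" by (rule mult_P[OF D_pow_P k]) simp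
  also have "D_pow (int k) \<otimes> (D [^] k \<otimes> g) = D_pow (2 * int k) \<otimes> g"
    using assms D_pow_add[of "int k" "int k"] by (simp add: int_pow_int m_assoc[symmetric])
  finally have "D_pow (2 * int k) \<otimes> g \<in> P" .
  moreover have "conj_by y (D_pow (2 * int k) \<otimes> g) = conj_by y g"
    using assms conj_by_D_even[of y k] conj_by_mult[of y "D_pow (2 * int k)" g] by simp
  ultimately show ?thesis by blast
qed

lemma conj_by_meet_inf:
  assumes "y \<in> carrier G" "a \<in> carrier G" "b \<in> carrier G"
    and "D_pow p \<preceq> conj_by y a" "D_pow p \<preceq> conj_by y b"
  shows "D_pow p \<preceq> conj_by y (a \<^bold>\<and> b)"
proof -
  have "a \<preceq> y \<otimes> a \<otimes> D_pow (- p)" "b \<preceq> y \<otimes> b \<otimes> D_pow (- p)"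
    using assms by (simp_all add: conj_by_prefix_iff)
  then have "a \<^bold>\<and> b \<preceq> (y \<otimes> a \<otimes> D_pow (- p)) \<^bold>\<and> (y \<otimes> b \<otimes> D_pow (- p))"
    using assms prefix_trans[OF meet_prefix(1)] prefix_trans[OF meet_prefix(2)]
    by (simp add: prefix_meet_iff)
  then show ?thesis using assms by (simp add: conj_by_prefix_iff mult_meet meet_mult_D_pow)
qed

lemma conj_by_meet_sup:
  assumes "y \<in> carrier G" "a \<in> carrier G" "b \<in> carrier G"
    and "conj_by y a \<preceq> D_pow q" "conj_by y b \<preceq> D_pow q"
  shows "conj_by y (a \<^bold>\<and> b) \<preceq> D_pow q"
proof -
  have "y \<otimes> a \<preceq> a \<otimes> D_pow q" "y \<otimes> b \<preceq> b \<otimes> D_pow q"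
    using assms by (simp_all add: conj_by_prefix_iff)
  then have "(y \<otimes> a) \<^bold>\<and> (y \<otimes> b) \<preceq> (a \<otimes> D_pow q) \<^bold>\<and> (b \<otimes> D_pow q)"
    using assms prefix_trans[OF meet_prefix(1)] prefix_trans[OF meet_prefix(2)]
    by (simp add: prefix_meet_iff)
  then show ?thesis using assms by (simp add: conj_by_prefix_iff mult_meet meet_mult_D_pow)
qed

lemma prefix_conj_by_D_pow:
  assumes "a \<in> carrier G" "b \<in> carrier G"
  shows "conj_by a (D_pow m) \<preceq> conj_by b (D_pow m) \<longleftrightarrow> a \<preceq> b"
  using assms prefix_mult_D_pow[of a b m]
    prefix_mult_left[of "inv (D_pow m)" "a \<otimes> D_pow m" "b \<otimes> D_pow m"]
  by (simp add: conj_by_def m_assoc)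

lemma conj_by_D_pow_D_pow: "conj_by (D_pow p) (D_pow m) = D_pow p"
  using D_pow_commute[of p m] by (simp add: conj_by_def m_assoc)

lemma recurrent_conj_D: "y \<in> carrier G \<Longrightarrow> recurrent p y \<Longrightarrow> recurrent p (conj_by y (D_pow m))"
  unfolding recurrent_def by (auto simp: cyc_pow_conj_D)

lemma D_pow_prefix_inv_iff: "y \<in> carrier G \<Longrightarrow> D_pow (- q) \<preceq> inv y \<longleftrightarrow> y \<preceq> D_pow q"
  by (subst D_pow_prefix_iff_right) (simp_all add: prefix_def)

text \<open>
  Let \<open>s\<close> meet \<open>\<iota>(y\<^sup>-\<^sup>1) = y\<^sup>-\<^sup>1 D\<^sup>q \<^bold>\<and> D\<close> trivially. As \<open>s\<close> is simple, \<open>s \<^bold>\<and> y\<^sup>-\<^sup>1 D\<^sup>q = 1\<close>, that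
  is \<open>y s \<^bold>\<and> D\<^sup>q = y\<close>. Since \<open>p < q\<close>, taking the meet of \<open>y s D\<^sup>-\<^sup>p\<close> with \<open>D\<close> factors through the meet with
  \<open>D\<^sup>q\<^sup>-\<^sup>p\<close>, and therefore gives \<open>\<iota>(y)\<close>. The bound \<open>D\<^sup>p \<preceq> y\<^sup>s\<close> says that \<open>s\<close> is a prefix of
  \<open>y s D\<^sup>-\<^sup>p\<close>; so \<open>s \<preceq> \<iota>(y)\<close>, and if \<open>s\<close> meets \<open>\<iota>(y)\<close> trivially as well, it is \<open>1\<close>.
\<close>

lemma black_or_grey:
  assumes y: "y \<in> carrier G" and s: "s \<in> P" "s \<preceq> D" and "p < q"
    and inf: "D_pow p \<preceq> conj_by y s"
    and black: "s \<^bold>\<and> iota p y = \<one>" and grey: "s \<^bold>\<and> iota (- q) (inv y) = \<one>"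
  shows "s = \<one>"
proof -
  have "s \<^bold>\<and> iota (- q) (inv y) = (s \<^bold>\<and> D) \<^bold>\<and> (inv y \<otimes> D_pow q)"
    using y s by (simp add: iota_def meet_assoc meet_commute meet_left_commute)
  then have "s \<^bold>\<and> (inv y \<otimes> D_pow q) = \<one>"
    using grey s meet_absorb[of s D] by simp
  then have "(y \<otimes> s) \<^bold>\<and> (y \<otimes> (inv y \<otimes> D_pow q)) = y"
    using y s by (subst mult_meet[symmetric]) auto
  then have "(y \<otimes> s) \<^bold>\<and> D_pow q = y" using y by simp
  then have "((y \<otimes> s) \<^bold>\<and> D_pow q) \<otimes> D_pow (- p) = y \<otimes> D_pow (- p)" by simp
  then have eq: "(y \<otimes> s \<otimes> D_pow (- p)) \<^bold>\<and> D_pow (q - p) = y \<otimes> D_pow (- p)"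
    using y s D_pow_add[of q "- p"] by (simp add: meet_mult_D_pow)
  have "D \<preceq> D_pow (q - p)" using D_pow_mono[of 1 "q - p"] \<open>p < q\<close> by simp
  then have "D_pow (q - p) \<^bold>\<and> D = D"
    using meet_absorb[of D "D_pow (q - p)"] meet_commute[of D] by simp
  then have "(y \<otimes> s \<otimes> D_pow (- p)) \<^bold>\<and> D = (y \<otimes> s \<otimes> D_pow (- p)) \<^bold>\<and> D_pow (q - p) \<^bold>\<and> D"
    using y s by (simp add: meet_assoc)
  also have "\<dots> = iota p y" by (simp only: eq iota_def)
  finally have "(y \<otimes> s \<otimes> D_pow (- p)) \<^bold>\<and> D = iota p y" .
  moreover have "s \<preceq> y \<otimes> s \<otimes> D_pow (- p)" using inf y s by (simp add: conj_by_prefix_iff)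
  ultimately have "s \<preceq> iota p y" using prefix_meet_iff[of "y \<otimes> s \<otimes> D_pow (- p)" D s] y s by simp
  then show ?thesis using black meet_absorb y s by simp
qed

text \<open>
  The hypotheses \<open>black\<close> and \<open>grey\<close> say that no proper nontrivial part of \<open>\<iota>(y)\<close> or of \<open>\<iota>(y\<^sup>-\<^sup>1)\<close> leads back
  to \<open>U\<close>. Here \<open>iota (- q) (inv y)\<close> is \<open>\<iota>(y\<^sup>-\<^sup>1)\<close>, because the infimum of \<open>y\<^sup>-\<^sup>1\<close> is minus the
  supremum of \<open>y\<close>.
\<close>

theorem two_orbits:
  fixes x :: 'a and p q :: int and U :: "'a set"
  defines "U \<equiv> {y \<in> conj_by x ` carrier G. D_pow p \<preceq> y \<and> y \<preceq> D_pow q \<and> recurrent p y}"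
  assumes x: "x \<in> carrier G" and pq: "p < q"
    and sup: "\<And>y. y \<in> U \<Longrightarrow> \<not> y \<preceq> D_pow (q - 1)"
    and black: "\<And>y t. y \<in> U \<Longrightarrow> t \<in> P \<Longrightarrow> t \<noteq> \<one> \<Longrightarrow> t \<preceq> iota p y \<Longrightarrow> conj_by y t \<in> U \<Longrightarrow>
        t = iota p y"
    and grey_U: "\<And>y. y \<in> U \<Longrightarrow> conj_by y (iota (- q) (inv y)) \<in> U"
    and grey: "\<And>y t. y \<in> U \<Longrightarrow> t \<in> P \<Longrightarrow> t \<noteq> \<one> \<Longrightarrow> t \<preceq> iota (- q) (inv y) \<Longrightarrow> conj_by y t \<in> U \<Longrightarrow>
        t = iota (- q) (inv y)"
    and y0: "y0 \<in> U"
  shows "U = orbit (cyc p) y0 \<union> (\<lambda>y. conj_by y D) ` orbit (cyc p) y0"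
proof -
  let ?\<tau> = "\<lambda>y. conj_by y D"
  have U_carrier: "y \<in> carrier G" if "y \<in> U" for y using that x by (auto simp: U_def)
  have U_I: "conj_by y a \<in> U"
    if "y \<in> U" "a \<in> carrier G" "D_pow p \<preceq> conj_by y a" "conj_by y a \<preceq> D_pow q" "recurrent p (conj_by y a)"
    for y a
    using that x by (auto simp: U_def conj_by_mult)
  have U_meet: "conj_by y (a \<^bold>\<and> b) \<in> U"
    if "y \<in> U" "a \<in> P" "b \<in> P" "conj_by y a \<in> U" "conj_by y b \<in> U" for y a b
    using that U_carrier[OF that(1)] recurrent_meet[of y p a b]
    by (intro U_I conj_by_meet_inf conj_by_meet_sup) (auto simp: U_def)
  have U_D_pow: "conj_by y (D_pow m) \<in> U" if "y \<in> U" for y m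
    using that U_carrier[OF that] recurrent_conj_D[of y p m]
      prefix_conj_by_D_pow[of "D_pow p" y m] prefix_conj_by_D_pow[of y "D_pow q" m]
    by (intro U_I) (auto simp: U_def conj_by_D_pow_D_pow)
  have U_D: "conj_by y D \<in> U" if "y \<in> U" for y using U_D_pow[OF that, of 1] by simp
  have U_cyc: "cyc p y \<in> U" if "y \<in> U" for y
  proof -
    have y: "y \<in> carrier G" "D_pow p \<preceq> y" "y \<preceq> D_pow q" using U_carrier[OF that] that by (auto simp: U_def)
    have "recurrent p y" using that by (simp add: U_def)
    then have "recurrent p (cyc p y)" unfolding recurrent_def by (metis funpow_swap1)
    then show ?thesis using that y cyc_inf[OF y(1,2)] cyc_sup[OF y(1,3) pq]
      unfolding cyc_def by (intro U_I) auto
  qed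
  have orbit_U: "z \<in> U" if "z \<in> orbit (cyc p) y" "y \<in> U" for y z
  proof -
    have "(cyc p ^^ k) y \<in> U" for k using that(2) by (induction k) (auto intro: U_cyc)
    then show ?thesis using that by (auto simp: orbit_def)
  qed
  have orbit_tau: "orbit (cyc p) (?\<tau> y) = ?\<tau> ` orbit (cyc p) y" if "y \<in> U" for y
    using cyc_pow_conj_D[of y _ p 1] U_carrier[OF that] by (auto simp: orbit_def)
  have tau_tau: "?\<tau> (?\<tau> y) = y" if "y \<in> U" for y
    using U_carrier[OF that] by (simp add: conj_by_mult conj_by_D_square)
  have step: "\<exists>t\<in>P. t \<noteq> \<one> \<and> t \<preceq> a \<and> conj_by y t \<in> U \<and> (t = iota p y \<or> t = iota (- q) (inv y))"
    if y: "y \<in> U" and a: "a \<in> P" "a \<noteq> \<one>" "conj_by y a \<in> U" for y a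
  proof -
    let ?s = "a \<^bold>\<and> D" and ?k = "iota (- q) (inv y)"
    have yc: "y \<in> carrier G" using y by (rule U_carrier)
    have s: "?s \<in> P" "?s \<preceq> D" "?s \<noteq> \<one>" "?s \<preceq> a"
      using a D_P positive_meet_D meet_P meet_prefix by auto
    have sU: "conj_by y ?s \<in> U" using U_meet U_D y a D_P by blast
    have iP: "iota p y \<in> P" using y yc by (intro iota_P) (auto simp: U_def)
    have kP: "?k \<in> P" using y yc by (intro iota_P) (auto simp: U_def D_pow_prefix_inv_iff)
    have iU: "conj_by y (iota p y) \<in> U" using U_cyc[OF y] by (simp add: cyc_def)
    \<comment> \<open>By convexity the part common to \<open>a\<close> and \<open>e\<close> stays in \<open>U\<close>, so it is all of \<open>e\<close>.\<close>
    have whole: "e \<noteq> \<one> \<and> e \<preceq> a"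
      if "e \<in> P" "conj_by y e \<in> U" "?s \<^bold>\<and> e \<noteq> \<one>"
        and "\<And>t. t \<in> P \<Longrightarrow> t \<noteq> \<one> \<Longrightarrow> t \<preceq> e \<Longrightarrow> conj_by y t \<in> U \<Longrightarrow> t = e" for e
    proof -
      have "conj_by y (?s \<^bold>\<and> e) \<in> U" using U_meet[OF y s(1) that(1) sU that(2)] .
      then have "?s \<^bold>\<and> e = e" using that s(1) by (intro that(4)) (auto intro: meet_P meet_prefix)
      then have "e \<preceq> ?s" using meet_prefix(1)[of ?s e] s(1) that(1) by simp
      then show ?thesis
        using prefix_trans[OF _ s(4)] s(1) that(1,3) a(1) \<open>?s \<^bold>\<and> e = e\<close> by simp
    qed
    consider "?s \<^bold>\<and> iota p y \<noteq> \<one>" | "?s \<^bold>\<and> ?k \<noteq> \<one>"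
      using black_or_grey[OF yc s(1,2) pq] sU s(3) by (auto simp: U_def)
    then show ?thesis
    proof cases
      case 1
      then show ?thesis using whole[OF iP iU 1 black[OF y]] iP iU by blast
    next
      case 2
      then show ?thesis using whole[OF kP grey_U[OF y] 2 grey[OF y]] kP grey_U[OF y] by blast
    qed
  qed
  \<comment> \<open>The element \<open>f\<close> completes \<open>\<iota>(y\<^sup>-\<^sup>1)\<close> to \<open>D\<close>; it undoes the grey move up to conjugation
    by \<open>D\<close>, and turns out to be the initial factor of its source \<open>v\<close>.\<close>
  have grey_step: "\<exists>v \<in> orbit (cyc p) y. conj_by y (iota (- q) (inv y)) = ?\<tau> v" if y: "y \<in> U" for y
  proof -
    let ?k = "iota (- q) (inv y)"
    define v where "v = conj_by y (?k \<otimes> inv D)"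
    define f where "f = D \<otimes> inv ?k"
    have yc: "y \<in> carrier G" using y by (rule U_carrier)
    then have kc: "?k \<in> carrier G" "?k \<preceq> D" by (simp_all add: iota_prefix_D)
    have vc: "v \<in> carrier G" using yc by (simp add: v_def)
    have fc: "f \<in> carrier G" using kc by (simp add: f_def)
    have "conj_by (conj_by y ?k) (D_pow (- 1)) \<in> U" using U_D_pow grey_U y by blast
    then have vU: "v \<in> U" using yc D_pow_minus[of 1] by (simp add: v_def conj_by_mult)
    have "conj_by (inv ?k \<otimes> D) (D_pow (- 1)) \<in> P"
      using kc(2) by (intro conj_by_D_pow_P) (simp add: prefix_def)
    then have fP: "f \<in> P" using kc D_pow_minus[of 1] by (simp add: f_def conj_by_def m_assoc)
    have vf: "conj_by v f = y" using yc kc by (simp add: v_def f_def conj_by_mult m_assoc)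
    have "f \<noteq> \<one>"
    proof
      assume "f = \<one>"
      then have "f \<otimes> ?k = ?k" using kc by simp
      then have "?k = D" using kc by (simp add: f_def m_assoc)
      then have "D_pow (- (q - 1)) \<preceq> inv y" using yc iota_eq_D_iff[of "inv y" "- q"] by simp
      then show False using sup[OF y] yc D_pow_prefix_inv_iff[of y "q - 1"] by simp
    qed
    have "f \<preceq> iota p v"
    proof -
      have "D_pow (p + 1) \<preceq> y \<otimes> D"
        using y yc prefix_mult_D_pow[of "D_pow p" y 1] by (simp add: U_def D_pow_add)
      moreover have "D_pow (p + 1) \<preceq> D_pow q" using pq by (intro D_pow_mono) simp
      moreover have "y \<otimes> ?k = D_pow q \<^bold>\<and> (y \<otimes> D)"
        using yc by (simp add: iota_def mult_meet)
      ultimately have "D_pow (p + 1) \<preceq> y \<otimes> ?k" using yc by (simp add: prefix_meet_iff)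
      then have "y \<otimes> ?k \<otimes> D_pow (- (p + 1)) \<in> P" using yc by (subst D_pow_prefix_iff_right[symmetric]) auto
      also have "D_pow (- (p + 1)) = inv D \<otimes> D_pow (- p)"
      proof -
        have "- (p + 1) = - 1 + - p" by simp
        then show ?thesis using D_pow_add[of "- 1" "- p"] D_pow_minus[of 1] by (simp only: D_pow_1)
      qed
      also have "y \<otimes> ?k \<otimes> (inv D \<otimes> D_pow (- p)) = inv f \<otimes> (v \<otimes> D_pow (- p))"
        using yc kc by (simp add: f_def v_def conj_by_def group_word)
      finally have "f \<preceq> v \<otimes> D_pow (- p)" by (simp add: prefix_def)
      moreover have "f \<preceq> D" using fc kc iota_P[of "inv y" "- q"] y yc
        by (simp add: prefix_def f_def group_word U_def D_pow_prefix_inv_iff[unfolded prefix_def])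
      ultimately show ?thesis using vc fc by (simp add: iota_def prefix_meet_iff)
    qed
    then have "f = iota p v" using black[OF vU fP \<open>f \<noteq> \<one>\<close>] vf y by simp
    then have "cyc p v = y" using vf by (simp add: cyc_def)
    then have "y \<in> orbit (cyc p) v" using orbit_step[OF orbit_self, of "cyc p" v] by simp
    moreover obtain N where "(cyc p ^^ N) v = v" "N > 0" using vU by (auto simp: U_def recurrent_def)
    ultimately have "v \<in> orbit (cyc p) y" using orbit_eq orbit_self by metis
    moreover have "conj_by y ?k = ?\<tau> v" using yc kc by (simp add: v_def conj_by_mult m_assoc)
    ultimately show ?thesis by blast
  qed
  let ?O = "orbit (cyc p) y0"
  have closed: "conj_by y a \<in> ?O \<union> ?\<tau> ` ?O"
    if "a \<in> P" "y \<in> ?O \<union> ?\<tau> ` ?O" "conj_by y a \<in> U" for y a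
    using that
  proof (induction "nat (L a)" arbitrary: a y rule: less_induct)
    case less
    have y: "y \<in> U" using less.prems(2) orbit_U[OF _ y0] U_D by auto
    have yc: "y \<in> carrier G" using y by (rule U_carrier)
    show ?case
    proof (cases "a = \<one>")
      case True
      then show ?thesis using less.prems yc by simp
    next
      case False
      obtain t where t: "t \<in> P" "t \<noteq> \<one>" "t \<preceq> a" "t = iota p y \<or> t = iota (- q) (inv y)"
        using step[OF y less.prems(1) False less.prems(3)] by blast
      have tR: "conj_by y t \<in> ?O \<union> ?\<tau> ` ?O"
        using t(4)
      proof
        assume "t = iota p y"
        then have "conj_by y t = cyc p y" by (simp add: cyc_def)
        then show ?thesis
          using less.prems(2) orbit_step[of y "cyc p" y0] orbit_step[of y "cyc p" "?\<tau> y0"]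
          unfolding orbit_tau[OF y0] by (metis Un_iff)
      next
        assume "t = iota (- q) (inv y)"
        then obtain v where v: "v \<in> orbit (cyc p) y" "conj_by y t = ?\<tau> v"
          using grey_step[OF y] by blast
        show ?thesis
        proof (cases "y \<in> ?O")
          case True
          then have "v \<in> ?O" using v(1) subsetD[OF orbit_trans] by metis
          then show ?thesis using v(2) by simp
        next
          case False
          then have "y \<in> orbit (cyc p) (?\<tau> y0)" using less.prems(2) orbit_tau[OF y0] by auto
          then have "v \<in> orbit (cyc p) (?\<tau> y0)" using v(1) subsetD[OF orbit_trans] by metis
          then obtain w where "w \<in> ?O" "v = ?\<tau> w" using orbit_tau[OF y0] by auto
          then show ?thesis using v(2) tau_tau orbit_U[OF _ y0] by simp
        qed
      qed
      let ?b = "inv t \<otimes> a"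
      have b: "?b \<in> P" using t(3) by (simp add: prefix_def)
      have "L ?b < L a" "0 \<le> L ?b"
        using L_pos[OF t(1,2)] L_nonneg[OF b] t(1) less.prems(1) by (simp_all add: L_mult L_inv)
      then have lt: "nat (L ?b) < nat (L a)" by simp
      have "conj_by (conj_by y t) ?b = conj_by y a"
        using yc t(1) less.prems(1) by (simp add: conj_by_mult)
      then show ?thesis using less.hyps[OF lt b tR] less.prems(3) by simp
    qed
  qed
  show ?thesis
  proof
    show "?O \<union> ?\<tau> ` ?O \<subseteq> U" using orbit_U[OF _ y0] U_D by auto
    show "U \<subseteq> ?O \<union> ?\<tau> ` ?O"
    proof
      fix z assume z: "z \<in> U"
      obtain g h where gh: "g \<in> carrier G" "y0 = conj_by x g" "h \<in> carrier G" "z = conj_by x h"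
        using y0 z by (auto simp: U_def)
      then have "z = conj_by y0 (inv g \<otimes> h)" using x by (simp add: conj_by_mult)
      then obtain a where "a \<in> P" "z = conj_by y0 a"
        using conjugate_by_positive[of y0 "inv g \<otimes> h"] gh x by auto
      then show "z \<in> ?O \<union> ?\<tau> ` ?O" using closed[of a y0] z orbit_self[of y0 "cyc p"] by simp
    qed
  qed
qed

end

section \<open>The Garside structure of the braid group\<close>

lemma positive_braid_closed [simp]:
  "set w \<subseteq> {1..<n} \<Longrightarrow> positive_braid n w \<in> carrier (braid_group n)"
  by (simp add: positive_braid_def carrier_braid_group)

lemma positive_braid_append:
  assumes "set u \<subseteq> {1..<n}" "set v \<subseteq> {1..<n}"
  shows "positive_braid n (u @ v) = positive_braid n u \<otimes>\<^bsub>braid_group n\<^esub> positive_braid n v"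
  using assms by (simp add: positive_braid_def mult_braid_of)

lemma braid_prod_sigma:
  "set w \<subseteq> {1..<n} \<Longrightarrow> braid_prod n (map (sigma n) w) = positive_braid n w"
proof (induction w)
  case Nil
  then show ?case by (simp add: braid_prod_def positive_braid_def one_braid_group)
next
  case (Cons i w)
  then have "braid_prod n (map (sigma n) (i # w)) = positive_braid n [i] \<otimes>\<^bsub>braid_group n\<^esub> positive_braid n w"
    by (simp add: braid_prod_def) (simp add: sigma_def positive_braid_def)
  then show ?case using Cons.prems positive_braid_append[of "[i]" n w] by simp
qed

lemma positive_braids_eq: "positive_braids n = positive_braid n ` {w. set w \<subseteq> {1..<n}}"
proof -
  have "{as. set as \<subseteq> sigma n ` {1..<n}} = map (sigma n) ` {w. set w \<subseteq> {1..<n}}"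
    using lists_image[of "sigma n" "{1..<n}"] by (simp add: lists_eq_set)
  moreover have "positive_braids n = braid_prod n ` {as. set as \<subseteq> sigma n ` {1..<n}}"
    unfolding positive_braids_def by blast
  ultimately have "positive_braids n = braid_prod n ` map (sigma n) ` {w. set w \<subseteq> {1..<n}}"
    by simp
  then show ?thesis by (simp add: image_image braid_prod_sigma cong: image_cong_simp)
qed

lemma set_half_twist_word: "set (half_twist_word n) = {1..<n}"
  using supp_half_twist[of n] by (simp add: half_twist_def supp.abs_eq)

lemma Delta_eq: "Delta n = positive_braid n (half_twist_word n)"
  using braid_prod_sigma[of "half_twist_word n" n] set_half_twist_word[of n]
  by (simp add: Delta_def half_twist_word_def map_concat comp_def)

definition exponent_sum :: "braid_word \<Rightarrow> int" where
  "exponent_sum w = (\<Sum>(b, i)\<leftarrow>w. if b then 1 else - 1)"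

lemma artin_equiv_exponent_sum: "artin_equiv n u v \<Longrightarrow> exponent_sum u = exponent_sum v"
  by (induction rule: artin_equiv.induct) (simp_all add: exponent_sum_def)

text \<open>
  The exponent sum of any representing word; all of them have the same one.
\<close>

definition braid_exponent :: "braid \<Rightarrow> int" where
  "braid_exponent a = exponent_sum (SOME w. w \<in> a)"

lemma braid_exponent_braid_of:
  assumes "w \<in> braid_words n" shows "braid_exponent (braid_of n w) = exponent_sum w"
proof -
  have "(SOME v. v \<in> braid_of n w) \<in> braid_of n w"
    by (rule someI[of _ w]) (simp add: braid_of_def artin_equiv.refl assms)
  then show ?thesis
    using artin_equiv_exponent_sum[of n w] by (simp add: braid_of_def braid_exponent_def)
qed

lemma braid_exponent_positive:
  assumes "set w \<subseteq> {1..<n}" shows "braid_exponent (positive_braid n w) = int (length w)"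
proof -
  have "exponent_sum (map (Pair True) w) = int (length w)"
    by (induction w) (simp_all add: exponent_sum_def)
  then show ?thesis using assms by (simp add: positive_braid_def braid_exponent_braid_of)
qed

lemma left_dvd_supp: "left_dvd a b \<Longrightarrow> supp a \<subseteq> supp b"
  by (auto simp: left_dvd_def)

text \<open>
  Among positive braids, the prefix order of the group is left divisibility in the monoid.
  A quotient of words on \<open>n\<close> strands again has all its letters below \<open>n\<close>, since
  braid moves preserve the set of letters.
\<close>

lemma inv_mult_positive_iff:
  assumes u: "set u \<subseteq> {1..<n}" and v: "set v \<subseteq> {1..<n}"
  shows "inv\<^bsub>braid_group n\<^esub> positive_braid n u \<otimes>\<^bsub>braid_group n\<^esub> positive_braid n v
    \<in> positive_braids n \<longleftrightarrow> left_dvd (abs_pbraid u) (abs_pbraid v)"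
proof -
  interpret group "braid_group n" by (rule group_braid_group)
  have "inv\<^bsub>braid_group n\<^esub> positive_braid n u \<otimes>\<^bsub>braid_group n\<^esub> positive_braid n v = positive_braid n w
      \<longleftrightarrow> abs_pbraid v = abs_pbraid u * abs_pbraid w" if w: "set w \<subseteq> {1..<n}" for w
  proof -
    have "inv\<^bsub>braid_group n\<^esub> positive_braid n u \<otimes>\<^bsub>braid_group n\<^esub> positive_braid n v = positive_braid n w
        \<longleftrightarrow> positive_braid n v = positive_braid n (u @ w)"
      using u v w inv_solve_left[of "positive_braid n w" "positive_braid n u" "positive_braid n v"]
      by (auto simp: positive_braid_append)
    then show ?thesis using positive_braid_eq_iff[of v n "u @ w"] u v w by (simp add: abs_pbraid_simps)
  qed
  then have "inv\<^bsub>braid_group n\<^esub> positive_braid n u \<otimes>\<^bsub>braid_group n\<^esub> positive_braid n v \<in> positive_braids n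
      \<longleftrightarrow> (\<exists>w. set w \<subseteq> {1..<n} \<and> abs_pbraid v = abs_pbraid u * abs_pbraid w)"
    by (auto simp: positive_braids_eq image_iff)
  also have "\<dots> \<longleftrightarrow> left_dvd (abs_pbraid u) (abs_pbraid v)"
  proof
    assume "left_dvd (abs_pbraid u) (abs_pbraid v)"
    then obtain c where c: "abs_pbraid v = abs_pbraid u * c" by (auto simp: left_dvd_def)
    obtain w where w: "c = abs_pbraid w" by (rule pbraid_word)
    have "set w \<subseteq> {1..<n}" using arg_cong[OF c, of supp] v w by (auto simp: supp.abs_eq)
    then show "\<exists>w. set w \<subseteq> {1..<n} \<and> abs_pbraid v = abs_pbraid u * abs_pbraid w" using c w by blast
  qed (auto simp: left_dvd_def)
  finally show ?thesis .
qed

lemma half_twist_flip: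
  "set w \<subseteq> {1..<n} \<Longrightarrow> abs_pbraid w * half_twist n = half_twist n * abs_pbraid (map (\<lambda>i. n - i) w)"
proof (induction w)
  case (Cons i w)
  then show ?case using gen_half_twist[of i n]
    by (simp add: abs_pbraid_simps mult.assoc) (simp flip: mult.assoc)
qed (simp add: abs_pbraid_simps)

text \<open>
  Greatest common divisors come from the positive monoid, stability under conjugation from
  \<open>\<sigma>\<^sub>i \<Delta> = \<Delta> \<sigma>\<^bsub>n-i\<^esub>\<close>, and absorption from \<open>\<sigma>\<^sub>i\<^sup>-\<^sup>1 \<Delta>\<^sup>2\<close> being positive. The bound on \<open>n\<close>
  makes the half twist nontrivial.
\<close>

theorem garside_group_braid_group:
  assumes "2 \<le> n"
  shows "garside_group (braid_group n) (positive_braids n) (Delta n) braid_exponent"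
proof -
  interpret group "braid_group n" by (rule group_braid_group)
  let ?G = "braid_group n" and ?P = "positive_braids n" and ?W = "{w. set w \<subseteq> {1..<n}}"
  let ?H = "half_twist_word n" and ?pos = "positive_braid n"
  let ?Z = "Delta n \<otimes>\<^bsub>?G\<^esub> Delta n"
  note D = Delta_eq[of n]
  have H: "set ?H \<subseteq> {1..<n}" by (simp add: set_half_twist_word)
  have absH: "abs_pbraid ?H = half_twist n" by (simp add: half_twist_def)
  have D_closed: "Delta n \<in> carrier ?G" using H by (simp add: D)
  have Z: "?Z = ?pos (?H @ ?H)" using H by (simp add: D positive_braid_append)
  have P_mult: "a \<otimes>\<^bsub>?G\<^esub> b \<in> ?P" if ab: "a \<in> ?P" "b \<in> ?P" for a b
  proof -
    obtain u v where "a = ?pos u" "b = ?pos v" "set u \<subseteq> {1..<n}" "set v \<subseteq> {1..<n}"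
      using ab by (auto simp: positive_braids_eq)
    then show ?thesis by (auto simp: positive_braids_eq positive_braid_append[symmetric])
  qed
  have word_closed: "braid_of n w \<in> carrier ?G" if "w \<in> braid_words n" for w
    using that by (simp add: carrier_braid_group)
  have sigma_closed: "?pos [i] \<in> carrier ?G" if "1 \<le> i" "i < n" for i
    using that by simp
  have cons: "braid_of n ((b, i) # w) = (if b then ?pos [i] else inv\<^bsub>?G\<^esub> ?pos [i]) \<otimes>\<^bsub>?G\<^esub> braid_of n w"
    if i: "1 \<le> i" "i < n" and w: "w \<in> braid_words n" for b i w
  proof -
    have "[(b, i)] \<in> braid_words n" for b using i by (simp add: braid_words_def)
    moreover have "braid_of n [(False, i), (True, i)] = \<one>\<^bsub>?G\<^esub>"
      using artin_equiv.cancel[OF i, of False] by (simp add: one_braid_group braid_of_eqI)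
    ultimately have "braid_of n [(False, i)] = inv\<^bsub>?G\<^esub> ?pos [i]"
      using mult_braid_of[of "[(False, i)]" n "[(True, i)]"]
      by (intro inv_equality[symmetric]) (simp_all add: positive_braid_def carrier_braid_group)
    then show ?thesis
      using mult_braid_of[of "[(b, i)]" n w] i w
      by (cases b) (simp_all add: braid_words_def positive_braid_def)
  qed
  have Z_sigma: "?Z \<otimes>\<^bsub>?G\<^esub> ?pos [i] = ?pos [i] \<otimes>\<^bsub>?G\<^esub> ?Z" if i: "1 \<le> i" "i < n" for i
  proof -
    have "?pos ((?H @ ?H) @ [i]) = ?pos ([i] @ ?H @ ?H)"
      using i H gen_full_twist[OF i]
      by (subst positive_braid_eq_iff) (auto simp: abs_pbraid_simps absH full_twist_def mult.assoc)
    then show ?thesis using i H unfolding Z by (subst (asm) (1 2) positive_braid_append) auto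
  qed
  have central: "?Z \<otimes>\<^bsub>?G\<^esub> braid_of n w = braid_of n w \<otimes>\<^bsub>?G\<^esub> ?Z" if "w \<in> braid_words n" for w
    using that
  proof (induction w)
    case Nil
    then show ?case using D_closed by (simp flip: one_braid_group)
  next
    case (Cons l w)
    obtain b i where l: "l = (b, i)" by (cases l)
    have i: "1 \<le> i" "i < n" and w: "w \<in> braid_words n"
      using Cons.prems by (auto simp: l braid_words_def)
    let ?s = "if b then ?pos [i] else inv\<^bsub>?G\<^esub> ?pos [i]"
    have s: "?s \<in> carrier ?G" and wc: "braid_of n w \<in> carrier ?G" and Zc: "?Z \<in> carrier ?G"
      using sigma_closed[OF i] word_closed[OF w] D_closed by simp_all
    have Zs: "?Z \<otimes>\<^bsub>?G\<^esub> ?s = ?s \<otimes>\<^bsub>?G\<^esub> ?Z"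
    proof (cases b)
      case False
      have "inv\<^bsub>?G\<^esub> ?pos [i] \<otimes>\<^bsub>?G\<^esub> ?Z =
          inv\<^bsub>?G\<^esub> ?pos [i] \<otimes>\<^bsub>?G\<^esub> (?Z \<otimes>\<^bsub>?G\<^esub> ?pos [i]) \<otimes>\<^bsub>?G\<^esub> inv\<^bsub>?G\<^esub> ?pos [i]"
        using sigma_closed[OF i] Zc by (simp add: m_assoc)
      also have "\<dots> = ?Z \<otimes>\<^bsub>?G\<^esub> inv\<^bsub>?G\<^esub> ?pos [i]"
        unfolding Z_sigma[OF i] using sigma_closed[OF i] Zc by (simp add: m_assoc[symmetric])
      finally show ?thesis using False by simp
    qed (simp add: Z_sigma[OF i])
    have "?Z \<otimes>\<^bsub>?G\<^esub> (?s \<otimes>\<^bsub>?G\<^esub> braid_of n w) = ?s \<otimes>\<^bsub>?G\<^esub> (?Z \<otimes>\<^bsub>?G\<^esub> braid_of n w)"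
      using s wc Zc Zs by (simp only: m_assoc[symmetric])
    also have "\<dots> = ?s \<otimes>\<^bsub>?G\<^esub> braid_of n w \<otimes>\<^bsub>?G\<^esub> ?Z"
      using s wc Zc Cons.IH[OF w] by (simp only: m_assoc)
    finally show ?case unfolding l cons[OF i w] .
  qed
  have absorb: "\<exists>k::nat. ?Z [^]\<^bsub>?G\<^esub> k \<otimes>\<^bsub>?G\<^esub> braid_of n w \<in> ?P" if "w \<in> braid_words n" for w
    using that
  proof (induction w)
    case Nil
    have "?pos [] \<in> ?P" by (auto simp: positive_braids_eq)
    then have "?Z [^]\<^bsub>?G\<^esub> (0::nat) \<otimes>\<^bsub>?G\<^esub> braid_of n [] \<in> ?P"
      by (simp add: positive_braid_def flip: one_braid_group)
    then show ?case by blast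
  next
    case (Cons l w)
    obtain b i where l: "l = (b, i)" by (cases l)
    have i: "1 \<le> i" "i < n" and w: "w \<in> braid_words n"
      using Cons.prems by (auto simp: l braid_words_def)
    obtain k :: nat where k: "?Z [^]\<^bsub>?G\<^esub> k \<otimes>\<^bsub>?G\<^esub> braid_of n w \<in> ?P" using Cons.IH[OF w] by blast
    have wc: "braid_of n w \<in> carrier ?G" and Zc: "?Z \<in> carrier ?G"
      using word_closed[OF w] D_closed by simp_all
    note sc = sigma_closed[OF i]
    have Zk: "?Z [^]\<^bsub>?G\<^esub> k \<otimes>\<^bsub>?G\<^esub> x = x \<otimes>\<^bsub>?G\<^esub> ?Z [^]\<^bsub>?G\<^esub> k" if "x \<in> carrier ?G" for x and k :: nat
    proof -
      have "?Z \<otimes>\<^bsub>?G\<^esub> x = x \<otimes>\<^bsub>?G\<^esub> ?Z"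
        using that central by (auto simp: carrier_braid_group)
      then show ?thesis using group_commutes_pow[of ?Z x k] that Zc by simp
    qed
    have "?pos [i] \<in> ?P" using i by (auto simp: positive_braids_eq)
    have co: "?Z \<otimes>\<^bsub>?G\<^esub> inv\<^bsub>?G\<^esub> ?pos [i] \<in> ?P"
    proof -
      obtain c where c: "gen_cofactor n i = abs_pbraid c" by (rule pbraid_word)
      have eq: "abs_pbraid (c @ [i]) = abs_pbraid (?H @ ?H)"
        using gen_cofactor(2)[OF i] by (simp add: abs_pbraid_simps c absH full_twist_def)
      have cr: "set c \<subseteq> {1..<n}"
        using arg_cong[OF eq, of supp] H by (auto simp: supp.abs_eq)
      have "?Z = ?pos c \<otimes>\<^bsub>?G\<^esub> ?pos [i]"
        using positive_braid_eq_iff[THEN iffD2, OF _ _ eq] cr H i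
        by (simp add: Z positive_braid_append[symmetric])
      then have "?Z \<otimes>\<^bsub>?G\<^esub> inv\<^bsub>?G\<^esub> ?pos [i] = ?pos c" using cr sc by (simp add: m_assoc)
      then show ?thesis using cr by (auto simp: positive_braids_eq)
    qed
    show ?case
    proof (cases b)
      case True
      have "?Z [^]\<^bsub>?G\<^esub> k \<otimes>\<^bsub>?G\<^esub> (?pos [i] \<otimes>\<^bsub>?G\<^esub> braid_of n w) =
          ?pos [i] \<otimes>\<^bsub>?G\<^esub> (?Z [^]\<^bsub>?G\<^esub> k \<otimes>\<^bsub>?G\<^esub> braid_of n w)"
        using sc wc Zc Zk[OF sc, of k] by (simp only: m_assoc[symmetric] nat_pow_closed)
      then show ?thesis using P_mult[OF \<open>?pos [i] \<in> ?P\<close> k] cons[OF i w] True l by metis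
    next
      case False
      let ?t = "inv\<^bsub>?G\<^esub> ?pos [i]"
      have tc: "?t \<in> carrier ?G" using sc by simp
      have "?Z [^]\<^bsub>?G\<^esub> Suc k \<otimes>\<^bsub>?G\<^esub> (?t \<otimes>\<^bsub>?G\<^esub> braid_of n w) =
          ?Z \<otimes>\<^bsub>?G\<^esub> (?Z [^]\<^bsub>?G\<^esub> k \<otimes>\<^bsub>?G\<^esub> ?t) \<otimes>\<^bsub>?G\<^esub> braid_of n w"
        using tc wc Zc Zk[OF Zc, of k] by (simp add: m_assoc[symmetric])
      also have "\<dots> = ?Z \<otimes>\<^bsub>?G\<^esub> ?t \<otimes>\<^bsub>?G\<^esub> (?Z [^]\<^bsub>?G\<^esub> k \<otimes>\<^bsub>?G\<^esub> braid_of n w)"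
        unfolding Zk[OF tc, of k] using tc wc Zc by (simp add: m_assoc)
      finally have "?Z [^]\<^bsub>?G\<^esub> Suc k \<otimes>\<^bsub>?G\<^esub> (?t \<otimes>\<^bsub>?G\<^esub> braid_of n w) \<in> ?P"
        using P_mult[OF co k] by simp
      then show ?thesis using cons[OF i w, of b] False l by metis
    qed
  qed
  show ?thesis
  proof
    show "?P \<subseteq> carrier ?G" by (auto simp: positive_braids_eq)
    have "?pos [] \<in> ?P" by (auto simp: positive_braids_eq)
    then show "\<one>\<^bsub>?G\<^esub> \<in> ?P" by (simp add: positive_braid_def one_braid_group)
    show "a \<otimes>\<^bsub>?G\<^esub> b \<in> ?P" if "a \<in> ?P" "b \<in> ?P" for a b using P_mult that .
    show "\<exists>g\<in>?P. inv\<^bsub>?G\<^esub> g \<otimes>\<^bsub>?G\<^esub> a \<in> ?P \<and> inv\<^bsub>?G\<^esub> g \<otimes>\<^bsub>?G\<^esub> b \<in> ?P \<and>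
        (\<forall>d\<in>?P. inv\<^bsub>?G\<^esub> d \<otimes>\<^bsub>?G\<^esub> a \<in> ?P \<longrightarrow> inv\<^bsub>?G\<^esub> d \<otimes>\<^bsub>?G\<^esub> b \<in> ?P \<longrightarrow> inv\<^bsub>?G\<^esub> d \<otimes>\<^bsub>?G\<^esub> g \<in> ?P)"
      if ab: "a \<in> ?P" "b \<in> ?P" for a b
    proof -
      obtain u v where uv: "a = ?pos u" "b = ?pos v" "set u \<subseteq> {1..<n}" "set v \<subseteq> {1..<n}"
        using ab by (auto simp: positive_braids_eq)
      obtain g where g: "left_dvd g (abs_pbraid u)" "left_dvd g (abs_pbraid v)"
        "\<And>d. left_dvd d (abs_pbraid u) \<Longrightarrow> left_dvd d (abs_pbraid v) \<Longrightarrow> left_dvd d g"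
        using pbraid_gcd by blast
      obtain w where w: "g = abs_pbraid w" by (rule pbraid_word)
      have wr: "set w \<subseteq> {1..<n}"
        using left_dvd_supp[OF g(1)] uv w by (auto simp: supp.abs_eq)
      have "inv\<^bsub>?G\<^esub> d \<otimes>\<^bsub>?G\<^esub> ?pos w \<in> ?P"
        if d: "d \<in> ?P" "inv\<^bsub>?G\<^esub> d \<otimes>\<^bsub>?G\<^esub> a \<in> ?P" "inv\<^bsub>?G\<^esub> d \<otimes>\<^bsub>?G\<^esub> b \<in> ?P" for d
      proof -
        obtain e where "d = ?pos e" "set e \<subseteq> {1..<n}" using d(1) by (auto simp: positive_braids_eq)
        then show ?thesis using d(2,3) g(3) uv wr w by (simp add: inv_mult_positive_iff)
      qed
      moreover have "?pos w \<in> ?P" using wr by (auto simp: positive_braids_eq)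
      moreover have "inv\<^bsub>?G\<^esub> ?pos w \<otimes>\<^bsub>?G\<^esub> a \<in> ?P" "inv\<^bsub>?G\<^esub> ?pos w \<otimes>\<^bsub>?G\<^esub> b \<in> ?P"
        using g(1,2) uv wr w by (simp_all add: inv_mult_positive_iff)
      ultimately show ?thesis by blast
    qed
    show "braid_exponent (a \<otimes>\<^bsub>?G\<^esub> b) = braid_exponent a + braid_exponent b"
      if "a \<in> carrier ?G" "b \<in> carrier ?G" for a b
      using that
      by (auto simp: carrier_braid_group mult_braid_of braid_exponent_braid_of braid_words_append exponent_sum_def)
    show "0 < braid_exponent a" if a: "a \<in> ?P" "a \<noteq> \<one>\<^bsub>?G\<^esub>" for a
    proof -
      obtain w where w: "a = ?pos w" "set w \<subseteq> {1..<n}" using a by (auto simp: positive_braids_eq)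
      have "w \<noteq> []" using a(2) w by (auto simp: positive_braid_def one_braid_group)
      then show ?thesis using w by (simp add: braid_exponent_positive)
    qed
    show "finite {a \<in> ?P. braid_exponent a \<le> m}" for m
    proof -
      have "{a \<in> ?P. braid_exponent a \<le> m} \<subseteq> ?pos ` {w. set w \<subseteq> {1..<n} \<and> length w \<le> nat m}"
        by (auto simp: positive_braids_eq braid_exponent_positive)
      moreover have "finite {w. set w \<subseteq> {1..<n} \<and> length w \<le> nat m}"
        by (rule finite_lists_length_le) simp
      ultimately show ?thesis using finite_surj by blast
    qed
    show "Delta n \<in> ?P" using H by (auto simp: positive_braids_eq D)
    show "inv\<^bsub>?G\<^esub> Delta n \<otimes>\<^bsub>?G\<^esub> a \<otimes>\<^bsub>?G\<^esub> Delta n \<in> ?P" if "a \<in> ?P" for a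
    proof -
      obtain w where w: "a = ?pos w" "set w \<subseteq> {1..<n}" using \<open>a \<in> ?P\<close> by (auto simp: positive_braids_eq)
      let ?v = "map (\<lambda>i. n - i) w"
      have v: "set ?v \<subseteq> {1..<n}" using w(2) by fastforce
      have "?pos (w @ ?H) = ?pos (?H @ ?v)"
        using w(2) v H half_twist_flip[OF w(2)]
        by (subst positive_braid_eq_iff) (auto simp: abs_pbraid_simps absH)
      then have "a \<otimes>\<^bsub>?G\<^esub> Delta n = Delta n \<otimes>\<^bsub>?G\<^esub> ?pos ?v"
        using w v H by (simp add: positive_braid_append D)
      then have "inv\<^bsub>?G\<^esub> Delta n \<otimes>\<^bsub>?G\<^esub> a \<otimes>\<^bsub>?G\<^esub> Delta n = ?pos ?v"
        using w v D_closed by (simp add: m_assoc) (simp add: m_assoc[symmetric])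
      then show ?thesis using v by (auto simp: positive_braids_eq)
    qed
    show "?Z \<otimes>\<^bsub>?G\<^esub> a = a \<otimes>\<^bsub>?G\<^esub> ?Z" if "a \<in> carrier ?G" for a
      using that central by (auto simp: carrier_braid_group)
    show "\<exists>k::nat. Delta n [^]\<^bsub>?G\<^esub> k \<otimes>\<^bsub>?G\<^esub> a \<in> ?P" if "a \<in> carrier ?G" for a
    proof -
      obtain k :: nat where "?Z [^]\<^bsub>?G\<^esub> k \<otimes>\<^bsub>?G\<^esub> a \<in> ?P"
        using absorb \<open>a \<in> carrier ?G\<close> by (auto simp: carrier_braid_group)
      moreover have "?Z [^]\<^bsub>?G\<^esub> k = Delta n [^]\<^bsub>?G\<^esub> (2 * k)"
        using D_closed nat_pow_pow[of "Delta n" 2 k] by (simp add: numeral_2_eq_2)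
      ultimately show ?thesis by auto
    qed
    show "Delta n \<noteq> \<one>\<^bsub>?G\<^esub>"
    proof
      assume "Delta n = \<one>\<^bsub>?G\<^esub>"
      then have "?pos ?H = ?pos []" by (simp add: D positive_braid_def one_braid_group)
      then have "length ?H = 0"
        using braid_exponent_positive[OF H] braid_exponent_positive[of "[]" n] by simp
      then show False using set_half_twist_word[of n] assms by simp
    qed
  qed
qed

section \<open>Ultra summit sets of braids\<close>

context
  fixes n :: nat
  assumes n: "2 \<le> n"
begin

interpretation B: garside_group "braid_group n" "positive_braids n" "Delta n" braid_exponent
  by (rule garside_group_braid_group[OF n])

lemma braid_prefix_eq: "braid_prefix n = B.prefix"
  by (intro ext) (simp add: braid_prefix_def B.prefix_def)

lemma conjugate_eq: "conjugate n = B.conj_by"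
  by (intro ext) (simp add: conjugate_def B.conj_by_def)

lemma prefix_order_meet_eq:
  assumes "a \<in> carrier (braid_group n)" "b \<in> carrier (braid_group n)"
  shows "a \<sqinter>\<^bsub>prefix_order n\<^esub> b = B.meet a b"
proof -
  have g: "greatest (prefix_order n) m (Lower (prefix_order n) {a, b}) \<longleftrightarrow>
      m \<in> carrier (braid_group n) \<and> B.prefix m a \<and> B.prefix m b \<and>
      (\<forall>d\<in>carrier (braid_group n). B.prefix d a \<longrightarrow> B.prefix d b \<longrightarrow> B.prefix d m)" for m
    using assms by (auto simp: greatest_def Lower_def prefix_order_def braid_prefix_eq)
  have "m = B.meet a b" if "greatest (prefix_order n) m (Lower (prefix_order n) {a, b})" for m
    using that B.meet_props[OF assms] B.prefix_antisym[of m "B.meet a b"] unfolding g by blast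
  moreover have "greatest (prefix_order n) (B.meet a b) (Lower (prefix_order n) {a, b})"
    using B.meet_props[OF assms] unfolding g by blast
  ultimately show ?thesis unfolding Lattice.meet_def inf_def by (metis someI)
qed

lemma left_normal_form_eq: "left_normal_form n y p xs \<longleftrightarrow> B.normal_form y p xs"
proof -
  have "successively (left_weighted n) xs \<longleftrightarrow>
      successively (\<lambda>s t. B.meet (inv\<^bsub>braid_group n\<^esub> s \<otimes>\<^bsub>braid_group n\<^esub> Delta n) t = \<one>\<^bsub>braid_group n\<^esub>) xs"
    if "set xs \<subseteq> carrier (braid_group n)"
  proof (rule successively_cong)
    fix s t assume "s \<in> set xs" "t \<in> set xs"
    then have "s \<in> carrier (braid_group n)" "t \<in> carrier (braid_group n)" using that by auto
    then show "left_weighted n s t \<longleftrightarrow>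
        B.meet (inv\<^bsub>braid_group n\<^esub> s \<otimes>\<^bsub>braid_group n\<^esub> Delta n) t = \<one>\<^bsub>braid_group n\<^esub>"
      by (simp add: left_weighted_def complement_def prefix_order_meet_eq)
  qed simp
  then show ?thesis
    by (auto simp: left_normal_form_def B.normal_form_def braid_prod_def simple_braids_def braid_prefix_eq)
qed

lemma canonical_length_eq:
  assumes y: "y \<in> carrier (braid_group n)" "B.has_inf y p" "B.has_sup y q"
  shows "int (canonical_length n y) = q - p"
proof -
  have l: "int (length xs) = q - p" if "B.normal_form y p' xs" for p' xs
    using B.normal_form_props[OF that] B.has_inf_unique B.has_sup_unique y by fastforce
  obtain p' xs where nf: "B.normal_form y p' xs" using B.normal_form_exists y(1) by blast
  have "canonical_length n y = length xs"
    unfolding canonical_length_def left_normal_form_eq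
  proof (rule the_equality)
    fix k assume "\<exists>p xs. B.normal_form y p xs \<and> k = length xs"
    then show "k = length xs" using l l[OF nf] by fastforce
  qed (use nf in blast)
  then show ?thesis using l[OF nf] by simp
qed

lemma initial_factor_eq:
  assumes y: "y \<in> carrier (braid_group n)" "B.has_inf y p"
  shows "initial_factor n y = B.iota p y"
proof -
  have i: "(if xs = [] then \<one>\<^bsub>braid_group n\<^esub>
      else B.conj_by (hd xs) (Delta n [^]\<^bsub>braid_group n\<^esub> (- p'))) = B.iota p y"
    if "B.normal_form y p' xs" for p' xs
    using B.normal_form_props[OF that] B.has_inf_unique y by metis
  obtain p' xs where nf: "B.normal_form y p' xs" using B.normal_form_exists y(1) by blast
  show ?thesis
    unfolding initial_factor_def left_normal_form_eq conjugate_eq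
  proof (rule the_equality)
    show "\<exists>p' xs. B.normal_form y p' xs \<and> B.iota p y =
        (if xs = [] then \<one>\<^bsub>braid_group n\<^esub>
         else B.conj_by (hd xs) (Delta n [^]\<^bsub>braid_group n\<^esub> (- p')))"
      using nf i[OF nf] by metis
  qed (use i in blast)
qed

lemma has_sup_exists: "y \<in> carrier (braid_group n) \<Longrightarrow> \<exists>q. B.has_sup y q"
  using B.normal_form_exists B.normal_form_props(3) by blast

lemma has_inf_inverse:
  assumes "y \<in> carrier (braid_group n)" "B.has_sup y q"
  shows "B.has_inf (inv\<^bsub>braid_group n\<^esub> y) (- q)"
  using assms B.D_pow_prefix_inv_iff[of y q] B.D_pow_prefix_inv_iff[of y "q - 1"]
  by (simp add: B.has_inf_def B.has_sup_def)

lemma cycling_eq: "y \<in> carrier (braid_group n) \<Longrightarrow> B.has_inf y p \<Longrightarrow> cycling n y = B.cyc p y"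
  by (simp add: cycling_def B.cyc_def conjugate_eq initial_factor_eq)

text \<open>
  A conjugate of \<open>x\<close> that lies in an interval of the minimal possible width fills it.
\<close>

lemma summit_interval:
  assumes x: "x \<in> carrier (braid_group n)" and y: "y \<in> conjugates n x"
    and pq: "q - p = int (summit_length n x)"
    and b: "B.prefix (B.D_pow p) y" "B.prefix y (B.D_pow q)"
  shows "B.has_inf y p" "B.has_sup y q" "y \<in> SSS n x"
proof -
  have yc: "y \<in> carrier (braid_group n)" using x y by (auto simp: conjugates_def conjugate_eq)
  obtain p' where p': "B.has_inf y p'" using B.has_inf_exists yc by blast
  obtain q' where q': "B.has_sup y q'" using has_sup_exists yc by blast
  have "summit_length n x \<le> canonical_length n y"
    unfolding summit_length_def using y by (intro Least_le) blast
  moreover have l: "int (canonical_length n y) = q' - p'" using canonical_length_eq yc p' q' by blast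
  moreover have "p \<le> p'" "q' \<le> q"
    using B.has_inf_prefix_iff[OF p' yc] B.has_sup_prefix_iff[OF q' yc] b by auto
  ultimately have "p' = p" "q' = q" using pq by linarith+
  then show "B.has_inf y p" "B.has_sup y q" using p' q' by simp_all
  show "y \<in> SSS n x" using y l pq \<open>p' = p\<close> \<open>q' = q\<close> by (simp add: SSS_def)
qed

lemma cycling_pow_eq:
  assumes x: "x \<in> carrier (braid_group n)" and y: "y \<in> conjugates n x"
    and pq: "q - p = int (summit_length n x)" "p < q"
    and b: "B.prefix (B.D_pow p) y" "B.prefix y (B.D_pow q)"
  shows "(cycling n ^^ k) y = (B.cyc p ^^ k) y" "(B.cyc p ^^ k) y \<in> conjugates n x"
proof -
  have yc: "y \<in> carrier (braid_group n)" using x y by (auto simp: conjugates_def conjugate_eq)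
  show *: "(B.cyc p ^^ k) y \<in> conjugates n x" for k
  proof -
    obtain g where "g \<in> carrier (braid_group n)" "y = B.conj_by x g"
      using y by (auto simp: conjugates_def conjugate_eq)
    then show ?thesis
      using x yc by (auto simp: B.cyc_pow_eq_conj_by conjugates_def conjugate_eq B.conj_by_mult)
  qed
  show "(cycling n ^^ k) y = (B.cyc p ^^ k) y"
  proof (induction k)
    case (Suc k)
    have "B.has_inf ((B.cyc p ^^ k) y) p"
      using summit_interval(1)[OF x * pq(1)] B.cyc_pow_inf B.cyc_pow_sup yc b pq(2) by blast
    then show ?case using Suc yc by (simp add: cycling_eq)
  qed simp
qed

text \<open>
  All elements of the ultra summit set share their infimum and supremum, so that it can be
  described with one fixed \<open>p\<close>. The infimum is common because each of two elements has
  maximal infimum in the class; the supremum then follows from the canonical length. The set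
  is nonempty because cycling stays within a finite interval and hence becomes periodic.
\<close>

lemma USS_characterization:
  assumes x: "x \<in> carrier (braid_group n)" and l: "0 < summit_length n x"
  obtains p q where "p < q" "q - p = int (summit_length n x)" "USS n x \<noteq> {}"
    "USS n x = {y \<in> B.conj_by x ` carrier (braid_group n).
       B.prefix (B.D_pow p) y \<and> B.prefix y (B.D_pow q) \<and> B.recurrent p y}"
proof -
  let ?G = "braid_group n"
  have conj: "conjugates n x = B.conj_by x ` carrier ?G" by (simp add: conjugates_def conjugate_eq)
  have conj_closed: "y \<in> carrier ?G" if "y \<in> conjugates n x" for y using that x by (auto simp: conj)
  have "x \<in> conjugates n x" using x by (auto simp: conj image_iff intro!: bexI[of _ "\<one>\<^bsub>?G\<^esub>"])
  then have "\<exists>y\<in>conjugates n x. canonical_length n x = canonical_length n y" by blast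
  from LeastI[of "\<lambda>l. \<exists>y\<in>conjugates n x. l = canonical_length n y", OF this]
  have "\<exists>y\<in>conjugates n x. summit_length n x = canonical_length n y"
    unfolding summit_length_def .
  then obtain y where y: "y \<in> conjugates n x" "canonical_length n y = summit_length n x" by metis
  have yc: "y \<in> carrier ?G" using y conj_closed by blast
  obtain p where p: "B.has_inf y p" using B.has_inf_exists yc by blast
  obtain q where q: "B.has_sup y q" using has_sup_exists yc by blast
  have pq: "q - p = int (summit_length n x)" using canonical_length_eq[OF yc p q] y by simp
  then have "p < q" using l by linarith
  define U where "U = {y \<in> B.conj_by x ` carrier ?G.
       B.prefix (B.D_pow p) y \<and> B.prefix y (B.D_pow q) \<and> B.recurrent p y}"
  have U_USS: "U \<subseteq> USS n x"
  proof
    fix z assume z: "z \<in> U"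
    then have "z \<in> SSS n x" using summit_interval(3)[OF x _ pq] by (auto simp: U_def conj)
    moreover have "(cycling n ^^ k) z = (B.cyc p ^^ k) z" for k
      using z cycling_pow_eq(1)[OF x _ pq \<open>p < q\<close>] by (auto simp: U_def conj)
    ultimately show "z \<in> USS n x" using z by (auto simp: U_def USS_def B.recurrent_def)
  qed
  have bounds: "B.prefix (B.D_pow p) ((B.cyc p ^^ k) y)" "B.prefix ((B.cyc p ^^ k) y) (B.D_pow q)" for k
    using B.cyc_pow_inf B.cyc_pow_sup yc p q \<open>p < q\<close> by (auto simp: B.has_inf_def B.has_sup_def)
  have "finite (range (\<lambda>k. (B.cyc p ^^ k) y))"
    by (rule finite_subset[OF _ B.finite_interval[of p q]]) (use bounds yc in auto)
  then have "\<not> inj (\<lambda>k. (B.cyc p ^^ k) y)" using finite_imageD infinite_UNIV_nat by blast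
  then obtain i j where "(B.cyc p ^^ i) y = (B.cyc p ^^ j) y" "i \<noteq> j" by (auto simp: inj_def)
  then obtain i d where eq: "(B.cyc p ^^ i) y = (B.cyc p ^^ (d + i)) y" and d: "d > 0"
    by (metis linorder_neqE_nat less_imp_add_positive add.commute)
  define u where "u = (B.cyc p ^^ i) y"
  have "(B.cyc p ^^ d) u = u" using eq by (simp add: u_def funpow_add)
  then have "B.recurrent p u" using d by (auto simp: B.recurrent_def)
  moreover have "u \<in> conjugates n x"
    unfolding u_def using p q by (intro cycling_pow_eq(2)[OF x y(1) pq \<open>p < q\<close>]) (auto simp: B.has_inf_def B.has_sup_def)
  ultimately have u: "u \<in> U" using bounds[of i] by (simp add: U_def conj u_def)
  have uc: "u \<in> carrier ?G" using yc by (simp add: u_def)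
  have u_inf: "B.has_inf u p" using summit_interval(1)[OF x _ pq] u by (auto simp: U_def conj)
  have "USS n x \<subseteq> U"
  proof
    fix z assume z: "z \<in> USS n x"
    then have zx: "z \<in> conjugates n x" "canonical_length n z = summit_length n x"
      by (auto simp: USS_def SSS_def)
    have zc: "z \<in> carrier ?G" using zx conj_closed by blast
    obtain p' where p': "B.has_inf z p'" using B.has_inf_exists zc by blast
    obtain q' where q': "B.has_sup z q'" using has_sup_exists zc by blast
    have pq': "q' - p' = int (summit_length n x)" using canonical_length_eq[OF zc p' q'] zx by simp
    then have "p' < q'" using l by linarith
    have zb: "B.prefix (B.D_pow p') z" "B.prefix z (B.D_pow q')"
      using p' q' by (auto simp: B.has_inf_def B.has_sup_def)
    have rec: "B.recurrent p' z"
      using z cycling_pow_eq(1)[OF x zx(1) pq' \<open>p' < q'\<close> zb] by (auto simp: USS_def B.recurrent_def)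
    have conj_pos: "\<exists>a\<in>positive_braids n. w = B.conj_by v a"
      if vw: "v \<in> conjugates n x" "w \<in> conjugates n x" for v w
    proof -
      obtain g h where gh: "g \<in> carrier ?G" "v = B.conj_by x g" "h \<in> carrier ?G" "w = B.conj_by x h"
        using vw by (auto simp: conj)
      then have "w = B.conj_by v (inv\<^bsub>?G\<^esub> g \<otimes>\<^bsub>?G\<^esub> h)" using x by (simp add: B.conj_by_mult)
      then show ?thesis
        using B.conjugate_by_positive[of v "inv\<^bsub>?G\<^esub> g \<otimes>\<^bsub>?G\<^esub> h"] gh x by auto
    qed
    have "u \<in> conjugates n x" using u by (simp add: U_def conj)
    have "\<not> B.prefix (B.D_pow (p + 1)) z"
      using conj_pos[OF \<open>u \<in> conjugates n x\<close> zx(1)] B.recurrent_inf_maximal[OF uc, of p] u u_inf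
      by (auto simp: U_def B.has_inf_def)
    then have "p' \<le> p" using B.has_inf_prefix_iff[OF p' zc] by (metis not_less zless_imp_add1_zle)
    have "\<not> B.prefix (B.D_pow (p' + 1)) u"
      using conj_pos[OF zx(1) \<open>u \<in> conjugates n x\<close>] B.recurrent_inf_maximal[OF zc zb(1) _ rec] p'
      by (auto simp: B.has_inf_def)
    then have "p \<le> p'" using B.has_inf_prefix_iff[OF u_inf uc] by (metis not_less zless_imp_add1_zle)
    then have "p' = p" "q' = q" using \<open>p' \<le> p\<close> pq pq' by simp_all
    then show "z \<in> U" using zb rec zx(1) by (simp add: U_def conj)
  qed
  then have "USS n x = U" using U_USS by blast
  then show ?thesis using that[OF \<open>p < q\<close> pq] u by (auto simp: U_def)
qed

text \<open>
  A shortest nontrivial prefix of \<open>t\<close> whose conjugation stays in the ultra summit set.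
\<close>

lemma minimal_simple_below:
  assumes t: "t \<in> positive_braids n" "t \<noteq> \<one>\<^bsub>braid_group n\<^esub>" "B.prefix t (Delta n)"
    and "B.conj_by y t \<in> USS n x"
  obtains s where "minimal_simple n x y s" "s \<in> positive_braids n" "B.prefix s t"
proof -
  let ?Q = "\<lambda>s. s \<in> positive_braids n \<and> s \<noteq> \<one>\<^bsub>braid_group n\<^esub> \<and> B.prefix s t \<and> B.conj_by y s \<in> USS n x"
  have "?Q t" using assms by simp
  from ex_has_least_nat[of ?Q, OF this, of "\<lambda>s. nat (braid_exponent s)"]
  obtain s where s: "?Q s" "\<And>r. ?Q r \<Longrightarrow> nat (braid_exponent s) \<le> nat (braid_exponent r)"
    by blast
  have "minimal_simple n x y s"
    unfolding minimal_simple_def conjugate_eq braid_prefix_eq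
  proof (intro conjI ballI impI)
    show "s \<in> simple_braids n"
      using s(1) t B.prefix_trans[of s t "Delta n"] by (simp add: simple_braids_def braid_prefix_eq B.one_prefix)
    fix r assume "r \<in> carrier (braid_group n)"
      and "r \<noteq> \<one>\<^bsub>braid_group n\<^esub> \<and> B.prefix \<one>\<^bsub>braid_group n\<^esub> r \<and> B.prefix r s \<and> r \<noteq> s"
    then have r: "r \<in> positive_braids n" "r \<noteq> \<one>\<^bsub>braid_group n\<^esub>" "B.prefix r s" "r \<noteq> s"
      by (auto simp: B.one_prefix)
    have "0 < braid_exponent (inv\<^bsub>braid_group n\<^esub> r \<otimes>\<^bsub>braid_group n\<^esub> s)"
      using r s(1) by (intro B.L_pos) (simp_all add: B.prefix_def[symmetric] B.inv_mult_eq_one_iff)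
    then have "braid_exponent r < braid_exponent s" using r s(1) by (simp add: B.L_mult B.L_inv)
    moreover have "B.prefix r t" using B.prefix_trans[OF r(3)] s(1) r(1) t(1) by simp
    ultimately show "B.conj_by y r \<notin> USS n x"
      using s(2)[of r] r B.L_nonneg[OF r(1)] by fastforce
  qed (use s(1) in simp_all)
  then show ?thesis using that s(1) by blast
qed

text \<open>
  If the only arrow below a simple element \<open>e\<close> is labelled \<open>e\<close>, then conjugating \<open>y\<close> by any
  other nontrivial prefix of \<open>e\<close> leaves the ultra summit set, since below such a prefix there
  would be the label of another arrow.
\<close>

lemma unique_arrow:
  assumes y: "y \<in> USS n x"
    and arrows: "{(y', s, z) \<in> USS_arrows n x. y' = y \<and> braid_prefix n s e} = {(y, e, z0)}"
    and e: "e \<in> carrier (braid_group n)" "B.prefix e (Delta n)"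
  shows "B.conj_by y e \<in> USS n x"
    and "\<And>t. t \<in> positive_braids n \<Longrightarrow> t \<noteq> \<one>\<^bsub>braid_group n\<^esub> \<Longrightarrow> B.prefix t e \<Longrightarrow>
      B.conj_by y t \<in> USS n x \<Longrightarrow> t = e"
proof -
  have "(y, e, z0) \<in> USS_arrows n x" using arrows by blast
  then show "B.conj_by y e \<in> USS n x"
    by (auto simp: USS_arrows_def minimal_simple_def conjugate_eq)
  fix t assume t: "t \<in> positive_braids n" "t \<noteq> \<one>\<^bsub>braid_group n\<^esub>" "B.prefix t e" "B.conj_by y t \<in> USS n x"
  have tD: "B.prefix t (Delta n)" using B.prefix_trans[OF t(3) e(2)] t(1) e(1) by simp
  obtain s where s: "minimal_simple n x y s" "s \<in> positive_braids n" "B.prefix s t"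
    using minimal_simple_below[OF t(1,2) tD t(4)] by blast
  have "B.prefix s e" using B.prefix_trans[OF s(3) t(3)] s(2) t(1) e(1) by simp
  then have "(y, s, conjugate n y s) \<in> {(y', s, z) \<in> USS_arrows n x. y' = y \<and> braid_prefix n s e}"
    using s(1) y by (simp add: USS_arrows_def braid_prefix_eq)
  then have "s = e" unfolding arrows by simp
  then show "t = e" using B.prefix_antisym[of t e] t s(3) e(1) by simp
qed

text \<open>
  The \<open>\<tau>\<close>-image of an orbit is again an orbit, and two periodic orbits that share a point
  coincide.
\<close>

lemma two_cycling_orbits:
  assumes x: "x \<in> carrier (braid_group n)" and min: "USS_minimal n x"
  shows "(\<exists>O\<^sub>1\<in>USS_orbits n x. \<exists>O\<^sub>2\<in>USS_orbits n x.
            O\<^sub>1 \<inter> O\<^sub>2 = {} \<and> USS n x = O\<^sub>1 \<union> O\<^sub>2 \<and> tau n ` O\<^sub>1 = O\<^sub>2) \<or>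
         (\<exists>O\<^sub>0\<in>USS_orbits n x. USS n x = O\<^sub>0 \<and> tau n ` O\<^sub>0 = O\<^sub>0)"
proof -
  let ?G = "braid_group n" and ?U = "USS n x"
  have l: "0 < summit_length n x" using min by (simp add: USS_minimal_def)
  obtain p q where "p < q" and pq: "q - p = int (summit_length n x)" and "?U \<noteq> {}"
    and U: "?U = {y \<in> B.conj_by x ` carrier ?G.
       B.prefix (B.D_pow p) y \<and> B.prefix y (B.D_pow q) \<and> B.recurrent p y}"
    using USS_characterization[OF x l] by blast
  have conj: "conjugates n x = B.conj_by x ` carrier ?G" by (simp add: conjugates_def conjugate_eq)
  have U_carrier: "y \<in> carrier ?G" if "y \<in> ?U" for y using that x by (auto simp: U)
  have U_bounds: "B.has_inf y p" "B.has_sup y q" if "y \<in> ?U" for y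
    using that summit_interval[OF x _ pq] by (auto simp: U conj)
  have iotas: "initial_factor n y = B.iota p y"
    "initial_factor n (inv\<^bsub>?G\<^esub> y) = B.iota (- q) (inv\<^bsub>?G\<^esub> y)" if "y \<in> ?U" for y
    using U_bounds[OF that] U_carrier[OF that] has_inf_inverse by (simp_all add: initial_factor_eq)
  have black: "\<exists>z. {(y', s, z) \<in> USS_arrows n x. y' = y \<and> braid_prefix n s (B.iota p y)} = {(y, B.iota p y, z)}"
    if "y \<in> ?U" for y
  proof -
    have "\<exists>z. black_arrows_from n x y = {(y, initial_factor n y, z)}"
      using min that unfolding USS_minimal_def by blast
    then show ?thesis unfolding black_arrows_from_def iotas[OF that] .
  qed
  have grey: "\<exists>z. {(y', s, z) \<in> USS_arrows n x. y' = y \<and> braid_prefix n s (B.iota (- q) (inv\<^bsub>?G\<^esub> y))} =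
      {(y, B.iota (- q) (inv\<^bsub>?G\<^esub> y), z)}" if "y \<in> ?U" for y
  proof -
    have "\<exists>z. grey_arrows_from n x y = {(y, initial_factor n (inv\<^bsub>?G\<^esub> y), z)}"
      using min that unfolding USS_minimal_def by blast
    then show ?thesis unfolding grey_arrows_from_def iotas[OF that] .
  qed
  obtain y0 where y0: "y0 \<in> ?U" using \<open>?U \<noteq> {}\<close> by blast
  let ?O = "orbit (B.cyc p) y0" and ?t = "\<lambda>y. B.conj_by y (Delta n)"
  have UO: "?U = ?O \<union> ?t ` ?O"
    unfolding U
  proof (rule B.two_orbits[OF x \<open>p < q\<close>], unfold U[symmetric])
    show "\<not> B.prefix y (B.D_pow (q - 1))" if "y \<in> ?U" for y
      using U_bounds[OF that] by (simp add: B.has_sup_def)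
    show "t = B.iota p y"
      if "y \<in> ?U" "t \<in> positive_braids n" "t \<noteq> \<one>\<^bsub>?G\<^esub>" "B.prefix t (B.iota p y)" "B.conj_by y t \<in> ?U" for y t
    proof -
      obtain z where z: "{(y', s, z) \<in> USS_arrows n x. y' = y \<and> braid_prefix n s (B.iota p y)} =
          {(y, B.iota p y, z)}"
        using black[OF \<open>y \<in> ?U\<close>] by blast
      show ?thesis
        by (rule unique_arrow(2)[OF that(1) z _ _ that(2-5)])
          (simp_all add: B.iota_prefix_D U_carrier[OF that(1)])
    qed
    show "B.conj_by y (B.iota (- q) (inv\<^bsub>?G\<^esub> y)) \<in> ?U" if "y \<in> ?U" for y
    proof -
      obtain z where z: "{(y', s, z) \<in> USS_arrows n x. y' = y \<and>
          braid_prefix n s (B.iota (- q) (inv\<^bsub>?G\<^esub> y))} = {(y, B.iota (- q) (inv\<^bsub>?G\<^esub> y), z)}"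
        using grey[OF \<open>y \<in> ?U\<close>] by blast
      show ?thesis
        by (rule unique_arrow(1)[OF that z])
          (simp_all add: B.iota_prefix_D U_carrier[OF that])
    qed
    show "t = B.iota (- q) (inv\<^bsub>?G\<^esub> y)"
      if "y \<in> ?U" "t \<in> positive_braids n" "t \<noteq> \<one>\<^bsub>?G\<^esub>" "B.prefix t (B.iota (- q) (inv\<^bsub>?G\<^esub> y))"
        "B.conj_by y t \<in> ?U" for y t
    proof -
      obtain z where z: "{(y', s, z) \<in> USS_arrows n x. y' = y \<and>
          braid_prefix n s (B.iota (- q) (inv\<^bsub>?G\<^esub> y))} = {(y, B.iota (- q) (inv\<^bsub>?G\<^esub> y), z)}"
        using grey[OF \<open>y \<in> ?U\<close>] by blast
      show ?thesis
        by (rule unique_arrow(2)[OF that(1) z _ _ that(2-5)])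
          (simp_all add: B.iota_prefix_D U_carrier[OF that(1)])
    qed
    show "y0 \<in> ?U" by (rule y0)
  qed
  have tau: "tau n = ?t" by (intro ext) (simp add: tau_def conjugate_eq)
  have orbits: "cycling_orbit n y = orbit (B.cyc p) y" if "y \<in> ?U" for y
    using that cycling_pow_eq(1)[OF x _ pq \<open>p < q\<close>]
    by (auto simp: U conj cycling_orbit_def orbit_def)
  have "y0 \<in> ?O" by (rule orbit_self)
  then have ty0: "?t y0 \<in> ?U" unfolding UO by blast
  have orbit_tau: "orbit (B.cyc p) (?t y) = ?t ` orbit (B.cyc p) y" if "y \<in> ?U" for y
    using B.cyc_pow_conj_D[of y _ p 1] U_carrier[OF that] by (auto simp: orbit_def)
  have O: "?O \<in> USS_orbits n x" "?t ` ?O \<in> USS_orbits n x"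
    using orbits[OF y0] orbits[OF ty0] orbit_tau[OF y0] y0 ty0 unfolding USS_orbits_def by (metis imageI)+
  show ?thesis
  proof (cases "?O \<inter> ?t ` ?O = {}")
    case True
    then show ?thesis using O UO unfolding tau by blast
  next
    case False
    then obtain z where z: "z \<in> ?O" "?t z \<in> ?O" by blast
    obtain N where N: "(B.cyc p ^^ N) y0 = y0" "N > 0" using y0 by (auto simp: U B.recurrent_def)
    have "z \<in> ?U" using z(1) UO by blast
    have "?t ` ?O = orbit (B.cyc p) (?t z)"
      using orbit_eq[OF N z(1)] orbit_tau[OF \<open>z \<in> ?U\<close>] by simp
    also have "\<dots> = ?O" by (rule orbit_eq[OF N z(2)])
    finally show ?thesis using O UO unfolding tau by auto
  qed
qed

end

text \<open>
  In the trivial group every normal form is empty.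
\<close>

lemma summit_length_trivial:
  assumes "n < 2" "x \<in> carrier (braid_group n)"
  shows "summit_length n x = 0"
proof -
  interpret group "braid_group n" by (rule group_braid_group)
  have "braid_words n = {[]}" using assms(1) by (auto simp: braid_words_def)
  then have carrier: "carrier (braid_group n) = {\<one>\<^bsub>braid_group n\<^esub>}"
    by (simp add: carrier_braid_group one_braid_group)
  have no_factors: "simple_braids n - {\<one>\<^bsub>braid_group n\<^esub>, Delta n} = {}"
    by (auto simp: simple_braids_def carrier)
  have "canonical_length n \<one>\<^bsub>braid_group n\<^esub> = 0"
    unfolding canonical_length_def
  proof (rule the_equality)
    have "left_normal_form n \<one>\<^bsub>braid_group n\<^esub> 0 []"
      by (simp add: left_normal_form_def braid_prod_def)
    then show "\<exists>p xs. left_normal_form n \<one>\<^bsub>braid_group n\<^esub> p xs \<and> 0 = length xs"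
      by (intro exI[of _ 0] exI[of _ "[]"]) simp
    show "k = 0" if "\<exists>p xs. left_normal_form n \<one>\<^bsub>braid_group n\<^esub> p xs \<and> k = length xs" for k
      using that no_factors by (auto simp: left_normal_form_def)
  qed
  moreover have "\<one>\<^bsub>braid_group n\<^esub> \<in> conjugates n x"
    using assms(2) by (simp add: conjugates_def conjugate_def carrier)
  ultimately show ?thesis unfolding summit_length_def by (intro Least_eq_0) force
qed

theorem corollary4p4:
  fixes n :: nat and x :: braid
  assumes "x \<in> carrier (braid_group n)"
    and "USS_minimal n x"
  shows "(\<exists>O\<^sub>1\<in>USS_orbits n x. \<exists>O\<^sub>2\<in>USS_orbits n x.
            O\<^sub>1 \<inter> O\<^sub>2 = {} \<and> USS n x = O\<^sub>1 \<union> O\<^sub>2 \<and> tau n ` O\<^sub>1 = O\<^sub>2) \<or>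
         (\<exists>O\<^sub>0\<in>USS_orbits n x. USS n x = O\<^sub>0 \<and> tau n ` O\<^sub>0 = O\<^sub>0)"
proof (cases "2 \<le> n")
  case True
  then show ?thesis using assms by (rule two_cycling_orbits)
next
  case False
  then have "summit_length n x = 0" using summit_length_trivial assms(1) by simp
  then show ?thesis using assms(2) by (simp add: USS_minimal_def)
qed

end
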